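(* For each $c>0$, there is a probability density $f$ on $\mathbb{R}$ with $\int_{\mathbb{R}} v f(v)\,dv=0$ and $\int_{\mathbb{R}} v^2 f(v)\,dv=1$, and an $f(v)\,dv$-chaotic family $\{F^N\sigma^N\}_{N\in\mathbb{N}}$ (where $F^N$ is a probability density on $S^{N-1}(\sqrt N)$ with respect to $\sigma^N$), such that $$\limsup_{N\to\infty}\frac{-\langle \log F^N,\,L_NF^N\rangle}{H_N(F^N)}\le c .$$ For each $c$, the density $f$ is smooth and bounded, and has moments of all orders.
   Context: $S^{N-1}(\sqrt N)\subset\mathbb{R}^N$ is the sphere of radius $\sqrt N$ centred at $0$, with points $V=(v_1,\dots,v_N)$, and $\sigma^N$ is the uniform probability measure on it. $\langle\cdot,\cdot\rangle$ is the inner product of $L^2(S^{N-1}(\sqrt N),\sigma^N)$, i.e. $\langle\varphi,\psi\rangle=\int\varphi\psi\,d\sigma^N$. For $i<j$ and $\theta\in[0,2\pi)$, $R_{i,j,\theta}V$ is obtained from $V$ by leaving $v_k$ unchanged for $k\ne i,j$ and replacing $(v_i,v_j)$ by $((\cos\theta)v_i-(\sin\theta)v_j,\ (\sin\theta)v_i+(\cos\theta)v_j)$. The Kac transition operator is $$Q_N\varphi(V)=\binom N2^{-1}\sum_{i<j}\frac1{2\pi}\int_0^{2\pi}\varphi(R_{i,j,\theta}V)\,d\theta ,$$ and $L_N=N(Q_N-I)$, with $I$ the identity operator. For a probability density $F^N$ with respect to $\sigma^N$, $H_N(F^N)=\int F^N\log F^N\,d\sigma^N$. Chaos: let $\mu$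 be a Borel probability measure on $\mathbb{R}$ and, for each $N$, $\mu^{(N)}$ a probability measure on $S^{N-1}(\sqrt N)$. The sequence $\{\mu^{(N)}\}_{N\in\mathbb N}$ is $\mu$-chaotic if (i) each $\mu^{(N)}$ is symmetric under interchange of the variables $v_1,\dots,v_N$; and (ii) for each fixed positive integer $k$, the marginal $P_k\mu^{(N)}$ of $\mu^{(N)}$ on the first $k$ coordinates $(v_1,\dots,v_k)$ converges, as $N\to\infty$, to $\mu^{\otimes k}$ weakly against bounded continuous test functions on $\mathbb{R}^k$. *)

theory Defs
  imports "HOL-Probability.Probability"
begin

text \<open>
  Points of \<open>\<real>\<^sup>N\<close> are extensional functions on \<open>{..<N}\<close>, so that the dimension can vary;
  coordinates are numbered \<open>0, \<dots>, N - 1\<close>.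
\<close>

definition kac_sphere :: "nat \<Rightarrow> (nat \<Rightarrow> real) set" where
  "kac_sphere N = {V \<in> extensional {..<N}. L2_set V {..<N} = sqrt (real N)}"

definition unit_cball :: "nat \<Rightarrow> (nat \<Rightarrow> real) set" where
  "unit_cball N = {V \<in> extensional {..<N}. L2_set V {..<N} \<le> 1}"

text \<open>
  The uniform probability measure on the sphere is the normalised cone measure: the image of the
  uniform distribution on the unit ball under radial projection. (Equivalently, a set \<open>A\<close> has
  the proportion of the volume of the ball of radius \<open>sqrt N\<close> that is filled by the cone with
  base \<open>A\<close> and apex 0.) The origin, where the projection is meaningless, is a null set and is
  removed by restricting to the sphere.
\<close>

definition radial_proj :: "nat \<Rightarrow> (nat \<Rightarrow> real) \<Rightarrow> nat \<Rightarrow> real" where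
  "radial_proj N V = (\<lambda>i\<in>{..<N}. sqrt (real N) * V i / L2_set V {..<N})"

definition sphere_measure :: "nat \<Rightarrow> (nat \<Rightarrow> real) measure" where
  "sphere_measure N =
     restrict_space
       (distr (uniform_measure (Pi\<^sub>M {..<N} (\<lambda>_. lborel)) (unit_cball N))
              (Pi\<^sub>M {..<N} (\<lambda>_. borel)) (radial_proj N))
       (kac_sphere N)"

definition prob_density :: "'a measure \<Rightarrow> ('a \<Rightarrow> real) \<Rightarrow> bool" where
  "prob_density M f \<longleftrightarrow>
     f \<in> borel_measurable M \<and> (\<forall>x\<in>space M. 0 \<le> f x) \<and> (\<integral>\<^sup>+x. ennreal (f x) \<partial>M) = 1"

definition square_integrable :: "'a measure \<Rightarrow> ('a \<Rightarrow> real) \<Rightarrow> bool" where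
  "square_integrable M f \<longleftrightarrow> f \<in> borel_measurable M \<and> integrable M (\<lambda>x. (f x)\<^sup>2)"

definition sphere_inner :: "nat \<Rightarrow> ((nat \<Rightarrow> real) \<Rightarrow> real) \<Rightarrow> ((nat \<Rightarrow> real) \<Rightarrow> real) \<Rightarrow> real" where
  "sphere_inner N \<phi> \<psi> = (\<integral>V. \<phi> V * \<psi> V \<partial>sphere_measure N)"

definition kac_rotation :: "nat \<Rightarrow> nat \<Rightarrow> real \<Rightarrow> (nat \<Rightarrow> real) \<Rightarrow> nat \<Rightarrow> real" where
  "kac_rotation i j \<theta> V =
     V(i := cos \<theta> * V i - sin \<theta> * V j, j := sin \<theta> * V i + cos \<theta> * V j)"

definition kac_Q :: "nat \<Rightarrow> ((nat \<Rightarrow> real) \<Rightarrow> real) \<Rightarrow> (nat \<Rightarrow> real) \<Rightarrow> real" where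
  "kac_Q N \<phi> V =
     1 / real (N choose 2) *
     (\<Sum>j<N. \<Sum>i<j. 1 / (2 * pi) * (LBINT \<theta>:{0..2*pi}. \<phi> (kac_rotation i j \<theta> V)))"

definition kac_L :: "nat \<Rightarrow> ((nat \<Rightarrow> real) \<Rightarrow> real) \<Rightarrow> (nat \<Rightarrow> real) \<Rightarrow> real" where
  "kac_L N \<phi> V = real N * (kac_Q N \<phi> V - \<phi> V)"

definition sphere_entropy :: "nat \<Rightarrow> ((nat \<Rightarrow> real) \<Rightarrow> real) \<Rightarrow> real" where
  "sphere_entropy N F = (\<integral>V. F V * ln (F V) \<partial>sphere_measure N)"

definition marginal :: "nat \<Rightarrow> (nat \<Rightarrow> real) measure \<Rightarrow> (nat \<Rightarrow> real) measure" where
  "marginal k M = distr M (Pi\<^sub>M {..<k} (\<lambda>_. borel)) (\<lambda>V. restrict V {..<k})"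

text \<open>
  Continuity of test functions is with respect to the product topology on \<open>nat \<Rightarrow> real\<close>, whose
  restriction to \<open>extensional {..<k}\<close> is the usual topology of \<open>\<real>\<^sup>k\<close>. The marginal on \<open>k\<close>
  coordinates is meaningful only for \<open>N \<ge> k\<close>, which is immaterial in the limit.
\<close>

definition chaotic :: "real measure \<Rightarrow> (nat \<Rightarrow> (nat \<Rightarrow> real) measure) \<Rightarrow> bool" where
  "chaotic \<mu> M \<longleftrightarrow>
     prob_space \<mu> \<and> sets \<mu> = sets borel \<and>
     (\<forall>N\<ge>1. prob_space (M N) \<and>
        sets (M N) = sets (restrict_space (Pi\<^sub>M {..<N} (\<lambda>_. borel)) (kac_sphere N))) \<and>
     (\<forall>N\<ge>1. \<forall>p. p permutes {..<N} \<longrightarrow> distr (M N) (M N) (\<lambda>V. V \<circ> p) = M N) \<and>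
     (\<forall>k\<ge>1. \<forall>\<phi> :: (nat \<Rightarrow> real) \<Rightarrow> real.
        continuous_on (extensional {..<k}) \<phi> \<and> bounded (\<phi> ` extensional {..<k}) \<longrightarrow>
        (\<lambda>N. \<integral>x. \<phi> x \<partial>marginal k (M N))
          \<longlonglongrightarrow> (\<integral>x. \<phi> x \<partial>Pi\<^sub>M {..<k} (\<lambda>_. \<mu>)))"

definition smooth_real :: "(real \<Rightarrow> real) \<Rightarrow> bool" where
  "smooth_real f \<longleftrightarrow> (\<forall>n x. (deriv ^^ n) f differentiable at x)"

text \<open>
  Conditions under which the entropy production and the entropy are genuine real numbers and their
  quotient is defined: \<open>F\<close> and \<open>log F\<close> lie in \<open>L\<^sup>2\<close> (on which \<open>L\<^sub>N\<close> is a bounded operator), and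
  the entropy does not vanish (so that it is positive). Positivity of \<open>F\<close> is needed because \<open>ln 0 = 0\<close> here.
\<close>

definition entropy_ratio_defined :: "nat \<Rightarrow> ((nat \<Rightarrow> real) \<Rightarrow> real) \<Rightarrow> bool" where
  "entropy_ratio_defined N F \<longleftrightarrow>
     (AE V in sphere_measure N. 0 < F V) \<and>
     square_integrable (sphere_measure N) F \<and>
     square_integrable (sphere_measure N) (\<lambda>V. ln (F V)) \<and>
     sphere_entropy N F \<noteq> 0"

end

theory Submission
  imports Defs "HOL-Computational_Algebra.Polynomial" "HOL-Real_Asymp.Real_Asymp"
begin

text \<open>
  Let \<open>f\<close> be the density of a mixture of two centred Gaussians: a particle is hot with a small probability
  \<open>d\<close> and then has variance \<open>1 / (2 * d)\<close>, and otherwise it is cold with variance \<open>1 / (2 * (1 - d))\<close>.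
  Each of the two populations carries half of the energy. The probability measures on the spheres are
  obtained by projecting \<open>N\<close> independent particles with law \<open>f\<close> radially to the sphere. They are
  \<open>f\<close>-chaotic by the law of large numbers, since the projection rescales the particles by a factor that
  tends to 1 (\<open>projected_iid_chaos\<close>).

  The entropy production is of order \<open>N * d * ln (1 / d)\<close>. A collision of two particles of the same
  temperature leaves their joint law invariant, so only collisions between hot and cold particles count.
  They have frequency of order \<open>d\<close>, and each of them changes the logarithm of the density by at most a
  multiple of \<open>ln (1 / d)\<close> (\<open>product_dissipation_bound\<close>). This computation takes place in the flat space,
  where the density is a product. It passes to the sphere because the radial projection commutes with
  rotations and entropy dissipation along a rotation decreases under such maps
  (\<open>entropy_dissipation_projection\<close>). All integrals exist: relative to the hot Gaussian the density \<open>f\<close> lies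
  between positive constants, and the uniform measure on the sphere is the projection of a vector of
  independent centred Gaussians of any common variance (\<open>sphere_measure_eq_gauss\<close>), so the
  densities on the sphere are bounded and bounded away from 0.

  The entropy is at least a multiple of \<open>N\<close> that does not depend on \<open>d\<close>. Most particles are cold, so the
  sum of the absolute values of the coordinates is smaller than under the uniform measure by a fixed
  factor. The event that expresses this has probability tending to 1 (\<open>projected_iid_low_l1\<close>), but its
  uniform measure is at most \<open>exp (- \<eta> * N)\<close> (\<open>sphere_low_l1_exponentially_small\<close>), and this forces
  the entropy to be at least about \<open>\<eta> * N\<close> (\<open>entropy_ge_of_event\<close>). The ratio is therefore at most
  \<open>16 * d * ln (1 / d) / \<eta>\<close> in the limit, which is small for small \<open>d\<close>.
\<close>

section \<open>Densities of product measures\<close>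

lemma PiM_density:
  fixes u :: "'b \<Rightarrow> ennreal" and I :: "'i set"
  assumes "finite I" and M: "sigma_finite_measure M" and [measurable]: "u \<in> borel_measurable M"
    and D: "sigma_finite_measure (density M u)"
  shows "PiM I (\<lambda>_. density M u) = density (PiM I (\<lambda>_. M)) (\<lambda>x. \<Prod>i\<in>I. u (x i))"
proof -
  interpret D: product_sigma_finite "\<lambda>_::'i. density M u" using D by (simp add: product_sigma_finite_def)
  interpret M: product_sigma_finite "\<lambda>_::'i. M" using M by (simp add: product_sigma_finite_def)
  show ?thesis
  proof (rule D.PiM_eqI[symmetric])
    show "finite I" by fact
    show "sets (density (PiM I (\<lambda>_. M)) (\<lambda>x. \<Prod>i\<in>I. u (x i))) = sets (PiM I (\<lambda>_. density M u))"
      by (simp cong: sets_PiM_cong)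
    fix A :: "'i \<Rightarrow> 'b set" assume A: "\<And>i. i \<in> I \<Longrightarrow> A i \<in> sets (density M u)"
    have [measurable]: "Pi\<^sub>E I A \<in> sets (PiM I (\<lambda>_. M))"
      using A \<open>finite I\<close> by (intro sets_PiM_I_finite) auto
    have "emeasure (density (PiM I (\<lambda>_. M)) (\<lambda>x. \<Prod>i\<in>I. u (x i))) (Pi\<^sub>E I A) =
        (\<integral>\<^sup>+x. (\<Prod>i\<in>I. u (x i)) * indicator (Pi\<^sub>E I A) x \<partial>PiM I (\<lambda>_. M))"
      by (subst emeasure_density) auto
    also have "\<dots> = (\<integral>\<^sup>+x. (\<Prod>i\<in>I. u (x i) * indicator (A i) (x i)) \<partial>PiM I (\<lambda>_. M))"
    proof (rule nn_integral_cong)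
      fix x assume x: "x \<in> space (PiM I (\<lambda>_. M))"
      then have "(indicator (Pi\<^sub>E I A) x :: ennreal) = (\<Prod>i\<in>I. indicator (A i) (x i))"
        using \<open>finite I\<close> by (auto simp: indicator_def space_PiM PiE_iff prod_zero_iff)
      then show "(\<Prod>i\<in>I. u (x i)) * indicator (Pi\<^sub>E I A) x = (\<Prod>i\<in>I. u (x i) * indicator (A i) (x i))"
        by (simp add: prod.distrib)
    qed
    also have "\<dots> = (\<Prod>i\<in>I. \<integral>\<^sup>+x. u x * indicator (A i) x \<partial>M)"
      using A \<open>finite I\<close> by (subst M.product_nn_integral_prod) auto
    also have "\<dots> = (\<Prod>i\<in>I. emeasure (density M u) (A i))"
      using A by (intro prod.cong) (auto simp: emeasure_density)
    finally show "emeasure (density (PiM I (\<lambda>_. M)) (\<lambda>x. \<Prod>i\<in>I. u (x i))) (Pi\<^sub>E I A) = \<dots>" .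
  qed
qed

section \<open>Lebesgue measure under dilations\<close>

lemma PiM_lborel_dilation:
  fixes r :: real and I :: "'i set"
  assumes "finite I" "r > 0"
  shows "density (distr (PiM I (\<lambda>_. lborel)) (PiM I (\<lambda>_. lborel)) (\<lambda>x. \<lambda>i\<in>I. r * x i))
           (\<lambda>_. ennreal (r ^ card I)) = PiM I (\<lambda>_. lborel)" (is "?P = ?L")
proof -
  interpret L: product_sigma_finite "\<lambda>_::'i. lborel :: real measure"
    by (simp add: product_sigma_finite_def sigma_finite_lborel)
  show ?thesis
  proof (rule L.PiM_eqI)
    fix A :: "'i \<Rightarrow> real set" assume A: "\<And>i. i \<in> I \<Longrightarrow> A i \<in> sets lborel"
    have [measurable]: "Pi\<^sub>E I A \<in> sets ?L"
      using A \<open>finite I\<close> by (intro sets_PiM_I_finite) auto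
    have pre: "(\<lambda>x. \<lambda>i\<in>I. r * x i) -` Pi\<^sub>E I A \<inter> space ?L = Pi\<^sub>E I (\<lambda>i. (\<lambda>t. r * t) -` A i)"
      by (auto simp: space_PiM PiE_iff)
    have scale: "emeasure lborel B = ennreal r * emeasure lborel ((\<lambda>t. r * t) -` B)" if [measurable]: "B \<in> sets borel" for B
    proof -
      have [measurable]: "(\<lambda>t. r * t) -` B \<in> sets borel"
        using measurable_sets[of "\<lambda>t. r * t" borel borel B] by simp
      have "emeasure lborel B = (\<integral>\<^sup>+x. indicator B x \<partial>lborel)" by simp
      also have "\<dots> = ennreal r * (\<integral>\<^sup>+x. indicator B (0 + r * x) \<partial>lborel)"
        using \<open>r > 0\<close> by (subst nn_integral_real_affine[of _ r 0]) auto
      also have "(\<integral>\<^sup>+x. indicator B (0 + r * x) \<partial>lborel) = (\<integral>\<^sup>+x. indicator ((\<lambda>t. r * t) -` B) x \<partial>lborel)"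
        by (intro nn_integral_cong) (auto simp: indicator_def)
      finally show ?thesis by simp
    qed
    have "emeasure ?P (Pi\<^sub>E I A) = ennreal (r ^ card I) * emeasure ?L (Pi\<^sub>E I (\<lambda>i. (\<lambda>t. r * t) -` A i))"
      by (subst emeasure_density) (auto simp: nn_integral_cmult emeasure_distr pre[symmetric])
    also have "emeasure ?L (Pi\<^sub>E I (\<lambda>i. (\<lambda>t. r * t) -` A i)) = (\<Prod>i\<in>I. emeasure lborel ((\<lambda>t. r * t) -` A i))"
    proof (rule L.emeasure_PiM)
      fix i assume "i \<in> I"
      then show "(\<lambda>t. r * t) -` A i \<in> sets lborel"
        using measurable_sets[of "\<lambda>t. r * t" borel borel "A i"] A by simp
    qed fact
    also have "ennreal (r ^ card I) * \<dots> = (\<Prod>i\<in>I. ennreal r * emeasure lborel ((\<lambda>t. r * t) -` A i))"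
      using \<open>r > 0\<close> by (simp add: prod.distrib ennreal_power)
    also have "\<dots> = (\<Prod>i\<in>I. emeasure lborel (A i))"
      using A scale by (intro prod.cong) auto
    finally show "emeasure ?P (Pi\<^sub>E I A) = \<dots>" .
  qed (use assms in auto)
qed

text \<open>
  On a cone the ball of radius \<open>sqrt y\<close> is a dilation of the unit ball, so its share of the cone
  depends on the cone only through a constant factor.
\<close>
lemma cone_ball_volume:
  fixes y :: real
  assumes "y > 0" and [measurable]: "B \<in> sets (PiM {..<N} (\<lambda>_. lborel))"
    and cone: "\<And>r x. r > 0 \<Longrightarrow> x \<in> space (PiM {..<N} (\<lambda>_. lborel :: real measure)) \<Longrightarrow>
       (\<lambda>i\<in>{..<N}. r * x i) \<in> B \<longleftrightarrow> x \<in> B"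
  shows "emeasure (PiM {..<N} (\<lambda>_. lborel)) {x \<in> B. (\<Sum>i<N. (x i)\<^sup>2) \<le> y} =
     ennreal (sqrt y ^ N) * emeasure (PiM {..<N} (\<lambda>_. lborel)) (B \<inter> unit_cball N)"
proof -
  let ?L = "PiM {..<N} (\<lambda>_. lborel :: real measure)"
  let ?S = "\<lambda>x. \<lambda>i\<in>{..<N}. sqrt y * x i"
  have sp: "B \<subseteq> space ?L" by (rule sets.sets_into_space) simp
  have S: "{x \<in> B. (\<Sum>i<N. (x i)\<^sup>2) \<le> y} \<in> sets ?L"
  proof -
    have "{x \<in> B. (\<Sum>i<N. (x i)\<^sup>2) \<le> y} = B \<inter> {x \<in> space ?L. (\<Sum>i<N. (x i)\<^sup>2) \<le> y}"
      using sp by auto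
    also have "\<dots> \<in> sets ?L" by measurable
    finally show ?thesis .
  qed
  have "?S -` {x \<in> B. (\<Sum>i<N. (x i)\<^sup>2) \<le> y} \<inter> space ?L = B \<inter> unit_cball N"
    using sp \<open>y > 0\<close> cone[of "sqrt y"] mult_le_cancel_left_pos[of y _ 1]
    by (auto simp: unit_cball_def L2_set_def power_mult_distrib sum_distrib_left[symmetric] space_PiM PiE_iff)
  then show ?thesis
    using S assms
    by (subst PiM_lborel_dilation[of "{..<N}" "sqrt y", symmetric])
       (auto simp: emeasure_density nn_integral_cmult emeasure_distr)
qed

section \<open>The uniform measure on the sphere as the direction of a Gaussian vector\<close>

text \<open>
  Totalising the radial projection at the origin by a point of the sphere that is fixed by all
  permutations keeps the projection equivariant under them, so that no null set has to be removed.
\<close>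
definition sphere_proj :: "nat \<Rightarrow> (nat \<Rightarrow> real) \<Rightarrow> nat \<Rightarrow> real" where
  "sphere_proj N x = (if L2_set x {..<N} = 0 then (\<lambda>i\<in>{..<N}. 1) else radial_proj N x)"

definition sphere_space :: "nat \<Rightarrow> (nat \<Rightarrow> real) measure" where
  "sphere_space N = restrict_space (PiM {..<N} (\<lambda>_. borel)) (kac_sphere N)"

abbreviation gauss :: "real \<Rightarrow> real measure" where
  "gauss s \<equiv> density lborel (\<lambda>x. ennreal (normal_density 0 s x))"

abbreviation gauss_pow :: "real \<Rightarrow> nat \<Rightarrow> (nat \<Rightarrow> real) measure" where
  "gauss_pow s N \<equiv> PiM {..<N} (\<lambda>_. gauss s)"

lemma L2_set_radial_proj:
  assumes "L2_set x {..<N} \<noteq> 0"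
  shows "L2_set (radial_proj N x) {..<N} = sqrt (real N)"
proof -
  have "L2_set (radial_proj N x) {..<N} = L2_set (\<lambda>i. (sqrt (real N) / L2_set x {..<N}) * x i) {..<N}"
    by (intro L2_set_cong) (auto simp: radial_proj_def)
  also have "\<dots> = sqrt (real N)"
    using assms by (subst L2_set_right_distrib[symmetric]) auto
  finally show ?thesis .
qed

lemma sphere_proj_in_sphere: "sphere_proj N x \<in> kac_sphere N"
proof (cases "L2_set x {..<N} = 0")
  case True
  then show ?thesis by (auto simp: sphere_proj_def kac_sphere_def L2_set_def)
next
  case False
  then show ?thesis using L2_set_radial_proj[of x N]
    by (auto simp: sphere_proj_def kac_sphere_def radial_proj_def)
qed

lemma kac_sphere_sets[measurable]: "kac_sphere N \<in> sets (PiM {..<N} (\<lambda>_. borel))"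
proof -
  have "kac_sphere N = {x \<in> space (PiM {..<N} (\<lambda>_. borel)). L2_set x {..<N} = sqrt (real N)}"
    by (auto simp: kac_sphere_def space_PiM PiE_iff)
  also have "\<dots> \<in> sets (PiM {..<N} (\<lambda>_. borel))"
    unfolding L2_set_def by measurable
  finally show ?thesis .
qed

lemma space_sphere_space: "space (sphere_space N) = kac_sphere N"
  by (simp add: sphere_space_def)

lemma measurable_radial_proj[measurable]:
  "radial_proj N \<in> PiM {..<N} (\<lambda>_. borel) \<rightarrow>\<^sub>M PiM {..<N} (\<lambda>_. borel)"
  unfolding radial_proj_def[abs_def] L2_set_def by measurable

lemma measurable_sphere_proj[measurable]:
  "sphere_proj N \<in> PiM {..<N} (\<lambda>_. borel) \<rightarrow>\<^sub>M sphere_space N"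
  unfolding sphere_space_def
proof (rule measurable_restrict_space2)
  have [measurable]: "(\<lambda>x. \<lambda>i\<in>{..<N}. 1) \<in> PiM {..<N} (\<lambda>_. borel) \<rightarrow>\<^sub>M PiM {..<N} (\<lambda>_. borel :: real measure)"
    by measurable
  show "sphere_proj N \<in> PiM {..<N} (\<lambda>_. borel) \<rightarrow>\<^sub>M PiM {..<N} (\<lambda>_. borel)"
    unfolding sphere_proj_def[abs_def] L2_set_def by measurable
qed (use sphere_proj_in_sphere in blast)

lemma prob_gauss: "s > 0 \<Longrightarrow> prob_space (gauss s)"
  by (rule prob_space_normal_density)

lemma sets_gauss_pow[measurable_cong]: "sets (gauss_pow s N) = sets (PiM {..<N} (\<lambda>_. borel))"
  by (rule sets_PiM_cong[OF refl]) simp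

lemma space_gauss_pow: "space (gauss_pow s N) = extensional {..<N}"
  by (simp add: space_PiM PiE_def)

lemma prod_normal_density:
  "(\<Prod>i<N. normal_density 0 s (x i)) = (1 / sqrt (2 * pi * s\<^sup>2)) ^ N * exp (- (1 / (2 * s\<^sup>2)) * (\<Sum>i<N. (x i)\<^sup>2))"
proof -
  have "(\<Prod>i<N. normal_density 0 s (x i)) =
      (\<Prod>i<N. 1 / sqrt (2 * pi * s\<^sup>2)) * (\<Prod>i<N. exp (- (1 / (2 * s\<^sup>2)) * (x i)\<^sup>2))"
    unfolding normal_density_def prod.distrib[symmetric] by (intro prod.cong) auto
  also have "(\<Prod>i<N. exp (- (1 / (2 * s\<^sup>2)) * (x i)\<^sup>2)) = exp (- (1 / (2 * s\<^sup>2)) * (\<Sum>i<N. (x i)\<^sup>2))"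
    by (subst exp_sum[symmetric]) (simp_all only: finite_lessThan sum_distrib_left)
  finally show ?thesis by simp
qed

lemma gauss_pow_density:
  assumes "s > 0"
  shows "gauss_pow s N = density (PiM {..<N} (\<lambda>_. lborel)) (\<lambda>x. ennreal (\<Prod>i<N. normal_density 0 s (x i)))"
  using prob_gauss[OF assms]
  by (subst PiM_density)
     (auto simp: sigma_finite_lborel prob_space_imp_sigma_finite prod_ennreal)

lemma exp_tail_nn_integral:
  fixes b :: real assumes "b > 0"
  shows "(\<integral>\<^sup>+y. (if t \<le> y then ennreal (b * exp (- b * y)) else 0) \<partial>lborel) = ennreal (exp (- b * t))"
proof -
  have "(\<integral>\<^sup>+y. (if t \<le> y then ennreal (b * exp (- b * y)) else 0) \<partial>lborel) =
      (\<integral>\<^sup>+y. ennreal (b * exp (- b * y)) * indicator {t..} y \<partial>lborel)"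
    by (intro nn_integral_cong) auto
  also
  have "(\<integral>\<^sup>+y. ennreal (b * exp (- b * y)) * indicator {t..} y \<partial>lborel) = ennreal (0 - (- exp (- b * t)))"
  proof (rule nn_integral_FTC_atLeast)
    show "((\<lambda>y. - exp (- b * y)) \<longlongrightarrow> 0) at_top"
      using assms by real_asymp
  qed (use assms in \<open>auto intro!: derivative_eq_intros\<close>)
  finally show ?thesis by simp
qed

text \<open>
  A radially decreasing density is a superposition of indicators of centred balls, and on a cone each
  of these is a dilation of the unit ball. Hence a Gaussian vector and a uniform vector in the ball
  have the same distribution of directions.
\<close>
lemma gauss_pow_cone:
  assumes s: "s > 0"
  shows "\<exists>K. \<forall>B. B \<in> sets (PiM {..<N} (\<lambda>_. lborel)) \<longrightarrow>
    (\<forall>r>0. \<forall>x\<in>space (PiM {..<N} (\<lambda>_. lborel :: real measure)). (\<lambda>i\<in>{..<N}. r * x i) \<in> B \<longleftrightarrow> x \<in> B) \<longrightarrow>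
    emeasure (gauss_pow s N) B = K * emeasure (PiM {..<N} (\<lambda>_. lborel)) (B \<inter> unit_cball N)"
proof -
  let ?L = "PiM {..<N} (\<lambda>_. lborel :: real measure)"
  interpret L: finite_product_sigma_finite "\<lambda>_::nat. lborel :: real measure" "{..<N}"
    by (simp add: finite_product_sigma_finite_def finite_product_sigma_finite_axioms_def
          product_sigma_finite_def sigma_finite_lborel)
  define c where "c = (1 / sqrt (2 * pi * s\<^sup>2)) ^ N"
  define b where "b = 1 / (2 * s\<^sup>2)"
  have c: "c \<ge> 0" and b: "b > 0" using s by (auto simp: c_def b_def)
  define K where "K = ennreal c * (\<integral>\<^sup>+y. ennreal (b * exp (- b * y)) * indicator {0<..} y * ennreal (sqrt y ^ N) \<partial>lborel)"
  interpret LL: pair_sigma_finite ?L "lborel :: real measure" by standard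
  show ?thesis
  proof (intro exI[of _ K] allI impI)
    fix B assume B: "B \<in> sets ?L"
      and cone: "\<forall>r>0. \<forall>x\<in>space ?L. (\<lambda>i\<in>{..<N}. r * x i) \<in> B \<longleftrightarrow> x \<in> B"
    have sp: "B \<subseteq> space ?L" using B by (rule sets.sets_into_space)
    have [measurable]: "Measurable.pred ?L (\<lambda>x. x \<in> B)" "B \<in> sets ?L"
      using B by (auto simp: pred_def Int_def[symmetric] Collect_conj_eq)
    define k where "k x y = indicator B x * (if (\<Sum>i<N. (x i)\<^sup>2) \<le> y then ennreal (b * exp (- b * y)) else 0)" for x y
    have [measurable]: "(\<lambda>z. indicator B (fst z) :: ennreal) \<in> borel_measurable (?L \<Otimes>\<^sub>M (lborel :: real measure))"
      using B by (intro measurable_compose[OF measurable_fst borel_measurable_indicator])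
    have k[measurable]: "case_prod k \<in> borel_measurable (?L \<Otimes>\<^sub>M lborel)"
      unfolding k_def split_beta' by measurable
    have "emeasure (gauss_pow s N) B = (\<integral>\<^sup>+x. ennreal (c * exp (- b * (\<Sum>i<N. (x i)\<^sup>2))) * indicator B x \<partial>?L)"
      unfolding gauss_pow_density[OF s] prod_normal_density c_def b_def
      by (subst emeasure_density) auto
    also have "\<dots> = (\<integral>\<^sup>+x. ennreal c * (\<integral>\<^sup>+y. k x y \<partial>lborel) \<partial>?L)"
    proof (rule nn_integral_cong)
      fix x :: "nat \<Rightarrow> real"
      show "ennreal (c * exp (- b * (\<Sum>i<N. (x i)\<^sup>2))) * indicator B x =
        ennreal c * (\<integral>\<^sup>+y. k x y \<partial>lborel)"
      proof (cases "x \<in> B")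
        case True
        then show ?thesis using c exp_tail_nn_integral[OF b, of "\<Sum>i<N. (x i)\<^sup>2"]
          by (simp add: ennreal_mult' k_def)
      qed (simp add: k_def)
    qed
    also have "\<dots> = ennreal c * (\<integral>\<^sup>+x. (\<integral>\<^sup>+y. k x y \<partial>lborel) \<partial>?L)"
      by (rule nn_integral_cmult) (rule lborel.borel_measurable_nn_integral[OF k])
    also have "(\<integral>\<^sup>+x. (\<integral>\<^sup>+y. k x y \<partial>lborel) \<partial>?L)
       = (\<integral>\<^sup>+y. (\<integral>\<^sup>+x. k x y \<partial>?L) \<partial>lborel)"
      using LL.Fubini'[OF k] by simp
    also have "\<dots> = (\<integral>\<^sup>+y. ennreal (b * exp (- b * y)) * emeasure ?L {x \<in> B. (\<Sum>i<N. (x i)\<^sup>2) \<le> y} \<partial>lborel)"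
    proof (rule nn_integral_cong)
      fix y :: real
      have "{x \<in> B. (\<Sum>i<N. (x i)\<^sup>2) \<le> y} = B \<inter> {x \<in> space ?L. (\<Sum>i<N. (x i)\<^sup>2) \<le> y}"
        using sp by auto
      also have "\<dots> \<in> sets ?L" by measurable
      finally have [measurable]: "{x \<in> B. (\<Sum>i<N. (x i)\<^sup>2) \<le> y} \<in> sets ?L" .
      have "(\<integral>\<^sup>+x. k x y \<partial>?L)
         = (\<integral>\<^sup>+x. ennreal (b * exp (- b * y)) * indicator {x \<in> B. (\<Sum>i<N. (x i)\<^sup>2) \<le> y} x \<partial>?L)"
        by (intro nn_integral_cong) (auto simp: indicator_def k_def)
      also have "\<dots> = ennreal (b * exp (- b * y)) * emeasure ?L {x \<in> B. (\<Sum>i<N. (x i)\<^sup>2) \<le> y}"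
        by (rule nn_integral_cmult_indicator) measurable
      finally show "(\<integral>\<^sup>+x. k x y \<partial>?L)
         = ennreal (b * exp (- b * y)) * emeasure ?L {x \<in> B. (\<Sum>i<N. (x i)\<^sup>2) \<le> y}" .
    qed
    also have "\<dots> = (\<integral>\<^sup>+y. (ennreal (b * exp (- b * y)) * indicator {0<..} y * ennreal (sqrt y ^ N)) * emeasure ?L (B \<inter> unit_cball N) \<partial>lborel)"
    proof (rule nn_integral_cong_AE)
      have "AE y in lborel. y \<noteq> (0::real)" by (rule AE_lborel_singleton)
      then show "AE y in lborel. ennreal (b * exp (- b * y)) * emeasure ?L {x \<in> B. (\<Sum>i<N. (x i)\<^sup>2) \<le> y} =
         (ennreal (b * exp (- b * y)) * indicator {0<..} y * ennreal (sqrt y ^ N)) * emeasure ?L (B \<inter> unit_cball N)"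
      proof eventually_elim
        case (elim y)
        show ?case
        proof (cases "y > 0")
          case True
          have "emeasure ?L {x \<in> B. (\<Sum>i<N. (x i)\<^sup>2) \<le> y} = ennreal (sqrt y ^ N) * emeasure ?L (B \<inter> unit_cball N)"
            using True B cone by (intro cone_ball_volume) blast+
          then show ?thesis using True by (simp add: mult.assoc)
        next
          case False
          have "\<not> (\<Sum>i<N. (x i)\<^sup>2) \<le> y" for x :: "nat \<Rightarrow> real"
            using False elim sum_nonneg[of "{..<N}" "\<lambda>i. (x i)\<^sup>2"] by force
          then show ?thesis using False by simp
        qed
      qed
    qed
    also have "\<dots> = (\<integral>\<^sup>+y. ennreal (b * exp (- b * y)) * indicator {0<..} y * ennreal (sqrt y ^ N) \<partial>lborel) * emeasure ?L (B \<inter> unit_cball N)"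
      by (rule nn_integral_multc) measurable
    finally show "emeasure (gauss_pow s N) B = K * emeasure ?L (B \<inter> unit_cball N)"
      by (simp add: K_def mult.assoc)
  qed
qed

lemma unit_cball_sets[measurable]: "unit_cball N \<in> sets (PiM {..<N} (\<lambda>_. lborel))"
proof -
  have "unit_cball N = {x \<in> space (PiM {..<N} (\<lambda>_. lborel)). L2_set x {..<N} \<le> 1}"
    by (auto simp: unit_cball_def space_PiM PiE_def)
  also have "\<dots> \<in> sets (PiM {..<N} (\<lambda>_. lborel))"
    unfolding L2_set_def by measurable
  finally show ?thesis .
qed

lemma radial_proj_scale:
  assumes "r > 0"
  shows "radial_proj N (\<lambda>i\<in>{..<N}. r * x i) = radial_proj N x"
proof -
  have "L2_set (\<lambda>i\<in>{..<N}. r * x i) {..<N} = L2_set (\<lambda>i. r * x i) {..<N}"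
    by (intro L2_set_cong) auto
  also have "\<dots> = r * L2_set x {..<N}"
    using assms by (subst L2_set_right_distrib) auto
  finally show ?thesis using assms by (auto simp: radial_proj_def fun_eq_iff)
qed

lemma AE_gauss_pow_nonzero:
  assumes "s > 0" "N \<ge> 1"
  shows "AE x in gauss_pow s N. L2_set x {..<N} \<noteq> 0"
proof -
  have "AE t in lborel. t \<noteq> (0::real)" by (rule AE_lborel_singleton)
  then have "AE t in gauss s. t \<noteq> (0::real)"
    by (subst AE_density) auto
  then have "AE x in gauss_pow s N. x 0 \<noteq> 0"
    using assms by (intro AE_PiM_component prob_gauss) auto
  then show ?thesis
  proof eventually_elim
    case (elim x)
    then show ?case using assms
      by (auto simp: L2_set_eq_0_iff)
  qed
qed

text \<open>
  By \<open>gauss_pow_cone\<close> both measures of a set are proportional to the volume of the cone over it in the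
  unit ball. The constant is fixed by the total mass and never has to be computed. Every \<open>s\<close> is
  allowed, because directions do not see the scale; below, \<open>s\<close> is adapted to the argument.
\<close>
theorem sphere_measure_eq_gauss:
  assumes s: "s > 0" and N: "N \<ge> 1"
  shows "sphere_measure N = distr (gauss_pow s N) (sphere_space N) (sphere_proj N)"
proof (rule measure_eqI)
  let ?L = "PiM {..<N} (\<lambda>_. lborel :: real measure)"
  let ?B = "PiM {..<N} (\<lambda>_. borel :: real measure)"
  let ?U = "uniform_measure ?L (unit_cball N)"
  have LB: "sets ?L = sets ?B" by (rule sets_PiM_cong[OF refl]) simp
  have sp: "space ?L = extensional {..<N}" by (simp add: space_PiM PiE_def)
  show "sets (sphere_measure N) = sets (distr (gauss_pow s N) (sphere_space N) (sphere_proj N))"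
    unfolding sphere_measure_def sphere_space_def by (simp cong: sets_restrict_space_cong)
  fix A assume "A \<in> sets (sphere_measure N)"
  then have A: "A \<in> sets (sphere_space N)"
    unfolding sphere_measure_def sphere_space_def by (simp cong: sets_restrict_space_cong)
  then have A': "A \<in> sets ?B" "A \<subseteq> kac_sphere N"
    unfolding sphere_space_def by (auto simp: sets_restrict_space_iff)
  interpret G: prob_space "gauss_pow s N"
    by (intro prob_space_PiM prob_gauss s)
  have rp: "radial_proj N \<in> measurable ?L ?B" "radial_proj N \<in> measurable ?U ?B"
    using measurable_radial_proj[of N] by (simp_all add: measurable_cong_sets[OF LB refl] measurable_cong_sets[of ?U ?B] LB)
  define B where "B = radial_proj N -` A \<inter> space ?L"
  have B: "B \<in> sets ?L" unfolding B_def using rp(1) A'(1) by (rule measurable_sets)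
  obtain K where K: "\<And>B. B \<in> sets ?L \<Longrightarrow> (\<forall>r>0. \<forall>x\<in>space ?L. (\<lambda>i\<in>{..<N}. r * x i) \<in> B \<longleftrightarrow> x \<in> B) \<Longrightarrow>
      emeasure (gauss_pow s N) B = K * emeasure ?L (B \<inter> unit_cball N)"
    using gauss_pow_cone[OF s, of N] by blast
  have KB: "emeasure (gauss_pow s N) B = K * emeasure ?L (B \<inter> unit_cball N)"
  proof (rule K[OF B], intro allI impI ballI)
    fix r :: real and x assume "r > 0" "x \<in> space ?L"
    then show "(\<lambda>i\<in>{..<N}. r * x i) \<in> B \<longleftrightarrow> x \<in> B"
      by (simp add: B_def radial_proj_scale sp)
  qed
  have "1 = emeasure (gauss_pow s N) (space ?L)"
    using G.emeasure_space_1 by (simp only: space_gauss_pow sp)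
  also have "\<dots> = K * emeasure ?L (space ?L \<inter> unit_cball N)"
    by (rule K) (simp, simp add: sp)
  also have "space ?L \<inter> unit_cball N = unit_cball N" by (auto simp: sp unit_cball_def)
  finally have K1: "K * emeasure ?L (unit_cball N) = 1" by simp
  then have Kfin: "emeasure ?L (unit_cball N) \<noteq> 0" "emeasure ?L (unit_cball N) \<noteq> \<infinity>" "K \<noteq> 0" "K \<noteq> \<infinity>"
    by (auto simp: ennreal_top_mult ennreal_mult_top split: if_splits)
  have "emeasure (sphere_measure N) A = emeasure (distr ?U ?B (radial_proj N)) A"
    unfolding sphere_measure_def using A' by (intro emeasure_restrict_space) auto
  also have "\<dots> = emeasure ?U B"
    using rp A' by (subst emeasure_distr) (auto simp: B_def)
  also have "\<dots> = emeasure ?L (unit_cball N \<inter> B) / emeasure ?L (unit_cball N)"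
    using B by (intro emeasure_uniform_measure) auto
  also have "\<dots> = emeasure (gauss_pow s N) B"
  proof -
    let ?u = "emeasure ?L (unit_cball N)" and ?a = "emeasure ?L (unit_cball N \<inter> B)"
    have "?a / ?u = (K * ?u) * ?a / ?u" by (simp only: K1 mult_1)
    also have "\<dots> = (K * ?a) * (?u / ?u)" by (simp only: ennreal_times_divide mult_ac)
    also have "?u / ?u = 1" using Kfin by (intro ennreal_divide_self) (auto simp: less_top)
    finally show ?thesis by (simp add: KB Int_commute)
  qed
  also have "\<dots> = emeasure (gauss_pow s N) (sphere_proj N -` A \<inter> space (gauss_pow s N))"
  proof (rule emeasure_eq_AE)
    show "AE x in gauss_pow s N. x \<in> B \<longleftrightarrow> x \<in> sphere_proj N -` A \<inter> space (gauss_pow s N)"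
      using AE_gauss_pow_nonzero[OF s N]
      by eventually_elim (simp add: sphere_proj_def B_def sp space_gauss_pow)
    show "B \<in> sets (gauss_pow s N)" using B LB sets_gauss_pow by blast
    show "sphere_proj N -` A \<inter> space (gauss_pow s N) \<in> sets (gauss_pow s N)"
      using A by measurable
  qed
  also have "\<dots> = emeasure (distr (gauss_pow s N) (sphere_space N) (sphere_proj N)) A"
    using A by (subst emeasure_distr) auto
  finally show "emeasure (sphere_measure N) A = \<dots>" .
qed

lemma sets_sphere_measure[measurable_cong]: "sets (sphere_measure N) = sets (sphere_space N)"
  unfolding sphere_measure_def sphere_space_def by (rule sets_restrict_space_cong) simp

lemma space_sphere_measure: "space (sphere_measure N) = kac_sphere N"
  using sets_eq_imp_space_eq[OF sets_sphere_measure] by (simp add: space_sphere_space)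

lemma prob_space_sphere_measure:
  assumes "N \<ge> 1" shows "prob_space (sphere_measure N)"
proof -
  interpret G: prob_space "gauss_pow 1 N"
    by (intro prob_space_PiM prob_gauss) simp
  show ?thesis
    by (subst sphere_measure_eq_gauss[of 1]) (use assms in \<open>auto intro!: G.prob_space_distr\<close>)
qed

section \<open>Rotations in a coordinate plane\<close>

lemma nn_integral_rotation_plane:
  fixes \<psi> :: "real \<Rightarrow> real \<Rightarrow> ennreal" and c s :: real
  assumes [measurable]: "case_prod \<psi> \<in> borel_measurable (borel \<Otimes>\<^sub>M borel)" and cs: "c\<^sup>2 + s\<^sup>2 = 1"
  shows "(\<integral>\<^sup>+y. \<integral>\<^sup>+z. \<psi> (c * z - s * y) (s * z + c * y) \<partial>lborel \<partial>lborel) =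
         (\<integral>\<^sup>+y. \<integral>\<^sup>+z. \<psi> z y \<partial>lborel \<partial>lborel)"
proof (cases "c = 0")
  case False
  \<comment> \<open>Replace \<open>z\<close> by the new first coordinate \<open>u\<close>, then \<open>y\<close> by the new second one; the two Jacobians cancel.\<close>
  have 1: "(\<integral>\<^sup>+u. \<psi> u ((s * u + y) / c) \<partial>lborel) = \<bar>c\<bar> * (\<integral>\<^sup>+z. \<psi> (c * z - s * y) (s * z + c * y) \<partial>lborel)" for y
  proof -
    have "(s * (- (s * y) + c * z) + y) / c = s * z + c * y" for z
    proof -
      have "s * (- (s * y) + c * z) + y = c * s * z + (1 - s\<^sup>2) * y" by (simp add: algebra_simps power2_eq_square)
      also have "1 - s\<^sup>2 = c\<^sup>2" using cs by simp
      finally show ?thesis using False by (simp add: field_simps power2_eq_square)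
    qed
    then show ?thesis
      using False by (subst nn_integral_real_affine[of _ c "- (s * y)"]) (simp_all add: algebra_simps)
  qed
  have 2: "(\<integral>\<^sup>+y. \<psi> u ((s * u + y) / c) \<partial>lborel) = \<bar>c\<bar> * (\<integral>\<^sup>+v. \<psi> u v \<partial>lborel)" for u
  proof -
    have "(\<integral>\<^sup>+v. \<psi> u v \<partial>lborel) = \<bar>1 / c\<bar> * (\<integral>\<^sup>+y. \<psi> u (s * u / c + 1 / c * y) \<partial>lborel)"
      using False by (subst nn_integral_real_affine[of _ "1 / c" "s * u / c"]) simp_all
    then have "ennreal \<bar>c\<bar> * (\<integral>\<^sup>+v. \<psi> u v \<partial>lborel) =
        (ennreal \<bar>c\<bar> * ennreal \<bar>1 / c\<bar>) * (\<integral>\<^sup>+y. \<psi> u (s * u / c + 1 / c * y) \<partial>lborel)"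
      by (simp add: mult.assoc)
    also have "ennreal \<bar>c\<bar> * ennreal \<bar>1 / c\<bar> = 1"
      using False by (simp add: ennreal_mult[symmetric])
    finally show ?thesis by (simp add: add_divide_distrib)
  qed
  have "ennreal \<bar>c\<bar> * (\<integral>\<^sup>+y. \<integral>\<^sup>+z. \<psi> (c * z - s * y) (s * z + c * y) \<partial>lborel \<partial>lborel) =
      (\<integral>\<^sup>+y. \<integral>\<^sup>+u. \<psi> u ((s * u + y) / c) \<partial>lborel \<partial>lborel)"
    by (subst nn_integral_cmult[symmetric]) (simp_all add: 1)
  also have "\<dots> = (\<integral>\<^sup>+u. \<integral>\<^sup>+y. \<psi> u ((s * u + y) / c) \<partial>lborel \<partial>lborel)"
    by (rule lborel_pair.Fubini') simp
  also have "\<dots> = ennreal \<bar>c\<bar> * (\<integral>\<^sup>+u. \<integral>\<^sup>+v. \<psi> u v \<partial>lborel \<partial>lborel)"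
    by (simp add: 2 nn_integral_cmult)
  also have "(\<integral>\<^sup>+u. \<integral>\<^sup>+v. \<psi> u v \<partial>lborel \<partial>lborel) = (\<integral>\<^sup>+v. \<integral>\<^sup>+u. \<psi> u v \<partial>lborel \<partial>lborel)"
    by (rule lborel_pair.Fubini'[symmetric]) simp
  finally show ?thesis
    using False by (subst (asm) ennreal_mult_cancel_left) auto
next
  case True
  then have s: "s\<^sup>2 = 1" and s0: "\<bar>s\<bar> = 1" "s \<noteq> 0" using cs by (auto simp: power2_eq_1_iff)
  have 1: "(\<integral>\<^sup>+z. \<psi> u (s * z) \<partial>lborel) = (\<integral>\<^sup>+z. \<psi> u z \<partial>lborel)" for u
    using s0 nn_integral_real_affine[of "\<psi> u" s 0] by simp
  have 2: "(\<integral>\<^sup>+y. g (- (s * y)) \<partial>lborel) = (\<integral>\<^sup>+y. g y \<partial>lborel)" if "g \<in> borel_measurable borel" for g :: "real \<Rightarrow> ennreal"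
    using s0 nn_integral_real_affine[of g "- s" 0] that by simp
  have "(\<integral>\<^sup>+y. \<integral>\<^sup>+z. \<psi> (c * z - s * y) (s * z + c * y) \<partial>lborel \<partial>lborel) =
      (\<integral>\<^sup>+y. (\<lambda>u. \<integral>\<^sup>+z. \<psi> u z \<partial>lborel) (- (s * y)) \<partial>lborel)"
    by (simp add: True 1)
  also have "\<dots> = (\<integral>\<^sup>+u. \<integral>\<^sup>+z. \<psi> u z \<partial>lborel \<partial>lborel)"
    by (rule 2) simp
  also have "\<dots> = (\<integral>\<^sup>+v. \<integral>\<^sup>+u. \<psi> u v \<partial>lborel \<partial>lborel)"
    by (rule lborel_pair.Fubini'[symmetric]) simp
  finally show ?thesis .
qed

lemma measurable_kac_rotation_joint:
  assumes "i < j" "j < N"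
  shows "(\<lambda>(\<theta>, V). kac_rotation i j \<theta> V) \<in> borel \<Otimes>\<^sub>M PiM {..<N} (\<lambda>_. borel) \<rightarrow>\<^sub>M PiM {..<N} (\<lambda>_. borel)"
    (is "_ \<in> ?M \<rightarrow>\<^sub>M ?B")
proof -
  have [measurable]: "(\<lambda>z. snd z k) \<in> borel_measurable ?M" if "k < N" for k
    using that by (intro measurable_compose[OF measurable_snd measurable_component_singleton]) simp
  have "(\<lambda>z. \<lambda>k\<in>{..<N}. if k = j then sin (fst z) * snd z i + cos (fst z) * snd z j
      else if k = i then cos (fst z) * snd z i - sin (fst z) * snd z j else snd z k) \<in> ?M \<rightarrow>\<^sub>M ?B"
    using assms by (intro measurable_restrict) auto
  also have "?this \<longleftrightarrow> ?thesis"
    using assms by (intro measurable_cong) (auto simp: kac_rotation_def space_pair_measure space_PiM PiE_def extensional_def fun_eq_iff)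
  finally show ?thesis .
qed

lemma measurable_kac_rotation:
  assumes "i < j" "j < N"
  shows "kac_rotation i j \<theta> \<in> PiM {..<N} (\<lambda>_. borel) \<rightarrow>\<^sub>M PiM {..<N} (\<lambda>_. borel)"
  using measurable_compose[OF measurable_Pair1' measurable_kac_rotation_joint[OF assms], of \<theta>] by simp

lemma sum_squares_kac_rotation:
  assumes "i < j" "j < N"
  shows "(\<Sum>k<N. (kac_rotation i j \<theta> x k)\<^sup>2) = (\<Sum>k<N. (x k)\<^sup>2)"
proof -
  have *: "(\<Sum>k<N. g k) = g i + g j + (\<Sum>k\<in>{..<N} - {i, j}. g k)" for g :: "nat \<Rightarrow> real"
    using assms by (subst sum.subset_diff[of "{i, j}"]) auto
  have "(cos \<theta> * x i - sin \<theta> * x j)\<^sup>2 + (sin \<theta> * x i + cos \<theta> * x j)\<^sup>2 =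
      ((cos \<theta>)\<^sup>2 + (sin \<theta>)\<^sup>2) * ((x i)\<^sup>2 + (x j)\<^sup>2)"
    by (simp add: power2_eq_square algebra_simps del: sin_cos_squared_add sin_cos_squared_add2 sin_cos_squared_add3)
  then have **: "(cos \<theta> * x i - sin \<theta> * x j)\<^sup>2 + (sin \<theta> * x i + cos \<theta> * x j)\<^sup>2 = (x i)\<^sup>2 + (x j)\<^sup>2"
    by simp
  have "(\<Sum>k<N. (kac_rotation i j \<theta> x k)\<^sup>2) = (cos \<theta> * x i - sin \<theta> * x j)\<^sup>2 + (sin \<theta> * x i + cos \<theta> * x j)\<^sup>2
      + (\<Sum>k\<in>{..<N} - {i, j}. (x k)\<^sup>2)"
    using assms by (subst *) (auto simp: kac_rotation_def intro!: sum.cong)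
  then show ?thesis using ** by (subst (asm) **) (simp add: *[of "\<lambda>k. (x k)\<^sup>2"])
qed

text \<open>
  Fubini's theorem isolates the two rotated coordinates and reduces the claim to the plane.
\<close>
lemma nn_integral_PiM_lborel_rotation:
  assumes ij: "i < j" "j < N" and [measurable]: "\<phi> \<in> borel_measurable (PiM {..<N} (\<lambda>_. lborel))"
  shows "(\<integral>\<^sup>+x. \<phi> (kac_rotation i j \<theta> x) \<partial>PiM {..<N} (\<lambda>_. lborel)) = (\<integral>\<^sup>+x. \<phi> x \<partial>PiM {..<N} (\<lambda>_. lborel))"
proof -
  interpret L: product_sigma_finite "\<lambda>_::nat. lborel :: real measure"
    by (simp add: product_sigma_finite_def sigma_finite_lborel)
  define K where "K = {..<N} - {i, j}"
  have I: "{..<N} = insert i (insert j K)" and K: "finite K" "j \<notin> K" "i \<notin> insert j K"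
    using ij by (auto simp: K_def)
  have *: "(\<integral>\<^sup>+x. f x \<partial>PiM {..<N} (\<lambda>_. lborel)) =
     (\<integral>\<^sup>+x. \<integral>\<^sup>+y. \<integral>\<^sup>+z. f (x(j := y, i := z)) \<partial>lborel \<partial>lborel \<partial>PiM K (\<lambda>_. lborel))"
    if f: "f \<in> borel_measurable (PiM {..<N} (\<lambda>_. lborel :: real measure))" for f :: "(nat \<Rightarrow> real) \<Rightarrow> ennreal"
  proof -
    have f'[measurable]: "f \<in> borel_measurable (PiM (insert i (insert j K)) (\<lambda>_. lborel))"
      using f by (simp only: I)
    have m: "(\<lambda>x. \<integral>\<^sup>+z. f (x(i := z)) \<partial>lborel) \<in> borel_measurable (PiM (insert j K) (\<lambda>_. lborel))"
    proof -
      have "(\<lambda>(x, z). f (x(i := z))) \<in> borel_measurable (PiM (insert j K) (\<lambda>_. lborel) \<Otimes>\<^sub>M lborel)"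
        using measurable_compose[OF measurable_add_dim f'] by (simp add: split_beta')
      then show ?thesis by (rule lborel.borel_measurable_nn_integral)
    qed
    show ?thesis
      unfolding I using K
      by (subst L.product_nn_integral_insert) (simp_all add: L.product_nn_integral_insert[OF _ _ m])
  qed
  have meas: "kac_rotation i j \<theta> \<in> PiM {..<N} (\<lambda>_. lborel) \<rightarrow>\<^sub>M PiM {..<N} (\<lambda>_. lborel)"
    using measurable_kac_rotation[OF ij]
    by (simp cong: measurable_cong_sets sets_PiM_cong)
  have "(\<integral>\<^sup>+x. \<phi> (kac_rotation i j \<theta> x) \<partial>PiM {..<N} (\<lambda>_. lborel)) =
     (\<integral>\<^sup>+x. \<integral>\<^sup>+y. \<integral>\<^sup>+z. \<phi> (kac_rotation i j \<theta> (x(j := y, i := z))) \<partial>lborel \<partial>lborel \<partial>PiM K (\<lambda>_. lborel))"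
    by (rule *) (rule measurable_compose[OF meas], fact)
  also have "\<dots> = (\<integral>\<^sup>+x. \<integral>\<^sup>+y. \<integral>\<^sup>+z. \<phi> (x(j := y, i := z)) \<partial>lborel \<partial>lborel \<partial>PiM K (\<lambda>_. lborel))"
  proof (rule nn_integral_cong)
    fix x assume x: "x \<in> space (PiM K (\<lambda>_. lborel :: real measure))"
    define \<psi> where "\<psi> z y = \<phi> (x(j := y, i := z))" for z y
    have [measurable]: "case_prod \<psi> \<in> borel_measurable (borel \<Otimes>\<^sub>M borel)"
    proof -
      have "(\<lambda>p. x(j := snd p, i := fst p)) \<in> borel \<Otimes>\<^sub>M borel \<rightarrow>\<^sub>M PiM (insert i (insert j K)) (\<lambda>_. lborel)"
      proof (rule measurable_PiM_single')
        fix k assume "k \<in> insert i (insert j K)"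
        then show "(\<lambda>p. (x(j := snd p, i := fst p)) k) \<in> borel \<Otimes>\<^sub>M borel \<rightarrow>\<^sub>M lborel"
          by (auto simp: fun_upd_def)
      qed (use x in \<open>auto simp: space_PiM PiE_def extensional_def\<close>)
      then have "(\<lambda>p. \<phi> (x(j := snd p, i := fst p))) \<in> borel_measurable (borel \<Otimes>\<^sub>M borel)"
        by (rule measurable_compose) (simp flip: I)
      then show ?thesis by (simp add: \<psi>_def split_beta')
    qed
    have "kac_rotation i j \<theta> (x(j := y, i := z)) =
        x(j := sin \<theta> * z + cos \<theta> * y, i := cos \<theta> * z - sin \<theta> * y)" for y z
      using ij by (auto simp: kac_rotation_def fun_eq_iff)
    then have "(\<integral>\<^sup>+y. \<integral>\<^sup>+z. \<phi> (kac_rotation i j \<theta> (x(j := y, i := z))) \<partial>lborel \<partial>lborel) =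
        (\<integral>\<^sup>+y. \<integral>\<^sup>+z. \<psi> (cos \<theta> * z - sin \<theta> * y) (sin \<theta> * z + cos \<theta> * y) \<partial>lborel \<partial>lborel)"
      by (simp add: \<psi>_def)
    also have "\<dots> = (\<integral>\<^sup>+y. \<integral>\<^sup>+z. \<psi> z y \<partial>lborel \<partial>lborel)"
      by (rule nn_integral_rotation_plane) (auto simp: sin_cos_squared_add2)
    finally show "(\<integral>\<^sup>+y. \<integral>\<^sup>+z. \<phi> (kac_rotation i j \<theta> (x(j := y, i := z))) \<partial>lborel \<partial>lborel) =
       (\<integral>\<^sup>+y. \<integral>\<^sup>+z. \<phi> (x(j := y, i := z)) \<partial>lborel \<partial>lborel)"
      by (simp add: \<psi>_def)
  qed
  also have "\<dots> = (\<integral>\<^sup>+x. \<phi> x \<partial>PiM {..<N} (\<lambda>_. lborel))"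
    by (rule *[symmetric]) fact
  finally show ?thesis .
qed

text \<open>
  Lebesgue measure and the Gaussian density, a function of the norm, are both rotation invariant.
\<close>
lemma distr_gauss_pow_rotation:
  assumes s: "s > 0" and ij: "i < j" "j < N"
  shows "distr (gauss_pow s N) (gauss_pow s N) (kac_rotation i j \<theta>) = gauss_pow s N"
proof (rule measure_eqI)
  let ?L = "PiM {..<N} (\<lambda>_. lborel :: real measure)"
  let ?n = "\<lambda>x. ennreal (\<Prod>i<N. normal_density 0 s (x i))"
  fix A assume A: "A \<in> sets (distr (gauss_pow s N) (gauss_pow s N) (kac_rotation i j \<theta>))"
  then have A'[measurable]: "A \<in> sets ?L" by (simp add: sets_gauss_pow cong: sets_PiM_cong)
  have R: "kac_rotation i j \<theta> \<in> gauss_pow s N \<rightarrow>\<^sub>M gauss_pow s N"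
    using measurable_kac_rotation[OF ij] by (simp cong: measurable_cong_sets sets_PiM_cong)
  have "emeasure (distr (gauss_pow s N) (gauss_pow s N) (kac_rotation i j \<theta>)) A =
      (\<integral>\<^sup>+x. indicator A (kac_rotation i j \<theta> x) \<partial>gauss_pow s N)"
    using A by (subst nn_integral_distr[OF R, symmetric]) auto
  also have "\<dots> = (\<integral>\<^sup>+x. ?n x * indicator A (kac_rotation i j \<theta> x) \<partial>?L)"
    unfolding gauss_pow_density[OF s]
  proof (rule nn_integral_density)
    have "kac_rotation i j \<theta> \<in> ?L \<rightarrow>\<^sub>M ?L"
      using measurable_kac_rotation[OF ij] by (simp cong: measurable_cong_sets sets_PiM_cong)
    then show "(\<lambda>x. indicator A (kac_rotation i j \<theta> x)) \<in> borel_measurable ?L" by measurable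
  qed measurable
  also have "\<dots> = (\<integral>\<^sup>+x. ?n (kac_rotation i j \<theta> x) * indicator A (kac_rotation i j \<theta> x) \<partial>?L)"
    by (simp add: prod_normal_density sum_squares_kac_rotation[OF ij])
  also have "\<dots> = (\<integral>\<^sup>+x. ?n x * indicator A x \<partial>?L)"
    using ij by (rule nn_integral_PiM_lborel_rotation) measurable
  also have "\<dots> = emeasure (gauss_pow s N) A"
    unfolding gauss_pow_density[OF s] by (subst emeasure_density) auto
  finally show "emeasure (distr (gauss_pow s N) (gauss_pow s N) (kac_rotation i j \<theta>)) A = emeasure (gauss_pow s N) A" .
qed simp

lemma kac_rotation_in_sphere:
  assumes "i < j" "j < N" "V \<in> kac_sphere N"
  shows "kac_rotation i j \<theta> V \<in> kac_sphere N"
  using assms sum_squares_kac_rotation[OF assms(1,2), of \<theta> V]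
  by (auto simp: kac_sphere_def L2_set_def kac_rotation_def extensional_def)

lemma measurable_kac_rotation_sphere:
  assumes "i < j" "j < N"
  shows "(\<lambda>(\<theta>, V). kac_rotation i j \<theta> V) \<in> borel \<Otimes>\<^sub>M sphere_space N \<rightarrow>\<^sub>M sphere_space N"
proof -
  have "(\<lambda>V. V) \<in> sphere_space N \<rightarrow>\<^sub>M PiM {..<N} (\<lambda>_. borel)"
    unfolding sphere_space_def by (rule measurable_restrict_space1) simp
  then have "(\<lambda>z. (fst z, snd z)) \<in> (borel :: real measure) \<Otimes>\<^sub>M sphere_space N \<rightarrow>\<^sub>M borel \<Otimes>\<^sub>M PiM {..<N} (\<lambda>_. borel)"
    by (intro measurable_Pair measurable_fst measurable_compose[OF measurable_snd])
  from measurable_compose[OF this measurable_kac_rotation_joint[OF assms]]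
  have "(\<lambda>(\<theta>, V). kac_rotation i j \<theta> V) \<in> borel \<Otimes>\<^sub>M sphere_space N \<rightarrow>\<^sub>M PiM {..<N} (\<lambda>_. borel)"
    by (simp add: split_beta')
  then show ?thesis
    unfolding sphere_space_def
    by (rule measurable_restrict_space2[rotated])
       (auto simp: space_pair_measure kac_rotation_in_sphere[OF assms] space_restrict_space)
qed

lemma kac_rotation_inverse:
  assumes "i < j"
  shows "kac_rotation i j (- \<theta>) (kac_rotation i j \<theta> V) = V"
proof -
  have *: "cos \<theta> * (cos \<theta> * a) + sin \<theta> * (sin \<theta> * a) = a" for a
    by (simp only: mult.assoc[symmetric] distrib_right[symmetric] sin_cos_squared_add3 mult_1)
  have "cos \<theta> * (cos \<theta> * V i - sin \<theta> * V j) + sin \<theta> * (sin \<theta> * V i + cos \<theta> * V j) = V i"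
    using *[of "V i"] by (simp add: algebra_simps)
  moreover have "- (sin \<theta> * (cos \<theta> * V i - sin \<theta> * V j)) + cos \<theta> * (sin \<theta> * V i + cos \<theta> * V j) = V j"
    using *[of "V j"] by (simp add: algebra_simps)
  ultimately show ?thesis
    using assms by (auto simp: kac_rotation_def fun_eq_iff)
qed

lemma sphere_proj_rotation:
  assumes "i < j" "j < N" "L2_set x {..<N} \<noteq> 0"
  shows "sphere_proj N (kac_rotation i j \<theta> x) = kac_rotation i j \<theta> (sphere_proj N x)"
proof -
  have "L2_set (kac_rotation i j \<theta> x) {..<N} = L2_set x {..<N}"
    using sum_squares_kac_rotation[OF assms(1,2)] by (simp add: L2_set_def)
  then show ?thesis
    using assms by (auto simp: sphere_proj_def radial_proj_def kac_rotation_def fun_eq_iff diff_divide_distrib add_divide_distrib algebra_simps)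
qed

section \<open>Bounded measurable functions\<close>

definition bounded_measurable :: "'a measure \<Rightarrow> ('a \<Rightarrow> real) \<Rightarrow> bool" where
  "bounded_measurable M f \<longleftrightarrow> f \<in> borel_measurable M \<and> (\<exists>B. \<forall>x\<in>space M. \<bar>f x\<bar> \<le> B)"

lemma bounded_measurable_const: "bounded_measurable M (\<lambda>_. c)"
  by (auto simp: bounded_measurable_def)

lemma bounded_measurable_add:
  assumes "bounded_measurable M f" "bounded_measurable M g"
  shows "bounded_measurable M (\<lambda>x. f x + g x)"
proof -
  obtain A B where "\<And>x. x \<in> space M \<Longrightarrow> \<bar>f x\<bar> \<le> A" "\<And>x. x \<in> space M \<Longrightarrow> \<bar>g x\<bar> \<le> B"
    using assms by (auto simp: bounded_measurable_def)
  then have "\<forall>x\<in>space M. \<bar>f x + g x\<bar> \<le> A + B" by (metis abs_triangle_ineq add_mono order_trans)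
  with assms show ?thesis by (auto simp: bounded_measurable_def)
qed

lemma bounded_measurable_mult:
  assumes "bounded_measurable M f" "bounded_measurable M g"
  shows "bounded_measurable M (\<lambda>x. f x * g x)"
proof -
  obtain A B where "\<And>x. x \<in> space M \<Longrightarrow> \<bar>f x\<bar> \<le> A" "\<And>x. x \<in> space M \<Longrightarrow> \<bar>g x\<bar> \<le> B"
    using assms by (auto simp: bounded_measurable_def)
  then have "\<forall>x\<in>space M. \<bar>f x * g x\<bar> \<le> A * B"
    unfolding abs_mult by (meson abs_ge_zero mult_mono order_trans)
  with assms show ?thesis by (auto simp: bounded_measurable_def)
qed

lemma bounded_measurable_diff:
  "bounded_measurable M f \<Longrightarrow> bounded_measurable M g \<Longrightarrow> bounded_measurable M (\<lambda>x. f x - g x)"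
  using bounded_measurable_add[of M f "\<lambda>x. -1 * g x"] bounded_measurable_mult[of M "\<lambda>_. -1" g]
    bounded_measurable_const[of M "-1"] by simp

lemma bounded_measurable_compose:
  "bounded_measurable N f \<Longrightarrow> T \<in> M \<rightarrow>\<^sub>M N \<Longrightarrow> bounded_measurable M (\<lambda>x. f (T x))"
  by (auto simp: bounded_measurable_def dest: measurable_space)

lemma bounded_measurableI:
  "f \<in> borel_measurable M \<Longrightarrow> (\<And>x. x \<in> space M \<Longrightarrow> a \<le> f x) \<Longrightarrow> (\<And>x. x \<in> space M \<Longrightarrow> f x \<le> b) \<Longrightarrow> bounded_measurable M f"
  unfolding bounded_measurable_def by (intro conjI exI[of _ "max \<bar>a\<bar> \<bar>b\<bar>"]) force+

lemma bounded_measurable_ln: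
  assumes "f \<in> borel_measurable M" "0 < a" "\<And>x. x \<in> space M \<Longrightarrow> a \<le> f x" "\<And>x. x \<in> space M \<Longrightarrow> f x \<le> b"
  shows "bounded_measurable M (\<lambda>x. ln (f x))"
proof (rule bounded_measurableI[of _ _ "ln a" "ln b"])
  fix x assume x: "x \<in> space M"
  show "ln a \<le> ln (f x)" using assms(2) assms(3)[OF x] by simp
  show "ln (f x) \<le> ln b" using assms(2) assms(3)[OF x] assms(4)[OF x] by simp
qed (use assms in measurable)

lemma bounded_measurable_divide:
  assumes "bounded_measurable M g" "f \<in> borel_measurable M" "0 < a" "\<And>x. x \<in> space M \<Longrightarrow> a \<le> f x"
  shows "bounded_measurable M (\<lambda>x. g x / f x)"
proof -
  have "bounded_measurable M (\<lambda>x. 1 / f x)"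
  proof (rule bounded_measurableI[of _ _ 0 "1 / a"])
    fix x assume x: "x \<in> space M"
    show "0 \<le> 1 / f x" "1 / f x \<le> 1 / a" using assms(3) assms(4)[OF x] by (auto simp: frac_le)
  qed (use assms in measurable)
  from bounded_measurable_mult[OF assms(1) this] show ?thesis by simp
qed

lemma (in finite_measure) integrable_bounded_measurable:
  "bounded_measurable M f \<Longrightarrow> integrable M f"
  unfolding bounded_measurable_def using integrable_const_bound[of f] by (auto intro: AE_I2)

lemmas bounded_measurable_intros = bounded_measurable_add bounded_measurable_mult bounded_measurable_diff
  bounded_measurable_const

lemma measure_preserving_integral:
  fixes f :: "'a \<Rightarrow> real"
  assumes "distr M M T = M" "T \<in> M \<rightarrow>\<^sub>M M" "f \<in> borel_measurable M"
  shows "(\<integral>x. f (T x) \<partial>M) = (\<integral>x. f x \<partial>M)"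
  using integral_distr[of T M M f] assms by simp

lemma ennreal_add_le_self: "x + y \<le> x \<Longrightarrow> x \<noteq> \<infinity> \<Longrightarrow> y = 0" for x y :: ennreal
  using ennreal_add_left_cancel_le[of x y 0] by simp

text \<open>
  The Radon-Nikodym derivative obeys the bounds almost everywhere; truncating it makes them hold
  everywhere, so that logarithms and quotients of densities can be handled pointwise.
\<close>
lemma bounded_density_exists:
  fixes a b :: real
  assumes M: "finite_measure M" and sets: "sets M' = sets M" and ab: "0 \<le> a" "a \<le> b"
    and le: "\<And>A. A \<in> sets M \<Longrightarrow> emeasure M' A \<le> ennreal b * emeasure M A"
    and ge: "\<And>A. A \<in> sets M \<Longrightarrow> ennreal a * emeasure M A \<le> emeasure M' A"
  shows "\<exists>F. F \<in> borel_measurable M \<and> (\<forall>x. a \<le> F x \<and> F x \<le> b) \<and> M' = density M (\<lambda>x. ennreal (F x))"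
proof -
  interpret finite_measure M by fact
  have "absolutely_continuous M M'"
    unfolding absolutely_continuous_def
  proof
    fix A assume A: "A \<in> null_sets M"
    have "A \<in> sets M" "emeasure M A = 0" using A by blast+
    then have "emeasure M' A \<le> 0" using le[of A] by simp
    with \<open>A \<in> sets M\<close> show "A \<in> null_sets M'" by (auto simp: sets null_sets_def)
  qed
  then obtain f where f[measurable]: "f \<in> borel_measurable M" and D: "density M f = M'"
    using Radon_Nikodym[of M'] sets by auto
  have up: "AE x in M. f x \<le> ennreal b"
  proof -
    let ?A = "{x \<in> space M. ennreal b < f x}"
    have A[measurable]: "?A \<in> sets M" by measurable
    have 1: "(\<integral>\<^sup>+x. f x * indicator ?A x \<partial>M) \<le> (\<integral>\<^sup>+x. ennreal b * indicator ?A x \<partial>M)"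
      using le[OF A] by (simp add: D[symmetric] emeasure_density nn_integral_cmult_indicator)
    have fin: "(\<integral>\<^sup>+x. ennreal b * indicator ?A x \<partial>M) \<noteq> \<infinity>"
      using emeasure_finite[of ?A] by (simp add: nn_integral_cmult_indicator ennreal_mult_eq_top_iff)
    have 2: "(\<integral>\<^sup>+x. f x * indicator ?A x \<partial>M) =
        (\<integral>\<^sup>+x. ennreal b * indicator ?A x \<partial>M) + (\<integral>\<^sup>+x. (f x - ennreal b) * indicator ?A x \<partial>M)"
      by (subst nn_integral_add[symmetric]) (auto intro!: nn_integral_cong simp: indicator_def add_diff_inverse_ennreal)
    have "(\<integral>\<^sup>+x. (f x - ennreal b) * indicator ?A x \<partial>M) = 0"
      by (rule ennreal_add_le_self[OF 1[unfolded 2] fin])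
    then have "AE x in M. (f x - ennreal b) * indicator ?A x = 0"
      using nn_integral_0_iff_AE[of "\<lambda>x. (f x - ennreal b) * indicator ?A x" M] by simp
    then show ?thesis
      by (rule AE_mp) (auto intro!: AE_I2 simp: indicator_def diff_eq_0_iff_ennreal split: if_splits)
  qed
  have low: "AE x in M. ennreal a \<le> f x"
  proof -
    let ?A = "{x \<in> space M. f x < ennreal a}"
    have A[measurable]: "?A \<in> sets M" by measurable
    have 1: "(\<integral>\<^sup>+x. ennreal a * indicator ?A x \<partial>M) \<le> (\<integral>\<^sup>+x. f x * indicator ?A x \<partial>M)"
      using ge[OF A] by (simp add: D[symmetric] emeasure_density nn_integral_cmult_indicator)
    have "(\<integral>\<^sup>+x. f x * indicator ?A x \<partial>M) \<le> (\<integral>\<^sup>+x. ennreal a * indicator ?A x \<partial>M)"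
      by (intro nn_integral_mono) (auto simp: indicator_def)
    also have fin: "(\<integral>\<^sup>+x. ennreal a * indicator ?A x \<partial>M) < \<infinity>"
      using emeasure_finite[of ?A] by (simp add: nn_integral_cmult_indicator ennreal_mult_eq_top_iff less_top[symmetric])
    finally have fin: "(\<integral>\<^sup>+x. f x * indicator ?A x \<partial>M) \<noteq> \<infinity>" by simp
    have 2: "(\<integral>\<^sup>+x. ennreal a * indicator ?A x \<partial>M) =
        (\<integral>\<^sup>+x. f x * indicator ?A x \<partial>M) + (\<integral>\<^sup>+x. (ennreal a - f x) * indicator ?A x \<partial>M)"
      by (subst nn_integral_add[symmetric]) (auto intro!: nn_integral_cong simp: indicator_def add_diff_inverse_ennreal)
    have "(\<integral>\<^sup>+x. (ennreal a - f x) * indicator ?A x \<partial>M) = 0"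
      by (rule ennreal_add_le_self[OF 1[unfolded 2] fin])
    then have "AE x in M. (ennreal a - f x) * indicator ?A x = 0"
      using nn_integral_0_iff_AE[of "\<lambda>x. (ennreal a - f x) * indicator ?A x" M] by simp
    then show ?thesis
      by (rule AE_mp) (auto intro!: AE_I2 simp: indicator_def diff_eq_0_iff_ennreal split: if_splits)
  qed
  define F where "F x = max a (min b (enn2real (f x)))" for x
  show ?thesis
  proof (intro exI[of _ F] conjI allI)
    show [measurable]: "F \<in> borel_measurable M" unfolding F_def[abs_def] by measurable
    show "a \<le> F x" "F x \<le> b" for x using ab by (auto simp: F_def)
    have "AE x in M. f x = ennreal (F x)"
      using up low
    proof eventually_elim
      case (elim x)
      then have "f x < top" using ennreal_less_top[of b] le_less_trans by blast
      then obtain r where r: "f x = ennreal r" "0 \<le> r" by (cases "f x") auto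
      with elim ab have "a \<le> r" "r \<le> b" by auto
      then show ?case using r by (simp add: F_def)
    qed
    then show "M' = density M (\<lambda>x. ennreal (F x))"
      unfolding D[symmetric] by (intro density_cong) auto
  qed
qed

section \<open>Entropy dissipation decreases under projections\<close>

text \<open>
  The log-sum inequality in tangent form: equality holds at \<open>t = a / b\<close>. The number \<open>t\<close> can be chosen
  freely, for instance as a function of a projection of the point at which \<open>a\<close> and \<open>b\<close> are evaluated.
\<close>
lemma log_sum_tangent:
  fixes a b t :: real
  assumes "a > 0" "b > 0" "t > 0"
  shows "a * ln t + a - b * t \<le> a * (ln a - ln b)"
proof -
  define y where "y = b * t / a"
  have y: "y > 0" using assms by (simp add: y_def)
  have "ln y = ln b + ln t - ln a"
    using assms unfolding y_def by (subst ln_div, simp, simp, subst ln_mult) auto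
  with ln_le_minus_one[OF y] have "ln t + 1 - y \<le> ln a - ln b" by linarith
  then have "a * (ln t + 1 - y) \<le> a * (ln a - ln b)"
    using assms by (intro mult_left_mono) auto
  moreover have "a * y = b * t" using assms by (simp add: y_def)
  ultimately show ?thesis by (simp add: algebra_simps)
qed

text \<open>
  A form of the data processing inequality. Think of \<open>\<phi>\<close> as the conditional expectation of \<open>h\<close> given a
  map that commutes with \<open>R\<close>; the assumptions \<open>proj1\<close> and \<open>proj2\<close> are the only two instances of this
  that the argument uses. The log-sum inequality for \<open>h\<close> and its rotation, with
  \<open>t = \<phi> / (\<phi> \<circ> R')\<close>, replaces the logarithms of \<open>h\<close> by those of \<open>\<phi>\<close>, and the remaining linear terms
  cancel because all densities have the same mass.
\<close>
lemma entropy_dissipation_projection: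
  fixes \<phi> h :: "'a \<Rightarrow> real"
  assumes G: "prob_space G"
    and R[measurable]: "R \<in> G \<rightarrow>\<^sub>M G" "R' \<in> G \<rightarrow>\<^sub>M G" and inv: "distr G G R = G" "distr G G R' = G"
    and RR: "\<And>x. x \<in> space G \<Longrightarrow> R' (R x) = x"
    and [measurable]: "\<phi> \<in> borel_measurable G" "h \<in> borel_measurable G"
    and a: "0 < a" and \<phi>: "\<And>x. x \<in> space G \<Longrightarrow> a \<le> \<phi> x \<and> \<phi> x \<le> b" and h: "\<And>x. x \<in> space G \<Longrightarrow> a \<le> h x \<and> h x \<le> b"
    and same_mass: "(\<integral>x. h x \<partial>G) = (\<integral>x. \<phi> x \<partial>G)"
    and proj1: "(\<integral>x. (ln (\<phi> x) - ln (\<phi> (R' x))) * h x \<partial>G) = (\<integral>x. (ln (\<phi> x) - ln (\<phi> (R' x))) * \<phi> x \<partial>G)"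
    and proj2: "(\<integral>x. \<phi> (R x) / \<phi> x * h x \<partial>G) = (\<integral>x. \<phi> (R x) / \<phi> x * \<phi> x \<partial>G)"
  shows "(\<integral>x. ln (\<phi> x) * (\<phi> x - \<phi> (R x)) \<partial>G) \<le> (\<integral>x. h x * (ln (h x) - ln (h (R' x))) \<partial>G)"
proof -
  interpret prob_space G by fact
  note sp = measurable_space[OF R(1)] measurable_space[OF R(2)]
  have b\<phi>: "bounded_measurable G \<phi>" and bh: "bounded_measurable G h"
    by (rule bounded_measurableI[of _ _ a b], measurable, use \<phi> h in blast, use \<phi> h in blast)+
  have l\<phi>: "bounded_measurable G (\<lambda>x. ln (\<phi> x))" and lh: "bounded_measurable G (\<lambda>x. ln (h x))"
    by (rule bounded_measurable_ln[OF _ a, of _ _ b], measurable, use \<phi> h in blast, use \<phi> h in blast)+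
  note bm = b\<phi> bh l\<phi> lh bounded_measurable_compose[OF b\<phi> R(1)] bounded_measurable_compose[OF b\<phi> R(2)]
    bounded_measurable_compose[OF bh R(1)] bounded_measurable_compose[OF bh R(2)]
    bounded_measurable_compose[OF l\<phi> R(1)] bounded_measurable_compose[OF l\<phi> R(2)]
    bounded_measurable_compose[OF lh R(1)] bounded_measurable_compose[OF lh R(2)]
  have q1: "bounded_measurable G (\<lambda>x. h (R' x) * \<phi> x / \<phi> (R' x))"
    by (rule bounded_measurable_divide[OF _ _ a]) (intro bounded_measurable_mult bm, measurable, use \<phi> sp(2) in blast)
  have q2: "bounded_measurable G (\<lambda>x. \<phi> (R x) / \<phi> x)"
    by (rule bounded_measurable_divide[OF _ _ a]) (intro bm, measurable, use \<phi> in blast)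
  note int = integrable_bounded_measurable bounded_measurable_intros bm q1 q2
  have "(\<integral>x. ln (\<phi> x) * (\<phi> x - \<phi> (R x)) \<partial>G) = (\<integral>x. ln (\<phi> x) * \<phi> x \<partial>G) - (\<integral>x. ln (\<phi> x) * \<phi> (R x) \<partial>G)"
    by (simp add: right_diff_distrib) (intro Bochner_Integration.integral_diff int)
  also have "(\<integral>x. ln (\<phi> x) * \<phi> (R x) \<partial>G) = (\<integral>x. ln (\<phi> (R' (R x))) * \<phi> (R x) \<partial>G)"
    by (intro Bochner_Integration.integral_cong) (simp_all add: RR)
  also have "\<dots> = (\<integral>x. ln (\<phi> (R' x)) * \<phi> x \<partial>G)"
    by (rule measure_preserving_integral[OF inv(1) R(1)]) measurable
  also have "(\<integral>x. ln (\<phi> x) * \<phi> x \<partial>G) - (\<integral>x. ln (\<phi> (R' x)) * \<phi> x \<partial>G) = (\<integral>x. (ln (\<phi> x) - ln (\<phi> (R' x))) * \<phi> x \<partial>G)"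
    by (subst Bochner_Integration.integral_diff[symmetric]) (auto intro!: int simp: left_diff_distrib)
  also have "\<dots> = (\<integral>x. (ln (\<phi> x) - ln (\<phi> (R' x))) * h x \<partial>G)"
    by (rule proj1[symmetric])
  also have "\<dots> \<le> (\<integral>x. h x * (ln (h x) - ln (h (R' x))) - h x + h (R' x) * \<phi> x / \<phi> (R' x) \<partial>G)"
  proof (rule integral_mono)
    fix x assume x: "x \<in> space G"
    have pos: "h x > 0" "h (R' x) > 0" "\<phi> x > 0" "\<phi> (R' x) > 0"
      using \<phi>[OF x] h[OF x] \<phi>[OF sp(2)[OF x]] h[OF sp(2)[OF x]] a by linarith+
    have "ln (\<phi> x / \<phi> (R' x)) = ln (\<phi> x) - ln (\<phi> (R' x))" by (subst ln_div) (use pos in auto)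
    then show "(ln (\<phi> x) - ln (\<phi> (R' x))) * h x \<le> h x * (ln (h x) - ln (h (R' x))) - h x + h (R' x) * \<phi> x / \<phi> (R' x)"
      using log_sum_tangent[of "h x" "h (R' x)" "\<phi> x / \<phi> (R' x)"] pos by (simp add: mult.commute)
  qed (intro int)+
  also have "\<dots> = (\<integral>x. h x * (ln (h x) - ln (h (R' x))) \<partial>G) - (\<integral>x. h x \<partial>G) + (\<integral>x. h (R' x) * \<phi> x / \<phi> (R' x) \<partial>G)"
  proof -
    have "integrable G (\<lambda>x. h x * (ln (h x) - ln (h (R' x))))" "integrable G h" "integrable G (\<lambda>x. h (R' x) * \<phi> x / \<phi> (R' x))"
      by (intro int)+
    then show ?thesis by simp
  qed
  also have "(\<integral>x. h (R' x) * \<phi> x / \<phi> (R' x) \<partial>G) = (\<integral>x. h (R' (R x)) * \<phi> (R x) / \<phi> (R' (R x)) \<partial>G)"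
    by (rule measure_preserving_integral[OF inv(1) R(1), symmetric]) measurable
  also have "\<dots> = (\<integral>x. \<phi> (R x) / \<phi> x * h x \<partial>G)"
    by (intro Bochner_Integration.integral_cong) (simp_all add: RR)
  also have "\<dots> = (\<integral>x. \<phi> (R x) / \<phi> x * \<phi> x \<partial>G)" by (rule proj2)
  also have "\<dots> = (\<integral>x. \<phi> (R x) \<partial>G)"
    using \<phi> a by (intro Bochner_Integration.integral_cong) force+
  also have "\<dots> = (\<integral>x. h x \<partial>G)"
    unfolding same_mass by (rule measure_preserving_integral[OF inv(1) R(1)]) measurable
  finally show ?thesis by simp
qed

section \<open>The two-temperature profile\<close>

text \<open>
  The variance is \<open>1 / (2 * a)\<close>: a fraction \<open>a\<close> of the particles with this variance contributes the
  energy \<open>1 / 2\<close> per particle, half of the total.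
\<close>
definition half_energy_sd :: "real \<Rightarrow> real" where
  "half_energy_sd a = sqrt (1 / (2 * a))"

definition two_temp :: "real \<Rightarrow> real \<Rightarrow> real" where
  "two_temp d x = d * normal_density 0 (half_energy_sd d) x
     + (1 - d) * normal_density 0 (half_energy_sd (1 - d)) x"

abbreviation two_temp_pow :: "real \<Rightarrow> nat \<Rightarrow> (nat \<Rightarrow> real) measure" where
  "two_temp_pow d N \<equiv> PiM {..<N} (\<lambda>_. density lborel (\<lambda>x. ennreal (two_temp d x)))"

text \<open>The density of the cold Gaussian relative to the hot one.\<close>
definition cold_hot :: "real \<Rightarrow> real \<Rightarrow> real" where
  "cold_hot d x = sqrt ((1 - d) / d) * exp (- (1 - 2 * d) * x\<^sup>2)"

definition mix_hot :: "real \<Rightarrow> real \<Rightarrow> real" where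
  "mix_hot d x = d + (1 - d) * cold_hot d x"

lemma half_energy_sd_pos: "a > 0 \<Longrightarrow> half_energy_sd a > 0"
  by (simp add: half_energy_sd_def)

lemma normal_density_half_energy:
  assumes "a > 0"
  shows "normal_density 0 (half_energy_sd a) x = sqrt (a / pi) * exp (- a * x\<^sup>2)"
proof -
  have "(half_energy_sd a)\<^sup>2 = 1 / (2 * a)" using assms by (simp add: half_energy_sd_def)
  then have "normal_density 0 (half_energy_sd a) x = 1 / sqrt (pi / a) * exp (- x\<^sup>2 / (1 / a))"
    unfolding normal_density_def by simp
  also have "1 / sqrt (pi / a) = sqrt (a / pi)" using assms by (simp add: real_sqrt_divide)
  finally show ?thesis using assms by (simp add: mult.commute)
qed

context
  fixes d :: real
  assumes d: "0 < d" "d < 1 / 2"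
begin

lemma cold_hot_density:
  "normal_density 0 (half_energy_sd (1 - d)) x = cold_hot d x * normal_density 0 (half_energy_sd d) x"
proof -
  have "cold_hot d x * normal_density 0 (half_energy_sd d) x =
      (sqrt ((1 - d) / d) * sqrt (d / pi)) * (exp (- (1 - 2 * d) * x\<^sup>2) * exp (- d * x\<^sup>2))"
    using d by (simp add: cold_hot_def normal_density_half_energy)
  also have "sqrt ((1 - d) / d) * sqrt (d / pi) = sqrt ((1 - d) / pi)"
    using d by (simp flip: real_sqrt_mult)
  also have "exp (- (1 - 2 * d) * x\<^sup>2) * exp (- d * x\<^sup>2) = exp (- (1 - d) * x\<^sup>2)"
    by (simp add: algebra_simps flip: exp_add)
  also have "sqrt ((1 - d) / pi) * \<dots> = normal_density 0 (half_energy_sd (1 - d)) x"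
    using d by (simp add: normal_density_half_energy)
  finally show ?thesis ..
qed

lemma cold_hot_pos: "cold_hot d x > 0"
  using d by (simp add: cold_hot_def)

lemma measurable_cold_hot[measurable]: "cold_hot d \<in> borel_measurable borel"
  unfolding cold_hot_def[abs_def] by measurable

lemma measurable_mix_hot[measurable]: "mix_hot d \<in> borel_measurable borel"
  unfolding mix_hot_def[abs_def] by measurable

lemma two_temp_eq: "two_temp d x = normal_density 0 (half_energy_sd d) x * mix_hot d x"
  unfolding two_temp_def cold_hot_density mix_hot_def by (simp add: algebra_simps)

text \<open>
  The hot Gaussian is the right reference measure: its tails dominate those of both components, so the
  relative density of the mixture is bounded from above and from below.
\<close>
lemma mix_hot_bounds: "d \<le> mix_hot d x" "mix_hot d x \<le> 1 / sqrt d"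
proof -
  show "d \<le> mix_hot d x" using d cold_hot_pos[of x] by (simp add: mix_hot_def)
  have "cold_hot d x \<le> sqrt ((1 - d) / d) * 1"
    unfolding cold_hot_def using d by (intro mult_left_mono) (auto intro: mult_nonpos_nonneg)
  then have "mix_hot d x \<le> d + (1 - d) * sqrt ((1 - d) / d)"
    unfolding mix_hot_def using d by (intro add_mono mult_left_mono) auto
  also have "\<dots> \<le> d / sqrt d + (1 - d) * (1 / sqrt d)"
  proof (intro add_mono mult_left_mono)
    have "sqrt d \<le> 1" using d by simp
    then show "d \<le> d / sqrt d" using d by (simp add: field_simps)
    show "sqrt ((1 - d) / d) \<le> 1 / sqrt d" using d by (simp add: real_sqrt_divide divide_right_mono)
  qed (use d in auto)
  also have "\<dots> = 1 / sqrt d" by (simp add: diff_divide_distrib)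
  finally show "mix_hot d x \<le> 1 / sqrt d" .
qed

lemma abs_ln_mix_hot: "\<bar>ln (mix_hot d x)\<bar> \<le> ln (1 / d)"
proof -
  have "1 / sqrt d \<le> 1 / d" using d real_sqrt_le_mono[of "d\<^sup>2" d] mult_left_mono[of d 1 d]
    by (intro divide_left_mono) (auto simp: power2_eq_square)
  then have "mix_hot d x \<le> 1 / d" using mix_hot_bounds(2)[of x] by linarith
  moreover have "mix_hot d x > 0" using mix_hot_bounds(1)[of x] d by linarith
  ultimately have "ln (mix_hot d x) \<le> ln (1 / d)" using d by (subst ln_le_cancel_iff) auto
  moreover have "ln d \<le> ln (mix_hot d x)" using mix_hot_bounds(1)[of x] d \<open>mix_hot d x > 0\<close> by (subst ln_le_cancel_iff) auto
  moreover have "ln (1 / d) = - ln d" using d by (subst ln_div) auto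
  ultimately show ?thesis by linarith
qed

lemma prob_hot: "prob_space (gauss (half_energy_sd d))"
  using d by (intro prob_gauss half_energy_sd_pos)

lemma nn_integral_cold_hot: "(\<integral>\<^sup>+x. ennreal (cold_hot d x) \<partial>gauss (half_energy_sd d)) = 1"
proof -
  interpret C: prob_space "gauss (half_energy_sd (1 - d))"
    using d by (intro prob_gauss half_energy_sd_pos) auto
  have "(\<integral>\<^sup>+x. ennreal (cold_hot d x) \<partial>gauss (half_energy_sd d)) =
      (\<integral>\<^sup>+x. ennreal (normal_density 0 (half_energy_sd (1 - d)) x) \<partial>lborel)"
    by (subst nn_integral_density) (simp_all add: cold_hot_density ennreal_mult less_imp_le[OF cold_hot_pos] mult.commute)
  also have "\<dots> = emeasure (gauss (half_energy_sd (1 - d))) (space (gauss (half_energy_sd (1 - d))))"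
    by (subst emeasure_density) auto
  also have "\<dots> = 1" by (rule C.emeasure_space_1)
  finally show ?thesis .
qed

lemma has_integral_cold_hot: "has_bochner_integral (gauss (half_energy_sd d)) (cold_hot d) 1"
  using nn_integral_cold_hot cold_hot_pos
  by (intro has_bochner_integral_nn_integral) (auto intro: less_imp_le)

lemma has_integral_mix_hot: "has_bochner_integral (gauss (half_energy_sd d)) (mix_hot d) 1"
proof -
  interpret H: prob_space "gauss (half_energy_sd d)" by (rule prob_hot)
  have "has_bochner_integral (gauss (half_energy_sd d)) (\<lambda>_. d) d"
    using H.prob_space by (simp add: has_bochner_integral_iff)
  from has_bochner_integral_add[OF this has_bochner_integral_mult_right[OF has_integral_cold_hot, of "1 - d"]]
  show ?thesis by (simp add: mix_hot_def[abs_def])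
qed

lemma measurable_two_temp[measurable]: "two_temp d \<in> borel_measurable borel"
  unfolding two_temp_def[abs_def] by measurable

lemma two_temp_pos: "two_temp d x > 0"
  using d half_energy_sd_pos by (simp add: two_temp_def add_pos_pos normal_density_pos)

lemma density_two_temp:
  "density lborel (\<lambda>x. ennreal (two_temp d x)) = density (gauss (half_energy_sd d)) (\<lambda>x. ennreal (mix_hot d x))"
  by (subst density_density_eq) (simp_all add: two_temp_eq ennreal_mult')

lemma prob_space_two_temp: "prob_space (density lborel (\<lambda>x. ennreal (two_temp d x)))"
proof
  have "(\<integral>\<^sup>+x. ennreal (mix_hot d x) \<partial>gauss (half_energy_sd d)) = ennreal 1"
    using has_integral_mix_hot mix_hot_bounds(1) d
    by (subst nn_integral_eq_integral) (auto simp: has_bochner_integral_iff intro!: AE_I2 intro: order_trans[OF less_imp_le])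
  then show "emeasure (density lborel (\<lambda>x. ennreal (two_temp d x))) (space (density lborel (\<lambda>x. ennreal (two_temp d x)))) = 1"
    unfolding density_two_temp by (subst emeasure_density) auto
qed

lemma two_temp_pow_density:
  "two_temp_pow d N = density (gauss_pow (half_energy_sd d) N) (\<lambda>x. ennreal (\<Prod>k<N. mix_hot d (x k)))"
proof -
  have "0 \<le> mix_hot d t" for t using mix_hot_bounds(1)[of t] d by linarith
  then show ?thesis
    using prob_space_two_temp prob_hot unfolding density_two_temp
    by (subst PiM_density) (simp_all add: prob_space_imp_sigma_finite prod_ennreal)
qed

section \<open>The projected product densities\<close>

text \<open>
  The projected product measure inherits the bounds of the product density relative to the hot Gaussian
  vector, whose projection is the uniform measure.
\<close>
lemma projected_density_exists:
  assumes N: "N \<ge> 1"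
  shows "\<exists>F. F \<in> borel_measurable (sphere_measure N) \<and> (\<forall>V. d ^ N \<le> F V \<and> F V \<le> (1 / sqrt d) ^ N) \<and>
    distr (two_temp_pow d N) (sphere_space N) (sphere_proj N) = density (sphere_measure N) (\<lambda>V. ennreal (F V))"
proof (rule bounded_density_exists)
  let ?G = "gauss_pow (half_energy_sd d) N" and ?h = "\<lambda>x. \<Prod>k<N. mix_hot d (x k)"
  have sd: "half_energy_sd d > 0" using d by (simp add: half_energy_sd_pos)
  have h: "d ^ N \<le> ?h x" "?h x \<le> (1 / sqrt d) ^ N" for x
  proof -
    have "0 \<le> mix_hot d t" for t using mix_hot_bounds(1)[of t] d by linarith
    then show "d ^ N \<le> ?h x" "?h x \<le> (1 / sqrt d) ^ N"
      using prod_mono[of "{..<N}" "\<lambda>_. d" "\<lambda>k. mix_hot d (x k)"] prod_mono[of "{..<N}" "\<lambda>k. mix_hot d (x k)" "\<lambda>_. 1 / sqrt d"]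
        mix_hot_bounds d by auto
  qed
  interpret S: prob_space "sphere_measure N" using N by (rule prob_space_sphere_measure)
  show "finite_measure (sphere_measure N)" by unfold_locales
  show "sets (distr (two_temp_pow d N) (sphere_space N) (sphere_proj N)) = sets (sphere_measure N)"
    by (simp add: sets_sphere_measure)
  show "0 \<le> d ^ N" using d by simp
  show "d ^ N \<le> (1 / sqrt d) ^ N" using h by (rule order_trans)
  fix A assume A: "A \<in> sets (sphere_measure N)"
  then have A'[measurable]: "A \<in> sets (sphere_space N)" by (simp add: sets_sphere_measure)
  have [measurable]: "sphere_proj N \<in> ?G \<rightarrow>\<^sub>M sphere_space N" by measurable
  have [measurable]: "sphere_proj N \<in> two_temp_pow d N \<rightarrow>\<^sub>M sphere_space N"
    unfolding two_temp_pow_density by simp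
  have [measurable]: "?h \<in> borel_measurable ?G" by measurable
  have P: "emeasure (distr (two_temp_pow d N) (sphere_space N) (sphere_proj N)) A =
     (\<integral>\<^sup>+x. ennreal (?h x) * indicator A (sphere_proj N x) \<partial>?G)"
  proof -
    have "emeasure (distr (two_temp_pow d N) (sphere_space N) (sphere_proj N)) A =
        (\<integral>\<^sup>+V. indicator A V \<partial>distr (two_temp_pow d N) (sphere_space N) (sphere_proj N))"
      by simp
    also have "\<dots> = (\<integral>\<^sup>+x. indicator A (sphere_proj N x) \<partial>two_temp_pow d N)"
      by (rule nn_integral_distr) measurable
    also have "\<dots> = (\<integral>\<^sup>+x. ennreal (?h x) * indicator A (sphere_proj N x) \<partial>?G)"
      unfolding two_temp_pow_density by (rule nn_integral_density) measurable
    finally show ?thesis .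
  qed
  have S: "ennreal c * emeasure (sphere_measure N) A = (\<integral>\<^sup>+x. ennreal c * indicator A (sphere_proj N x) \<partial>?G)" for c
  proof -
    have "emeasure (sphere_measure N) A = (\<integral>\<^sup>+V. indicator A V \<partial>distr ?G (sphere_space N) (sphere_proj N))"
      unfolding sphere_measure_eq_gauss[OF sd N] by simp
    also have "\<dots> = (\<integral>\<^sup>+x. indicator A (sphere_proj N x) \<partial>?G)"
      by (rule nn_integral_distr) measurable
    finally show ?thesis by (simp add: nn_integral_cmult)
  qed
  show "emeasure (distr (two_temp_pow d N) (sphere_space N) (sphere_proj N)) A \<le> ennreal ((1 / sqrt d) ^ N) * emeasure (sphere_measure N) A"
    unfolding P S using h by (intro nn_integral_mono mult_right_mono ennreal_leI) auto
  show "ennreal (d ^ N) * emeasure (sphere_measure N) A \<le> emeasure (distr (two_temp_pow d N) (sphere_space N) (sphere_proj N)) A"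
    unfolding P S using h by (intro nn_integral_mono mult_right_mono ennreal_leI) auto
qed

section \<open>Entropy dissipation of the projected product densities\<close>

text \<open>
  Rotating two coordinates changes the product of the two one-particle densities only through the
  cross terms between the two temperatures: both pure terms are rotation invariant. The cross terms
  have total weight of order \<open>d\<close>, and the logarithms are bounded by \<open>ln (1 / d)\<close>.
\<close>
lemma product_dissipation_bound:
  fixes N i j :: nat and \<theta> :: real
  assumes ij: "i < j" "j < N"
  defines "G \<equiv> gauss_pow (half_energy_sd d) N"
    and "h \<equiv> \<lambda>x. \<Prod>k<N. mix_hot d (x k)"
  shows "(\<integral>x. h x * (ln (h x) - ln (h (kac_rotation i j (- \<theta>) x))) \<partial>G) \<le> 8 * d * ln (1 / d)"
proof -
  let ?R = "kac_rotation i j \<theta>" and ?R' = "kac_rotation i j (- \<theta>)"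
  define K where "K = {..<N} - {i, j}"
  define rest where "rest x = (\<Prod>k\<in>K. mix_hot d (x k))" for x :: "nat \<Rightarrow> real"
  define q where "q x = ln (mix_hot d (x i)) + ln (mix_hot d (x j))" for x :: "nat \<Rightarrow> real"
  define m where "m x = rest x * (cold_hot d (x i) + cold_hot d (x j))" for x :: "nat \<Rightarrow> real"
  have sd: "half_energy_sd d > 0" using d by (simp add: half_energy_sd_pos)
  interpret G: prob_space G unfolding G_def by (intro prob_space_PiM prob_hot)
  interpret P: product_sigma_finite "\<lambda>_::nat. gauss (half_energy_sd d)"
    using prob_hot by (simp add: product_sigma_finite_def prob_space_imp_sigma_finite)
  have Iij: "i < N" "j < N" "i \<noteq> j" using ij by auto
  have split: "(\<Prod>k<N. g k) = g i * g j * (\<Prod>k\<in>K. g k)" for g :: "nat \<Rightarrow> real"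
    using Iij unfolding K_def by (subst prod.subset_diff[of "{i, j}"]) auto
  have mix0: "mix_hot d t > 0" for t using mix_hot_bounds(1)[of t] d by linarith
  have rest0: "rest x > 0" for x unfolding rest_def using mix0 by (intro prod_pos) auto
  have sG: "sets G = sets (PiM {..<N} (\<lambda>_. borel))" unfolding G_def by (rule sets_gauss_pow)
  have comp[measurable]: "(\<lambda>x. x k) \<in> borel_measurable G" if "k < N" for k
    using that by (simp add: measurable_cong_sets[OF sG refl])
  have R[measurable]: "?R \<in> G \<rightarrow>\<^sub>M G" "?R' \<in> G \<rightarrow>\<^sub>M G"
    using measurable_kac_rotation[OF ij] by (simp_all add: measurable_cong_sets[OF sG sG])
  have inv: "distr G G ?R = G" "distr G G ?R' = G"
    unfolding G_def by (rule distr_gauss_pow_rotation[OF sd ij])+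
  have [measurable]: "h \<in> borel_measurable G" "rest \<in> borel_measurable G" "q \<in> borel_measurable G" "m \<in> borel_measurable G"
    unfolding h_def rest_def[abs_def] q_def[abs_def] m_def[abs_def] using Iij
    by (auto simp: K_def intro!: borel_measurable_prod borel_measurable_add borel_measurable_times
          measurable_compose[OF comp measurable_mix_hot] measurable_compose[OF comp measurable_cold_hot]
          borel_measurable_ln)
  have hq: "h x = mix_hot d (x i) * mix_hot d (x j) * rest x" for x
    unfolding h_def rest_def by (rule split)
  have h0: "h x > 0" for x unfolding hq using mix0 rest0 by simp
  have restR: "rest (kac_rotation i j t x) = rest x" for x t
    unfolding rest_def by (intro prod.cong) (auto simp: K_def kac_rotation_def)
  have lnh: "ln (h x) = q x + ln (rest x)" for x
    using mix0[of "x i"] mix0[of "x j"] rest0[of x] unfolding hq q_def by (simp add: ln_mult)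
  have qb: "\<bar>q x\<bar> \<le> 2 * ln (1 / d)" for x
    using abs_ln_mix_hot[of "x i"] abs_ln_mix_hot[of "x j"] unfolding q_def by linarith
  have bh: "bounded_measurable G h"
  proof (rule bounded_measurableI[of _ _ 0 "(1 / sqrt d) ^ N"])
    show "h x \<le> (1 / sqrt d) ^ N" for x
      using prod_mono[of "{..<N}" "\<lambda>k. mix_hot d (x k)" "\<lambda>_. 1 / sqrt d"] mix0 mix_hot_bounds(2)
      by (auto simp: h_def less_imp_le)
  qed (use h0 in \<open>auto simp: less_imp_le\<close>)
  have bq: "bounded_measurable G q"
    unfolding bounded_measurable_def using qb by auto
  note bm = bh bq bounded_measurable_compose[OF bh R(1)] bounded_measurable_compose[OF bq R(2)]
  note int = G.integrable_bounded_measurable bounded_measurable_intros bm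
  \<comment> \<open>The product of the two cold factors depends on the sum of the two squares only and drops out.\<close>
  have key: "\<bar>h x - h (?R x)\<bar> \<le> d * (m x + m (?R x))" for x
  proof -
    let ?y = "?R x"
    have "(x i)\<^sup>2 + (x j)\<^sup>2 = (?y i)\<^sup>2 + (?y j)\<^sup>2"
    proof -
      have *: "(\<Sum>k<N. g k) = g i + g j + (\<Sum>k\<in>K. g k)" for g :: "nat \<Rightarrow> real"
        using Iij unfolding K_def by (subst sum.subset_diff[of "{i, j}"]) auto
      have "(\<Sum>k\<in>K. (?y k)\<^sup>2) = (\<Sum>k\<in>K. (x k)\<^sup>2)"
        by (intro sum.cong) (auto simp: K_def kac_rotation_def)
      then show ?thesis using sum_squares_kac_rotation[OF ij, of \<theta> x] unfolding * by linarith
    qed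
    then have e: "- (1 - 2 * d) * (x i)\<^sup>2 + - (1 - 2 * d) * (x j)\<^sup>2 = - (1 - 2 * d) * (?y i)\<^sup>2 + - (1 - 2 * d) * (?y j)\<^sup>2"
      by (simp only: distrib_left[symmetric])
    have inv2: "cold_hot d (x i) * cold_hot d (x j) = cold_hot d (?y i) * cold_hot d (?y j)"
    proof -
      have "exp (- (1 - 2 * d) * (x i)\<^sup>2) * exp (- (1 - 2 * d) * (x j)\<^sup>2) =
          exp (- (1 - 2 * d) * (?y i)\<^sup>2) * exp (- (1 - 2 * d) * (?y j)\<^sup>2)"
        unfolding exp_add[symmetric] e ..
      then show ?thesis unfolding cold_hot_def by (simp only: mult_ac)
    qed
    have "h x - h ?y = rest x * (d * (1 - d) * ((cold_hot d (x i) + cold_hot d (x j)) - (cold_hot d (?y i) + cold_hot d (?y j)))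
        + (1 - d)\<^sup>2 * (cold_hot d (x i) * cold_hot d (x j) - cold_hot d (?y i) * cold_hot d (?y j)))"
      unfolding hq restR mix_hot_def by (simp add: algebra_simps power2_eq_square)
    also have "\<dots> = d * (1 - d) * (m x - m ?y)"
      unfolding inv2 m_def restR by (simp add: algebra_simps)
    finally have "\<bar>h x - h ?y\<bar> = d * (1 - d) * \<bar>m x - m ?y\<bar>"
      using d by (simp add: abs_mult)
    also have "\<dots> \<le> d * 1 * (m x + m ?y)"
    proof (intro mult_mono)
      have "m z \<ge> 0" for z unfolding m_def using rest0[of z] cold_hot_pos[of "z i"] cold_hot_pos[of "z j"] by simp
      then show "\<bar>m x - m ?y\<bar> \<le> m x + m ?y" by (smt (verit))
    qed (use d in auto)
    finally show ?thesis by simp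
  qed
  \<comment> \<open>One cold factor or the other, with the remaining factors normalised: each of the two terms has mass 1.\<close>
  have im: "has_bochner_integral G m 2"
  proof -
    have one: "has_bochner_integral G (\<lambda>x. rest x * cold_hot d (x l)) 1" if l: "l = i \<and> l' = j \<or> l = j \<and> l' = i" for l l'
    proof -
      \<comment> \<open>The coordinate \<open>l'\<close> of the pair does not occur in the product and gets the factor 1.\<close>
      define f where "f k = (if k = l then cold_hot d else if k = l' then (\<lambda>_. 1) else mix_hot d)" for k
      interpret H: prob_space "gauss (half_energy_sd d)" by (rule prob_hot)
      have hb: "has_bochner_integral (gauss (half_energy_sd d)) (f k) 1" for k
        using has_integral_cold_hot has_integral_mix_hot
        H.prob_space by (auto simp: f_def has_bochner_integral_iff)
      have "(\<Prod>k<N. f k (x k)) = rest x * cold_hot d (x l)" for x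
      proof -
        have "(\<Prod>k\<in>K. f k (x k)) = rest x"
          unfolding rest_def using l by (intro prod.cong) (auto simp: f_def K_def)
        then show ?thesis using l Iij unfolding split by (auto simp: f_def)
      qed
      moreover have "integrable G (\<lambda>x. \<Prod>k<N. f k (x k))"
        unfolding G_def using hb by (intro P.product_integrable_prod) (auto simp: has_bochner_integral_iff)
      moreover have "(\<integral>x. (\<Prod>k<N. f k (x k)) \<partial>G) = 1"
        unfolding G_def using hb by (subst P.product_integral_prod) (auto simp: has_bochner_integral_iff)
      ultimately show ?thesis by (simp add: has_bochner_integral_iff)
    qed
    from has_bochner_integral_add[OF one[of i j] one[of j i]] show ?thesis
      by (simp add: m_def[abs_def] distrib_left)
  qed
  have imR: "integrable G (\<lambda>x. m (?R x))" "(\<integral>x. m (?R x) \<partial>G) = 2"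
  proof -
    show "integrable G (\<lambda>x. m (?R x))"
      using im by (intro integrable_distr[OF R(1)]) (simp add: inv has_bochner_integral_iff)
    show "(\<integral>x. m (?R x) \<partial>G) = 2"
      using im by (subst measure_preserving_integral[OF inv(1) R(1)]) (auto simp: has_bochner_integral_iff)
  qed
  have "(\<integral>x. h x * (ln (h x) - ln (h (?R' x))) \<partial>G) = (\<integral>x. h x * q x - h x * q (?R' x) \<partial>G)"
    unfolding lnh restR by (simp add: algebra_simps)
  also have "\<dots> = (\<integral>x. h x * q x \<partial>G) - (\<integral>x. h x * q (?R' x) \<partial>G)"
    by (intro Bochner_Integration.integral_diff int)
  also have "(\<integral>x. h x * q (?R' x) \<partial>G) = (\<integral>x. h (?R x) * q (?R' (?R x)) \<partial>G)"
    by (rule measure_preserving_integral[OF inv(1) R(1), symmetric]) measurable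
  also have "\<dots> = (\<integral>x. h (?R x) * q x \<partial>G)"
    using kac_rotation_inverse[OF ij(1)] by simp
  also have "(\<integral>x. h x * q x \<partial>G) - (\<integral>x. h (?R x) * q x \<partial>G) = (\<integral>x. h x * q x - h (?R x) * q x \<partial>G)"
    by (intro Bochner_Integration.integral_diff[symmetric] int)
  also have "\<dots> \<le> (\<integral>x. (2 * ln (1 / d) * d) * (m x + m (?R x)) \<partial>G)"
  proof (rule integral_mono)
    fix x
    have "h x * q x - h (?R x) * q x \<le> \<bar>h x - h (?R x)\<bar> * \<bar>q x\<bar>"
      by (simp only: left_diff_distrib[symmetric] abs_mult[symmetric] abs_ge_self)
    also have "\<dots> \<le> (d * (m x + m (?R x))) * (2 * ln (1 / d))"
      using key[of x] qb[of x] by (intro mult_mono) auto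
    finally show "h x * q x - h (?R x) * q x \<le> (2 * ln (1 / d) * d) * (m x + m (?R x))"
      by (simp add: mult_ac)
  next
    show "integrable G (\<lambda>x. h x * q x - h (?R x) * q x)" by (intro int)
    show "integrable G (\<lambda>x. (2 * ln (1 / d) * d) * (m x + m (?R x)))"
      using im imR by (auto simp: has_bochner_integral_iff)
  qed
  also have "\<dots> = 8 * d * ln (1 / d)"
    using im imR by (simp add: has_bochner_integral_iff)
  finally show ?thesis .
qed

text \<open>
  The bound for the product density passes to the sphere because the radial projection commutes with
  rotations away from the origin.
\<close>
lemma projected_dissipation_bound:
  fixes N i j :: nat and \<theta> :: real
  assumes ij: "i < j" "j < N"
    and F[measurable]: "F \<in> borel_measurable (sphere_measure N)"
    and Fb: "\<And>V. d ^ N \<le> F V \<and> F V \<le> (1 / sqrt d) ^ N"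
    and FD: "distr (two_temp_pow d N) (sphere_space N) (sphere_proj N) = density (sphere_measure N) (\<lambda>V. ennreal (F V))"
  shows "(\<integral>V. ln (F V) * (F V - F (kac_rotation i j \<theta> V)) \<partial>sphere_measure N) \<le> 8 * d * ln (1 / d)"
proof -
  let ?R = "kac_rotation i j \<theta>" and ?R' = "kac_rotation i j (- \<theta>)"
  define G where "G = gauss_pow (half_energy_sd d) N"
  define h where "h x = (\<Prod>k<N. mix_hot d (x k))" for x :: "nat \<Rightarrow> real"
  define \<phi> where "\<phi> x = F (sphere_proj N x)" for x
  have sd: "half_energy_sd d > 0" using d by (simp add: half_energy_sd_pos)
  have N: "N \<ge> 1" using ij by simp
  interpret G: prob_space G unfolding G_def by (intro prob_space_PiM prob_hot)
  have sG: "sets G = sets (PiM {..<N} (\<lambda>_. borel))" unfolding G_def by (rule sets_gauss_pow)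
  have R[measurable]: "?R \<in> G \<rightarrow>\<^sub>M G" "?R' \<in> G \<rightarrow>\<^sub>M G"
    using measurable_kac_rotation[OF ij] by (simp_all add: measurable_cong_sets[OF sG sG])
  have inv: "distr G G ?R = G" "distr G G ?R' = G"
    unfolding G_def by (rule distr_gauss_pow_rotation[OF sd ij])+
  have F'[measurable]: "F \<in> borel_measurable (sphere_space N)"
    using F by (simp add: measurable_cong_sets[OF sets_sphere_measure refl])
  have p[measurable]: "sphere_proj N \<in> G \<rightarrow>\<^sub>M sphere_space N"
    using measurable_sphere_proj[of N] by (simp add: measurable_cong_sets[OF sG refl])
  have RS[measurable]: "kac_rotation i j t \<in> sphere_space N \<rightarrow>\<^sub>M sphere_space N" for t
    using measurable_compose[OF measurable_Pair1' measurable_kac_rotation_sphere[OF ij], of t] by simp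
  have \<phi>[measurable]: "\<phi> \<in> borel_measurable G" unfolding \<phi>_def[abs_def] by measurable
  have h[measurable]: "h \<in> borel_measurable G" unfolding h_def[abs_def] G_def by measurable
  have mix0: "mix_hot d t > 0" for t using mix_hot_bounds(1)[of t] d by linarith
  have hb: "d ^ N \<le> h x \<and> h x \<le> (1 / sqrt d) ^ N" for x
    using prod_mono[of "{..<N}" "\<lambda>_. d" "\<lambda>k. mix_hot d (x k)"] prod_mono[of "{..<N}" "\<lambda>k. mix_hot d (x k)" "\<lambda>_. 1 / sqrt d"]
      mix_hot_bounds d mix0 by (auto simp: h_def less_imp_le)
  have h0: "0 \<le> h x" for x unfolding h_def using mix0 by (intro prod_nonneg) (auto simp: less_imp_le)
  have F0: "0 \<le> F V" for V using Fb[of V] zero_le_power[of d N] d by linarith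
  have comm: "AE x in G. sphere_proj N (kac_rotation i j t x) = kac_rotation i j t (sphere_proj N x)" for t
    using AE_gauss_pow_nonzero[OF sd N] unfolding G_def
    by eventually_elim (rule sphere_proj_rotation[OF ij])
  have sig: "(\<integral>V. \<psi> V \<partial>sphere_measure N) = (\<integral>x. \<psi> (sphere_proj N x) \<partial>G)"
    if "\<psi> \<in> borel_measurable (sphere_space N)" for \<psi> :: "(nat \<Rightarrow> real) \<Rightarrow> real"
    unfolding sphere_measure_eq_gauss[OF sd N] G_def[symmetric] by (rule integral_distr[OF p that])
  \<comment> \<open>The density of the projection is the conditional expectation of \<open>h\<close> given the projection.\<close>
  have proj: "(\<integral>x. \<psi> (sphere_proj N x) * h x \<partial>G) = (\<integral>x. \<psi> (sphere_proj N x) * \<phi> x \<partial>G)"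
    if \<psi>[measurable]: "\<psi> \<in> borel_measurable (sphere_space N)" for \<psi> :: "(nat \<Rightarrow> real) \<Rightarrow> real"
  proof -
    have \<psi>': "\<psi> \<in> borel_measurable (sphere_measure N)"
      using \<psi> by (simp add: measurable_cong_sets[OF sets_sphere_measure refl])
    have p2: "sphere_proj N \<in> two_temp_pow d N \<rightarrow>\<^sub>M sphere_space N"
      unfolding two_temp_pow_density using p unfolding G_def by simp
    have "(\<integral>x. \<psi> (sphere_proj N x) * h x \<partial>G) = (\<integral>x. \<psi> (sphere_proj N x) \<partial>two_temp_pow d N)"
      unfolding two_temp_pow_density G_def[symmetric] h_def[symmetric] using h0
      by (subst integral_density) (simp_all add: mult.commute)
    also have "\<dots> = (\<integral>V. \<psi> V \<partial>density (sphere_measure N) (\<lambda>V. ennreal (F V)))"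
      unfolding FD[symmetric] by (rule integral_distr[OF p2 \<psi>, symmetric])
    also have "\<dots> = (\<integral>V. F V * \<psi> V \<partial>sphere_measure N)"
      using F0 \<psi>' by (subst integral_density) simp_all
    also have "\<dots> = (\<integral>x. \<psi> (sphere_proj N x) * \<phi> x \<partial>G)"
      by (subst sig) (auto simp: \<phi>_def mult.commute)
    finally show ?thesis .
  qed
  have \<phi>R: "AE x in G. \<phi> (kac_rotation i j t x) = F (kac_rotation i j t (sphere_proj N x))" for t
    using comm[of t] by eventually_elim (simp add: \<phi>_def)
  have "(\<integral>V. ln (F V) * (F V - F (?R V)) \<partial>sphere_measure N) =
      (\<integral>x. ln (F (sphere_proj N x)) * (F (sphere_proj N x) - F (?R (sphere_proj N x))) \<partial>G)"
    by (rule sig) measurable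
  also have "\<dots> = (\<integral>x. ln (\<phi> x) * (\<phi> x - \<phi> (?R x)) \<partial>G)"
    using \<phi>R[of \<theta>] by (intro integral_cong_AE) (measurable, auto simp: \<phi>_def)
  also have "\<dots> \<le> (\<integral>x. h x * (ln (h x) - ln (h (?R' x))) \<partial>G)"
  proof (rule entropy_dissipation_projection[OF G.prob_space_axioms R inv _ \<phi> h])
    show "?R' (?R x) = x" for x by (rule kac_rotation_inverse[OF ij(1)])
    show "0 < d ^ N" using d by simp
    show "d ^ N \<le> \<phi> x \<and> \<phi> x \<le> (1 / sqrt d) ^ N" for x unfolding \<phi>_def by (rule Fb)
    show "d ^ N \<le> h x \<and> h x \<le> (1 / sqrt d) ^ N" for x by (rule hb)
    show "(\<integral>x. h x \<partial>G) = (\<integral>x. \<phi> x \<partial>G)" using proj[of "\<lambda>_. 1"] by simp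
    have "(\<integral>x. (ln (\<phi> x) - ln (\<phi> (?R' x))) * g x \<partial>G) =
        (\<integral>x. (ln (F (sphere_proj N x)) - ln (F (?R' (sphere_proj N x)))) * g x \<partial>G)"
      if [measurable]: "g \<in> borel_measurable G" for g
      using \<phi>R[of "- \<theta>"] by (intro integral_cong_AE) (measurable, auto simp: \<phi>_def)
    then show "(\<integral>x. (ln (\<phi> x) - ln (\<phi> (?R' x))) * h x \<partial>G) = (\<integral>x. (ln (\<phi> x) - ln (\<phi> (?R' x))) * \<phi> x \<partial>G)"
      using proj[of "\<lambda>V. ln (F V) - ln (F (?R' V))"] by simp
    have "(\<integral>x. \<phi> (?R x) / \<phi> x * g x \<partial>G) = (\<integral>x. F (?R (sphere_proj N x)) / F (sphere_proj N x) * g x \<partial>G)"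
      if [measurable]: "g \<in> borel_measurable G" for g
      using \<phi>R[of \<theta>] by (intro integral_cong_AE) (measurable, auto simp: \<phi>_def)
    from this[OF h] this[OF \<phi>] proj[of "\<lambda>V. F (?R V) / F V"]
    show "(\<integral>x. \<phi> (?R x) / \<phi> x * h x \<partial>G) = (\<integral>x. \<phi> (?R x) / \<phi> x * \<phi> x \<partial>G)"
      by (simp only: F' RS borel_measurable_divide measurable_compose[OF RS F'] simp_thms True_implies_equals)
  qed
  also have "\<dots> \<le> 8 * d * ln (1 / d)"
    using product_dissipation_bound[OF ij, of \<theta>] unfolding G_def h_def .
  finally show ?thesis .
qed

end

section \<open>Entropy dissipation of the Kac generator\<close>

text \<open>
  The generator averages over pairs and angles, and \<open>N\<close> times an average of quantities below \<open>B\<close> is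
  below \<open>N * B\<close>. Boundedness of \<open>F\<close> justifies exchanging the integrals over the angle and the sphere.
\<close>
lemma kac_entropy_production_le:
  fixes F :: "(nat \<Rightarrow> real) \<Rightarrow> real" and a b B :: real
  assumes N: "N \<ge> 2" and F[measurable]: "F \<in> borel_measurable (sphere_measure N)"
    and a: "0 < a" and Fb: "\<And>V. a \<le> F V \<and> F V \<le> b"
    and B: "\<And>i j \<theta>. i < j \<Longrightarrow> j < N \<Longrightarrow>
      (\<integral>V. ln (F V) * (F V - F (kac_rotation i j \<theta> V)) \<partial>sphere_measure N) \<le> B"
  shows "- sphere_inner N (\<lambda>V. ln (F V)) (kac_L N F) \<le> real N * B"
proof -
  define S where "S = sphere_measure N"
  define T where "T = restrict_space lborel {0..2 * pi}"
  interpret S: prob_space S unfolding S_def using N by (intro prob_space_sphere_measure) simp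
  have Tsp: "space T = {0..2 * pi}" unfolding T_def by (simp add: space_restrict_space)
  have Tm: "emeasure T (space T) = ennreal (2 * pi)"
    unfolding Tsp T_def by (subst emeasure_restrict_space) auto
  interpret T: finite_measure T by standard (simp add: Tm)
  have Tmeas: "measure T (space T) = 2 * pi" unfolding measure_def Tm by simp
  interpret ST: pair_sigma_finite S T by standard
  interpret STf: finite_measure "S \<Otimes>\<^sub>M T"
  proof
    show "emeasure (S \<Otimes>\<^sub>M T) (space (S \<Otimes>\<^sub>M T)) \<noteq> \<infinity>"
      unfolding space_pair_measure by (subst T.emeasure_pair_measure_Times) (auto simp: Tm S.emeasure_space_1)
  qed
  have SS: "sets S = sets (sphere_space N)" unfolding S_def by (rule sets_sphere_measure)
  have F'[measurable]: "F \<in> borel_measurable S" using F by (simp add: S_def)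
  have FS: "F \<in> borel_measurable (sphere_space N)" using F' by (simp add: measurable_cong_sets[OF SS refl])
  have bF: "bounded_measurable S F" using Fb by (intro bounded_measurableI[of _ _ a b]) auto
  have bl: "bounded_measurable S (\<lambda>V. ln (F V))" using Fb by (intro bounded_measurable_ln[of _ _ a b] a) auto
  define E where "E = (\<integral>V. ln (F V) * F V \<partial>S)"
  have iE: "integrable S (\<lambda>V. ln (F V) * F V)"
    by (intro S.integrable_bounded_measurable bounded_measurable_mult bF bl)
  define I where "I i j V = 1 / (2 * pi) * (LBINT \<theta>:{0..2*pi}. F (kac_rotation i j \<theta> V))" for i j V
  have I: "integrable S (\<lambda>V. ln (F V) * I i j V) \<and> E - (\<integral>V. ln (F V) * I i j V \<partial>S) \<le> B"
    if ij: "i < j" "j < N" for i j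
  proof -
    let ?f = "\<lambda>V \<theta>. ln (F V) * F (kac_rotation i j \<theta> V)"
    have swap: "(\<lambda>z. (snd z, fst z)) \<in> S \<Otimes>\<^sub>M T \<rightarrow>\<^sub>M borel \<Otimes>\<^sub>M sphere_space N"
    proof (rule measurable_Pair)
      have "(\<lambda>x. x) \<in> T \<rightarrow>\<^sub>M borel" unfolding T_def by (rule measurable_restrict_space1) simp
      then show "snd \<in> S \<Otimes>\<^sub>M T \<rightarrow>\<^sub>M borel" using measurable_compose[OF measurable_snd] by blast
      have "(\<lambda>x. x) \<in> S \<rightarrow>\<^sub>M sphere_space N" by (simp add: measurable_cong_sets[OF SS refl])
      then show "fst \<in> S \<Otimes>\<^sub>M T \<rightarrow>\<^sub>M sphere_space N" using measurable_compose[OF measurable_fst] by blast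
    qed
    have mR: "(\<lambda>z. F (kac_rotation i j (snd z) (fst z))) \<in> borel_measurable (S \<Otimes>\<^sub>M T)"
      using measurable_compose[OF measurable_compose[OF swap measurable_kac_rotation_sphere[OF ij]] FS] by simp
    have "bounded_measurable (S \<Otimes>\<^sub>M T) (\<lambda>z. F (kac_rotation i j (snd z) (fst z)))"
      using Fb mR by (intro bounded_measurableI[of _ _ a b]) auto
    then have "bounded_measurable (S \<Otimes>\<^sub>M T) (\<lambda>z. ln (F (fst z)) * F (kac_rotation i j (snd z) (fst z)))"
      by (intro bounded_measurable_mult bounded_measurable_compose[OF bl]) simp_all
    then have "integrable (S \<Otimes>\<^sub>M T) (\<lambda>z. ln (F (fst z)) * F (kac_rotation i j (snd z) (fst z)))"
      by (rule STf.integrable_bounded_measurable)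
    then have int: "integrable (S \<Otimes>\<^sub>M T) (case_prod ?f)" by (simp add: split_beta')
    have Ieq: "ln (F V) * I i j V = 1 / (2 * pi) * (\<integral>\<theta>. ?f V \<theta> \<partial>T)" for V
      unfolding I_def T_def set_lebesgue_integral_def by (subst integral_restrict_space) (auto simp: mult_ac)
    have i1: "integrable S (\<lambda>V. \<integral>\<theta>. ?f V \<theta> \<partial>T)" and i2: "integrable T (\<lambda>\<theta>. \<integral>V. ?f V \<theta> \<partial>S)"
      using ST.integrable_fst[OF int] ST.integrable_snd[OF int] by auto
    have "E - B \<le> (\<integral>V. ?f V \<theta> \<partial>S)" for \<theta>
    proof -
      have RS: "kac_rotation i j \<theta> \<in> sphere_space N \<rightarrow>\<^sub>M sphere_space N"
        using measurable_compose[OF measurable_Pair1' measurable_kac_rotation_sphere[OF ij], of \<theta>] by simp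
      have "kac_rotation i j \<theta> \<in> S \<rightarrow>\<^sub>M S" using RS by (simp add: measurable_cong_sets[OF SS SS])
      then have i3: "integrable S (\<lambda>V. ?f V \<theta>)"
        by (intro S.integrable_bounded_measurable bounded_measurable_mult bl bounded_measurable_compose[OF bF])
      have "(\<integral>V. ln (F V) * (F V - F (kac_rotation i j \<theta> V)) \<partial>S) = E - (\<integral>V. ?f V \<theta> \<partial>S)"
        unfolding E_def right_diff_distrib by (rule Bochner_Integration.integral_diff[OF iE i3])
      then show ?thesis using B[OF ij, of \<theta>] unfolding S_def[symmetric] by linarith
    qed
    then have "(\<integral>\<theta>. E - B \<partial>T) \<le> (\<integral>\<theta>. \<integral>V. ?f V \<theta> \<partial>S \<partial>T)"
      by (intro integral_mono i2) auto
    also have "\<dots> = (\<integral>V. \<integral>\<theta>. ?f V \<theta> \<partial>T \<partial>S)"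
      by (rule ST.Fubini_integral[OF int])
    finally have "2 * pi * (E - B) \<le> (\<integral>V. \<integral>\<theta>. ?f V \<theta> \<partial>T \<partial>S)" by (simp add: Tmeas)
    then have "E - B \<le> 1 / (2 * pi) * (\<integral>V. \<integral>\<theta>. ?f V \<theta> \<partial>T \<partial>S)"
      using pi_gt_zero by (simp add: field_simps)
    then show ?thesis unfolding Ieq using i1 by (auto simp: algebra_simps)
  qed
  define C where "C = real (N choose 2)"
  have C: "C > 0" using N by (simp add: C_def)
  have pairs: "(\<Sum>j<N. \<Sum>i<j. (1::real)) = C"
  proof -
    have "(\<Sum>j<N. \<Sum>i<j. (1::real)) = real (\<Sum>j<N. j)" by simp
    also have "(\<Sum>j<N. j) = N choose 2"
      using gauss_sum_nat[of "N - 1"] N lessThan_Suc_atMost[of "N - 1"]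
      by (simp add: choose_two atLeast0AtMost mult.commute)
    finally show ?thesis by (simp add: C_def)
  qed
  have "sphere_inner N (\<lambda>V. ln (F V)) (kac_L N F) =
      (\<integral>V. real N * (1 / C * (\<Sum>j<N. \<Sum>i<j. ln (F V) * I i j V) - ln (F V) * F V) \<partial>S)"
    unfolding sphere_inner_def kac_L_def kac_Q_def S_def[symmetric] I_def[symmetric] C_def[symmetric]
    by (intro Bochner_Integration.integral_cong) (simp_all add: sum_distrib_left algebra_simps)
  also have "\<dots> = real N * (1 / C * (\<Sum>j<N. \<Sum>i<j. \<integral>V. ln (F V) * I i j V \<partial>S) - E)"
  proof -
    have s: "integrable S (\<lambda>V. \<Sum>j<N. \<Sum>i<j. ln (F V) * I i j V)"
      using I by (intro Bochner_Integration.integrable_sum) auto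
    have "(\<integral>V. (\<Sum>j<N. \<Sum>i<j. ln (F V) * I i j V) \<partial>S) = (\<Sum>j<N. \<Sum>i<j. \<integral>V. ln (F V) * I i j V \<partial>S)"
      using I by (subst Bochner_Integration.integral_sum, intro Bochner_Integration.integrable_sum, simp, intro sum.cong refl, subst Bochner_Integration.integral_sum) auto
    then show ?thesis using s iE by (simp add: E_def)
  qed
  finally have "- sphere_inner N (\<lambda>V. ln (F V)) (kac_L N F) = real N * (E - 1 / C * (\<Sum>j<N. \<Sum>i<j. \<integral>V. ln (F V) * I i j V \<partial>S))"
    by (simp add: algebra_simps)
  also have "E - 1 / C * (\<Sum>j<N. \<Sum>i<j. \<integral>V. ln (F V) * I i j V \<partial>S) =
      1 / C * (\<Sum>j<N. \<Sum>i<j. E - (\<integral>V. ln (F V) * I i j V \<partial>S))"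
  proof -
    have "(\<Sum>j<N. \<Sum>i<j. E) = C * E"
      unfolding pairs[symmetric] sum_distrib_right by simp
    then show ?thesis using C by (simp only: sum_subtractf) (simp add: field_simps)
  qed
  also have "real N * \<dots> \<le> real N * (1 / C * (\<Sum>j<N. \<Sum>i<j. B))"
    using I C by (intro mult_left_mono sum_mono) auto
  also have "(\<Sum>j<N. \<Sum>i<j. B) = C * B"
    unfolding pairs[symmetric] sum_distrib_right by simp
  finally show ?thesis using C by simp
qed

section \<open>Lower bounds for the entropy\<close>

text \<open>
  A density that charges an event of exponentially small reference measure has large entropy. This is the
  variational characterisation of entropy, \<open>F * ln F \<ge> F * \<Phi> + F - exp \<Phi>\<close>, with \<open>\<Phi> = s * 1\<^sub>A\<close>.
\<close>
lemma entropy_ge_of_event: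
  fixes F :: "'a \<Rightarrow> real" and a b s :: real
  assumes M: "prob_space M" and F[measurable]: "F \<in> borel_measurable M"
    and a: "0 < a" and Fb: "\<And>V. a \<le> F V \<and> F V \<le> b" and F1: "(\<integral>V. F V \<partial>M) = 1"
    and A[measurable]: "A \<in> sets M" and small: "measure M A \<le> exp (- s)"
  shows "s * measure (density M (\<lambda>V. ennreal (F V))) A - 1 \<le> (\<integral>V. F V * ln (F V) \<partial>M)"
proof -
  interpret prob_space M by fact
  define \<Phi> where "\<Phi> V = s * indicator A V" for V
  have bF: "bounded_measurable M F" using Fb by (intro bounded_measurableI[of _ _ a b]) auto
  have bl: "bounded_measurable M (\<lambda>V. ln (F V))" using Fb by (intro bounded_measurable_ln[of _ _ a b] a) auto
  have bi: "bounded_measurable M (indicator A :: 'a \<Rightarrow> real)"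
    by (rule bounded_measurableI[of _ _ 0 1]) auto
  note int = integrable_bounded_measurable bounded_measurable_intros bF bl bi
  have Fpos: "F V > 0" for V using Fb[of V] a by linarith
  have meas: "measure (density M (\<lambda>V. ennreal (F V))) A = (\<integral>V. F V * indicator A V \<partial>M)"
  proof -
    have i: "integrable M (\<lambda>V. F V * indicator A V)" by (intro int)
    have "emeasure (density M (\<lambda>V. ennreal (F V))) A = (\<integral>\<^sup>+V. ennreal (F V * indicator A V) \<partial>M)"
      by (subst emeasure_density) (auto intro!: nn_integral_cong simp: indicator_def)
    also have "\<dots> = ennreal (\<integral>V. F V * indicator A V \<partial>M)"
      using i Fpos by (intro nn_integral_eq_integral) (auto simp: less_imp_le)
    finally show ?thesis using Fpos by (simp add: measure_def integral_nonneg_AE less_imp_le)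
  qed
  have "s * (\<integral>V. F V * indicator A V \<partial>M) + 1 - (\<integral>V. 1 + exp s * indicator A V \<partial>M) =
      (\<integral>V. s * (F V * indicator A V) + F V - (1 + exp s * indicator A V) \<partial>M)"
  proof -
    have "integrable M (\<lambda>V. F V * indicator A V)" "integrable M F" "integrable M (\<lambda>V. 1 + exp s * indicator A V)"
      by (intro int)+
    then show ?thesis by (simp add: F1)
  qed
  also have "\<dots> \<le> (\<integral>V. F V * ln (F V) \<partial>M)"
  proof (rule integral_mono)
    fix V
    have "F V * ln (exp (s * indicator A V)) + F V - 1 * exp (s * indicator A V) \<le> F V * (ln (F V) - ln 1)"
      using Fpos by (intro log_sum_tangent) auto
    moreover have "exp (s * indicator A V) \<le> 1 + exp s * indicator A V" by (simp add: indicator_def)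
    ultimately show "s * (F V * indicator A V) + F V - (1 + exp s * indicator A V) \<le> F V * ln (F V)"
      by (simp add: mult_ac)
  qed (intro int)+
  finally have "s * (\<integral>V. F V * indicator A V \<partial>M) + 1 - (\<integral>V. 1 + exp s * indicator A V \<partial>M) \<le> (\<integral>V. F V * ln (F V) \<partial>M)" .
  moreover have "(\<integral>V. 1 + exp s * indicator A V \<partial>M) \<le> 2"
  proof -
    have "(\<integral>V. 1 + exp s * indicator A V \<partial>M) = 1 + exp s * measure M A"
      using A by (subst Bochner_Integration.integral_add) (auto simp: prob_space integrable_real_indicator emeasure_finite less_top[symmetric])
    also have "exp s * measure M A \<le> exp s * exp (- s)" using small by (intro mult_left_mono) auto
    finally show ?thesis by (simp flip: exp_add)
  qed
  ultimately show ?thesis unfolding meas by linarith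
qed

lemma entropy_pos:
  fixes F :: "'a \<Rightarrow> real" and a b :: real
  assumes M: "prob_space M" and F[measurable]: "F \<in> borel_measurable M"
    and a: "0 < a" and Fb: "\<And>V. a \<le> F V \<and> F V \<le> b" and F1: "(\<integral>V. F V \<partial>M) = 1" and ne: "\<And>V. F V \<noteq> 1"
  shows "(\<integral>V. F V * ln (F V) \<partial>M) > 0"
proof -
  interpret prob_space M by fact
  have bF: "bounded_measurable M F" using Fb by (intro bounded_measurableI[of _ _ a b]) auto
  have bl: "bounded_measurable M (\<lambda>V. ln (F V))" using Fb by (intro bounded_measurable_ln[of _ _ a b] a) auto
  note int = integrable_bounded_measurable bounded_measurable_intros bF bl
  have Fpos: "F V > 0" for V using Fb[of V] a by linarith
  have "0 < F V * ln (F V) - F V + 1" for V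
  proof -
    have "ln (1 / F V) < 1 / F V - 1"
    proof (rule ccontr)
      assume "\<not> ?thesis"
      then have "ln (1 / F V) = 1 / F V - 1" using ln_le_minus_one[of "1 / F V"] Fpos[of V] by auto
      then have "1 / F V = 1" using ln_eq_minus_one[of "1 / F V"] Fpos[of V] by auto
      then show False using ne[of V] by simp
    qed
    then have "F V * (- ln (F V)) < F V * (1 / F V - 1)"
      using Fpos[of V] by (intro mult_strict_left_mono) (auto simp: ln_div)
    then show ?thesis using Fpos[of V] by (simp add: algebra_simps)
  qed
  then have "0 < (\<integral>V. F V * ln (F V) - F V + 1 \<partial>M)"
    by (intro integral_less_AE_space[of "\<lambda>_. 0", simplified] int) (auto simp: emeasure_space_1 intro!: int)
  also have "\<dots> = (\<integral>V. F V * ln (F V) \<partial>M)"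
  proof -
    have "integrable M (\<lambda>V. F V * ln (F V))" "integrable M F" by (intro int)+
    then show ?thesis by (simp add: F1 prob_space)
  qed
  finally show ?thesis .
qed

section \<open>A rare event for the uniform measure\<close>

text \<open>
  For a given energy the sum of the speeds is the smaller, the more unequally the energy is distributed.
  Under the uniform measure it concentrates at \<open>sqrt (2 / pi) * N\<close>, so for a smaller \<open>t\<close> the event is rare.
\<close>
definition low_l1 :: "real \<Rightarrow> nat \<Rightarrow> (nat \<Rightarrow> real) set" where
  "low_l1 t N = {V \<in> kac_sphere N. (\<Sum>j<N. \<bar>V j\<bar>) \<le> t * real N}"

lemma low_l1_sets[measurable]: "low_l1 t N \<in> sets (sphere_space N)"
proof -
  have comp: "(\<lambda>V. V j) \<in> borel_measurable (sphere_space N)" if "j < N" for j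
    unfolding sphere_space_def using that by (intro measurable_restrict_space1) simp
  have "(\<lambda>V. \<Sum>j<N. \<bar>V j\<bar>) \<in> borel_measurable (sphere_space N)"
    using comp by (intro borel_measurable_sum borel_measurable_abs) auto
  then have "{V \<in> space (sphere_space N). (\<Sum>j<N. \<bar>V j\<bar>) \<le> t * real N} \<in> sets (sphere_space N)"
    by measurable
  then show ?thesis by (simp add: low_l1_def space_sphere_space)
qed

lemma exp_le_quadratic:
  fixes x :: real
  shows "exp x \<le> 1 + x + x\<^sup>2 * exp \<bar>x\<bar>"
proof -
  have "norm (exp x - (\<Sum>i\<le>1. x ^ i / fact i)) \<le> exp (norm x) * (norm x ^ Suc 1) / fact 1"
    by (rule Taylor_exp_field)
  then have "\<bar>exp x - (1 + x)\<bar> \<le> exp \<bar>x\<bar> * x\<^sup>2" by (simp add: power2_eq_square)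
  then show ?thesis by (simp add: mult.commute abs_le_iff)
qed

lemma half_energy_sd_half: "half_energy_sd (1 / 2) = 1"
  by (simp add: half_energy_sd_def)

lemma integrable_gauss_quartic_exp:
  "integrable (gauss 1) (\<lambda>z. (z\<^sup>2 + 1)\<^sup>2 * exp ((z\<^sup>2 + 1) / 8))"
proof -
  define c where "c = sqrt ((1 / 2) / pi) / sqrt ((3 / 8) / pi) * exp (1 / 8 :: real)"
  have eq: "normal_density 0 1 z * ((z\<^sup>2 + 1)\<^sup>2 * exp ((z\<^sup>2 + 1) / 8)) =
      c * (normal_density 0 (half_energy_sd (3 / 8)) z * (z - 0) ^ 4 + 2 * (normal_density 0 (half_energy_sd (3 / 8)) z * (z - 0) ^ 2)
        + normal_density 0 (half_energy_sd (3 / 8)) z)" for z :: real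
  proof -
    have e: "exp (- (1 / 2) * z\<^sup>2) * exp ((z\<^sup>2 + 1) / 8) = exp (1 / 8) * exp (- (3 / 8) * z\<^sup>2)"
      by (simp add: algebra_simps flip: exp_add)
    have "normal_density 0 1 z * ((z\<^sup>2 + 1)\<^sup>2 * exp ((z\<^sup>2 + 1) / 8)) =
        sqrt ((1 / 2) / pi) * (exp (- (1 / 2) * z\<^sup>2) * exp ((z\<^sup>2 + 1) / 8)) * (z\<^sup>2 + 1)\<^sup>2"
      using normal_density_half_energy[of "1 / 2" z] unfolding half_energy_sd_half by simp
    also have "\<dots> = c * (sqrt ((3 / 8) / pi) * exp (- (3 / 8) * z\<^sup>2)) * (z\<^sup>2 + 1)\<^sup>2"
      unfolding e c_def by (simp add: field_simps)
    also have "sqrt ((3 / 8) / pi) * exp (- (3 / 8) * z\<^sup>2) = normal_density 0 (half_energy_sd (3 / 8)) z"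
      by (rule normal_density_half_energy[symmetric]) simp
    finally show ?thesis by (simp add: power2_eq_square power4_eq_xxxx algebra_simps)
  qed
  have sd: "half_energy_sd (3 / 8) > 0" by (rule half_energy_sd_pos) simp
  have "integrable lborel (\<lambda>z. normal_density 0 1 z * ((z\<^sup>2 + 1)\<^sup>2 * exp ((z\<^sup>2 + 1) / 8)))"
    unfolding eq using sd
    by (intro integrable_mult_right Bochner_Integration.integrable_add integrable_normal_moment integrable_normal_density)
  then show ?thesis by (subst integrable_density) auto
qed

text \<open>
  The summand has negative mean, so its exponential moment falls below one at a small parameter.
\<close>
lemma gauss_exponential_moment_less_one:
  assumes t: "0 < t" "t < sqrt (2 / pi)"
  shows "\<exists>l>0. integrable (gauss 1) (\<lambda>z. exp (l * (t * (z\<^sup>2 + 1) / 2 - \<bar>z\<bar>))) \<and>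
     (\<integral>z. exp (l * (t * (z\<^sup>2 + 1) / 2 - \<bar>z\<bar>)) \<partial>gauss 1) < 1"
proof -
  interpret G: prob_space "gauss 1" by (rule prob_gauss) simp
  define Y where "Y z = t * (z\<^sup>2 + 1) / 2 - \<bar>z\<bar>" for z :: real
  define k where "k z = (z\<^sup>2 + 1)\<^sup>2 * exp ((z\<^sup>2 + 1) / 8)" for z :: real
  have [measurable]: "Y \<in> borel_measurable borel" unfolding Y_def[abs_def] by measurable
  have ik: "integrable (gauss 1) k" unfolding k_def by (rule integrable_gauss_quartic_exp)
  have "t < 1"
  proof -
    have "2 / pi < 1" using pi_gt3 by simp
    then have "sqrt (2 / pi) < 1" by simp
    with t show ?thesis by linarith
  qed
  have Yb: "\<bar>Y z\<bar> \<le> z\<^sup>2 + 1" for z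
  proof -
    have "0 \<le> (\<bar>z\<bar> - 1)\<^sup>2" by simp
    then have "\<bar>z\<bar> \<le> (z\<^sup>2 + 1) / 2" by (simp add: power2_diff)
    moreover define v where "v = z\<^sup>2 + 1"
    moreover define u where "u = t * v"
    moreover have "u \<le> 1 * v" unfolding u_def v_def using \<open>t < 1\<close> by (intro mult_right_mono) auto
    moreover have "0 \<le> u" unfolding u_def v_def using t by simp
    moreover have "0 \<le> \<bar>z\<bar>" by simp
    ultimately have "u / 2 - \<bar>z\<bar> \<le> v" "- (u / 2 - \<bar>z\<bar>) \<le> v" by argo+
    then have "\<bar>u / 2 - \<bar>z\<bar>\<bar> \<le> v" by (simp only: abs_le_iff)
    then show ?thesis by (simp add: Y_def u_def v_def)
  qed
  have m: "has_bochner_integral (gauss 1) Y (t - sqrt (2 / pi))"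
  proof -
    have 2: "has_bochner_integral lborel (\<lambda>z. normal_density 0 1 z * z\<^sup>2) 1"
      using normal_moment_even[of 1 0 1] by (simp add: fact_2 numeral_2_eq_2)
    have 1: "has_bochner_integral lborel (\<lambda>z. normal_density 0 1 z * \<bar>z\<bar>) (sqrt (2 / pi))"
      using normal_moment_abs_odd[of 1 0 0] by simp
    have 0: "has_bochner_integral lborel (normal_density 0 1) 1"
      by (simp add: has_bochner_integral_iff)
    have "has_bochner_integral lborel (\<lambda>z. t / 2 * (normal_density 0 1 z * z\<^sup>2 + normal_density 0 1 z) - normal_density 0 1 z * \<bar>z\<bar>)
        (t / 2 * (1 + 1) - sqrt (2 / pi))"
      by (intro has_bochner_integral_diff has_bochner_integral_mult_right has_bochner_integral_add 0 1 2)
    moreover have "(\<lambda>z. t / 2 * (normal_density 0 1 z * z\<^sup>2 + normal_density 0 1 z) - normal_density 0 1 z * \<bar>z\<bar>) = (\<lambda>z. normal_density 0 1 z *\<^sub>R Y z)"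
      by (simp add: Y_def fun_eq_iff algebra_simps add_divide_distrib)
    ultimately have "has_bochner_integral lborel (\<lambda>z. normal_density 0 1 z *\<^sub>R Y z) (t - sqrt (2 / pi))" by simp
    then show ?thesis by (intro has_bochner_integral_density) auto
  qed
  define K where "K = (\<integral>z. k z \<partial>gauss 1)"
  have K: "K \<ge> 0" unfolding K_def k_def by (intro integral_nonneg_AE) simp
  \<comment> \<open>The quadratic error must not exceed half of the linear gain, and at most \<open>1 / 8\<close> keeps the moment finite.\<close>
  define l where "l = min (1 / 8) ((sqrt (2 / pi) - t) / (2 * (K + 1)))"
  have l: "0 < l" "l \<le> 1 / 8" and lK: "l * (2 * (K + 1)) \<le> sqrt (2 / pi) - t"
  proof -
    show "0 < l" using t K by (simp add: l_def)
    show "l \<le> 1 / 8" unfolding l_def by (rule min.cobounded1)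
    have "l \<le> (sqrt (2 / pi) - t) / (2 * (K + 1))" by (simp add: l_def)
    then show "l * (2 * (K + 1)) \<le> sqrt (2 / pi) - t" using K by (subst (asm) pos_le_divide_eq) auto
  qed
  have bound: "exp (l * Y z) \<le> 1 + l * Y z + l\<^sup>2 * k z" for z
  proof -
    have "\<bar>l * Y z\<bar> \<le> 1 / 8 * (z\<^sup>2 + 1)"
      unfolding abs_mult using l Yb[of z] by (intro mult_mono) auto
    then have e: "exp \<bar>l * Y z\<bar> \<le> exp ((z\<^sup>2 + 1) / 8)" by simp
    have "(l * Y z)\<^sup>2 \<le> l\<^sup>2 * (z\<^sup>2 + 1)\<^sup>2"
      unfolding power_mult_distrib using Yb[of z] by (intro mult_left_mono) (auto simp: abs_le_square_iff[symmetric])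
    then have "(l * Y z)\<^sup>2 * exp \<bar>l * Y z\<bar> \<le> (l\<^sup>2 * (z\<^sup>2 + 1)\<^sup>2) * exp ((z\<^sup>2 + 1) / 8)"
      using e by (intro mult_mono) auto
    with exp_le_quadratic[of "l * Y z"] show ?thesis by (simp add: k_def mult.assoc)
  qed
  have ib: "integrable (gauss 1) (\<lambda>z. 1 + l * Y z + l\<^sup>2 * k z)"
    using m ik by (auto simp: has_bochner_integral_iff)
  have ie: "integrable (gauss 1) (\<lambda>z. exp (l * Y z))"
  proof (rule Bochner_Integration.integrable_bound[OF ib])
    show "AE z in gauss 1. norm (exp (l * Y z)) \<le> norm (1 + l * Y z + l\<^sup>2 * k z)"
      using bound by (intro AE_I2) (metis abs_ge_self exp_ge_zero norm_of_real order_trans real_norm_def abs_of_nonneg)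
  qed measurable
  have "(\<integral>z. exp (l * Y z) \<partial>gauss 1) \<le> (\<integral>z. 1 + l * Y z + l\<^sup>2 * k z \<partial>gauss 1)"
    by (rule integral_mono[OF ie ib bound])
  also have "\<dots> = 1 + l * (t - sqrt (2 / pi)) + l\<^sup>2 * K"
    using m ik G.prob_space by (simp add: has_bochner_integral_iff K_def)
  also have "\<dots> = 1 - l * ((sqrt (2 / pi) - t) - l * K)" by (simp add: algebra_simps power2_eq_square)
  also have "\<dots> < 1"
  proof -
    have "l * K < l * (2 * (K + 1))" using l K by (intro mult_strict_left_mono) auto
    then have "0 < (sqrt (2 / pi) - t) - l * K" using lK by linarith
    then have "0 < l * ((sqrt (2 / pi) - t) - l * K)" using l by (intro mult_pos_pos)
    then show ?thesis by linarith
  qed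
  finally show ?thesis using l ie unfolding Y_def by blast
qed

text \<open>
  On the sphere the event compares an \<open>L1\<close> norm with an \<open>L2\<close> norm. The arithmetic-geometric mean
  inequality \<open>sqrt N * |x| \<le> (N + |x|^2) / 2\<close> turns it, for the Gaussian vector that is projected to
  the sphere, into a deviation of a sum of independent terms.
\<close>
lemma sphere_low_l1_exponentially_small:
  assumes t: "0 < t" "t < sqrt (2 / pi)"
  shows "\<exists>\<eta>>0. \<forall>N\<ge>1. measure (sphere_measure N) (low_l1 t N) \<le> exp (- (\<eta> * real N))"
proof -
  obtain l where l: "l > 0" and i: "integrable (gauss 1) (\<lambda>z. exp (l * (t * (z\<^sup>2 + 1) / 2 - \<bar>z\<bar>)))"
    and m: "(\<integral>z. exp (l * (t * (z\<^sup>2 + 1) / 2 - \<bar>z\<bar>)) \<partial>gauss 1) < 1"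
    using gauss_exponential_moment_less_one[OF t] by blast
  define Y where "Y z = t * (z\<^sup>2 + 1) / 2 - \<bar>z\<bar>" for z :: real
  define M where "M = (\<integral>z. exp (l * Y z) \<partial>gauss 1)"
  interpret G1: prob_space "gauss 1" by (rule prob_gauss) simp
  have M1: "M < 1" using m by (simp add: M_def Y_def)
  have M0: "M \<ge> 0" unfolding M_def by (intro integral_nonneg_AE) simp
  \<comment> \<open>The maximum only keeps the logarithm away from 0.\<close>
  define \<eta> where "\<eta> = - ln (max M (1 / 2))"
  have \<eta>: "\<eta> > 0" "exp (- \<eta>) \<ge> M" using M1 by (auto simp: \<eta>_def)
  show ?thesis
  proof (intro exI[of _ \<eta>] conjI allI impI \<eta>(1))
    fix N :: nat assume N: "N \<ge> 1"
    let ?G = "gauss_pow 1 N"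
    interpret G: prob_space ?G by (intro prob_space_PiM prob_gauss) simp
    interpret P: product_sigma_finite "\<lambda>_::nat. gauss 1"
      using prob_gauss by (simp add: product_sigma_finite_def prob_space_imp_sigma_finite)
    have [measurable]: "Y \<in> borel_measurable borel" unfolding Y_def[abs_def] by measurable
    have iP: "integrable ?G (\<lambda>x. \<Prod>j<N. exp (l * Y (x j)))"
      using i by (intro P.product_integrable_prod) (auto simp: Y_def)
    have "measure (sphere_measure N) (low_l1 t N) = measure ?G (sphere_proj N -` low_l1 t N \<inter> space ?G)"
      by (subst sphere_measure_eq_gauss[of 1]) (use N in \<open>auto intro!: measure_distr\<close>)
    also have "\<dots> \<le> measure ?G {x \<in> space ?G. (\<Prod>j<N. exp (l * Y (x j))) \<ge> 1}"
    proof (rule G.finite_measure_mono_AE)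
      show "AE x in ?G. x \<in> sphere_proj N -` low_l1 t N \<inter> space ?G \<longrightarrow> x \<in> {x \<in> space ?G. 1 \<le> (\<Prod>j<N. exp (l * Y (x j)))}"
        using AE_gauss_pow_nonzero[OF zero_less_one N]
      proof eventually_elim
        case (elim x)
        show ?case
        proof
          assume x: "x \<in> sphere_proj N -` low_l1 t N \<inter> space ?G"
          define r where "r = L2_set x {..<N}"
          have r: "r > 0" using elim L2_set_nonneg[of x "{..<N}"] by (simp add: r_def less_le)
          have r2: "r\<^sup>2 = (\<Sum>j<N. (x j)\<^sup>2)" by (simp add: r_def L2_set_def sum_nonneg)
          have "(\<Sum>j<N. \<bar>sphere_proj N x j\<bar>) \<le> t * real N" using x by (simp add: low_l1_def)
          also have "(\<Sum>j<N. \<bar>sphere_proj N x j\<bar>) = sqrt (real N) * (\<Sum>j<N. \<bar>x j\<bar>) / r"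
            using elim r by (simp add: sphere_proj_def radial_proj_def r_def[symmetric] abs_mult sum_distrib_left sum_divide_distrib)
          finally have "sqrt (real N) * (\<Sum>j<N. \<bar>x j\<bar>) \<le> t * real N * r"
            using r by (simp add: pos_divide_le_eq)
          also have "t * real N * r = sqrt (real N) * (t * (sqrt (real N) * r))" by simp
          finally have "(\<Sum>j<N. \<bar>x j\<bar>) \<le> t * (sqrt (real N) * r)"
            using N by (subst (asm) mult_le_cancel_left_pos) auto
          also have "\<dots> \<le> t * ((real N + r\<^sup>2) / 2)"
          proof (intro mult_left_mono)
            have "0 \<le> (sqrt (real N) - r)\<^sup>2" by simp
            then show "sqrt (real N) * r \<le> (real N + r\<^sup>2) / 2" by (simp add: power2_diff)
          qed (use t in simp)
          also have "\<dots> = (\<Sum>j<N. t * ((x j)\<^sup>2 + 1) / 2)"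
            unfolding r2 by (simp add: sum.distrib sum_divide_distrib sum_distrib_left algebra_simps add_divide_distrib)
          finally have "0 \<le> (\<Sum>j<N. Y (x j))" by (simp add: Y_def sum_subtractf)
          then have "1 \<le> exp (\<Sum>j<N. l * Y (x j))" using l by (simp add: sum_distrib_left[symmetric])
          then show "x \<in> {x \<in> space ?G. 1 \<le> (\<Prod>j<N. exp (l * Y (x j)))}"
            using x by (simp add: exp_sum)
        qed
      qed
    qed measurable
    also have "\<dots> \<le> (\<integral>x. (\<Prod>j<N. exp (l * Y (x j))) \<partial>?G) / 1"
      using iP by (intro integral_Markov_inequality_measure[of _ _ "{}"]) (auto intro!: AE_I2 prod_nonneg)
    also have "\<dots> = M ^ N"
      using i by (subst P.product_integral_prod) (simp_all add: M_def Y_def)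
    also have "\<dots> \<le> exp (- \<eta>) ^ N" using \<eta> M0 by (intro power_mono)
    also have "\<dots> = exp (- (\<eta> * real N))" by (simp flip: exp_of_nat_mult add: mult.commute)
    finally show "measure (sphere_measure N) (low_l1 t N) \<le> exp (- (\<eta> * real N))" .
  qed
qed

section \<open>Law of large numbers and chaos\<close>

definition avg :: "(real \<Rightarrow> real) \<Rightarrow> nat \<Rightarrow> (nat \<Rightarrow> real) \<Rightarrow> real" where
  "avg g N x = (\<Sum>j<N. g (x j)) / real N"

lemma compose_permutation_eq:
  fixes V :: "nat \<Rightarrow> real"
  assumes p: "p permutes {..<N}" and V: "V \<in> extensional {..<N}"
  shows "V \<circ> p = (\<lambda>n\<in>{..<N}. V (p n))"
proof
  fix n show "(V \<circ> p) n = (\<lambda>n\<in>{..<N}. V (p n)) n"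
    using V permutes_not_in[OF p, of n] by (cases "n < N") (auto simp: extensional_def)
qed

lemma L2_set_permutation:
  assumes p: "p permutes {..<N}"
  shows "L2_set (\<lambda>n\<in>{..<N}. V (p n)) {..<N} = L2_set V {..<N}"
proof -
  have "(\<Sum>n<N. (V (p n))\<^sup>2) = (\<Sum>n<N. (V n)\<^sup>2)" using sum.permute[OF p, of "\<lambda>n. (V n)\<^sup>2"] by (simp add: o_def)
  then show ?thesis by (simp add: L2_set_def)
qed

lemma measurable_permute_sphere:
  assumes p: "p permutes {..<N}"
  shows "(\<lambda>V. V \<circ> p) \<in> sphere_space N \<rightarrow>\<^sub>M sphere_space N"
proof -
  have pN: "p n < N" if "n < N" for n using permutes_in_image[OF p, of n] that by simp
  have "(\<lambda>V. \<lambda>n\<in>{..<N}. V (p n)) \<in> PiM {..<N} (\<lambda>_. borel :: real measure) \<rightarrow>\<^sub>M PiM {..<N} (\<lambda>_. borel)"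
    using pN by (intro measurable_restrict) auto
  then have "(\<lambda>V. \<lambda>n\<in>{..<N}. V (p n)) \<in> sphere_space N \<rightarrow>\<^sub>M sphere_space N"
    using kac_sphere_def L2_set_permutation[OF p] space_sphere_space[of N] unfolding sphere_space_def
    by (intro measurable_restrict_space2 measurable_restrict_space1) auto
  then show ?thesis
    by (rule measurable_cong[THEN iffD1, rotated]) (auto simp: space_sphere_space kac_sphere_def compose_permutation_eq[OF p])
qed

context
  fixes \<mu> :: "real measure"
  assumes prob_mu: "prob_space \<mu>" and sets_mu: "sets \<mu> = sets borel"
begin

abbreviation iid_seq :: "(nat \<Rightarrow> real) measure" where
  "iid_seq \<equiv> PiM UNIV (\<lambda>_. \<mu>)"

lemma prob_iid_seq: "prob_space iid_seq"
  by (intro prob_space_PiM prob_mu)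

lemma iid_seq_restrict:
  shows "distr iid_seq (PiM {..<N} (\<lambda>_. \<mu>)) (\<lambda>x. restrict x {..<N}) = PiM {..<N} (\<lambda>_. \<mu>)"
proof -
  interpret P: product_prob_space "\<lambda>_::nat. \<mu>" UNIV
    by (rule product_prob_spaceI) (rule prob_mu)
  show ?thesis by (rule P.distr_PiM_restrict_finite) auto
qed

lemma iid_seq_product:
  fixes c :: "real \<Rightarrow> real"
  assumes "i \<noteq> j" and c: "integrable \<mu> c"
  shows "has_bochner_integral iid_seq (\<lambda>x. c (x i) * c (x j)) ((\<integral>z. c z \<partial>\<mu>)\<^sup>2)"
proof -
  interpret P: product_prob_space "\<lambda>_::nat. \<mu>" UNIV
    by (rule product_prob_spaceI) (rule prob_mu)
  let ?I = "{i, j}"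
  have D: "distr iid_seq (PiM ?I (\<lambda>_. \<mu>)) (\<lambda>x. restrict x ?I) = PiM ?I (\<lambda>_. \<mu>)"
    by (rule P.distr_PiM_restrict_finite) auto
  have r: "(\<lambda>x. restrict x ?I) \<in> iid_seq \<rightarrow>\<^sub>M PiM ?I (\<lambda>_. \<mu>)"
    by (rule measurable_restrict_subset) simp
  have i: "integrable (PiM ?I (\<lambda>_. \<mu>)) (\<lambda>y. \<Prod>k\<in>?I. c (y k))"
    using c by (intro P.product_integrable_prod) auto
  have "(\<integral>y. (\<Prod>k\<in>?I. c (y k)) \<partial>PiM ?I (\<lambda>_. \<mu>)) = (\<Prod>k\<in>?I. \<integral>z. c z \<partial>\<mu>)"
    using c by (intro P.product_integral_prod) auto
  then have v: "(\<integral>y. (\<Prod>k\<in>?I. c (y k)) \<partial>PiM ?I (\<lambda>_. \<mu>)) = (\<integral>z. c z \<partial>\<mu>)\<^sup>2"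
    using assms(1) by (simp add: power2_eq_square)
  have eq: "(\<Prod>k\<in>?I. c (restrict x ?I k)) = c (x i) * c (x j)" for x :: "nat \<Rightarrow> real"
    using assms(1) by simp
  have "integrable iid_seq (\<lambda>x. \<Prod>k\<in>?I. c (restrict x ?I k))"
    by (rule integrable_distr[OF r]) (simp only: D i)
  moreover have "(\<integral>x. (\<Prod>k\<in>?I. c (restrict x ?I k)) \<partial>iid_seq) = (\<integral>z. c z \<partial>\<mu>)\<^sup>2"
    unfolding v[symmetric] by (subst D[symmetric], rule integral_distr[OF r, symmetric]) (use i in auto)
  ultimately show ?thesis unfolding eq by (simp add: has_bochner_integral_iff)
qed

lemma iid_seq_single:
  fixes c :: "real \<Rightarrow> real"
  assumes c: "integrable \<mu> c"
  shows "has_bochner_integral iid_seq (\<lambda>x. c (x i)) (\<integral>z. c z \<partial>\<mu>)"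
proof -
  have D: "distr iid_seq \<mu> (\<lambda>x. x i) = \<mu>"
    by (rule distr_PiM_component) (simp_all add: prob_mu)
  have r: "(\<lambda>x. x i) \<in> iid_seq \<rightarrow>\<^sub>M \<mu>" by (rule measurable_component_singleton) simp
  have "integrable iid_seq (\<lambda>x. c (x i))" by (rule integrable_distr[OF r]) (simp only: D c)
  moreover have "(\<integral>x. c (x i) \<partial>iid_seq) = (\<integral>z. c z \<partial>\<mu>)"
    by (subst (2) D[symmetric], rule integral_distr[OF r, symmetric]) (use c in auto)
  ultimately show ?thesis by (simp add: has_bochner_integral_iff)
qed

text \<open>
  The variance of the average is of order \<open>1 / N\<close>, and \<open>2 * s \<le> s\<^sup>2 + 1\<close>, scaled by \<open>sqrt N\<close>, turns
  this into a bound for the first absolute moment.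
\<close>
lemma L1_law_of_large_numbers:
  fixes g :: "real \<Rightarrow> real"
  assumes g[measurable]: "g \<in> borel_measurable borel" and g2: "integrable \<mu> (\<lambda>z. (g z)\<^sup>2)"
    and g1: "has_bochner_integral \<mu> g m"
  shows "(\<lambda>N. \<integral>x. \<bar>avg g N x - m\<bar> \<partial>iid_seq) \<longlonglongrightarrow> 0" and "integrable iid_seq (\<lambda>x. \<bar>avg g N x - m\<bar>)"
proof -
  interpret mu: prob_space \<mu> by (rule prob_mu)
  interpret P: prob_space iid_seq by (rule prob_iid_seq)
  define c where "c z = g z - m" for z
  define v where "v = (\<integral>z. (c z)\<^sup>2 \<partial>\<mu>)"
  have [measurable]: "c \<in> borel_measurable borel" unfolding c_def[abs_def] by measurable
  have ic: "integrable \<mu> c" and c0: "(\<integral>z. c z \<partial>\<mu>) = 0"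
    using g1 mu.prob_space unfolding c_def[abs_def] by (auto simp: has_bochner_integral_iff)
  have ic2: "integrable \<mu> (\<lambda>z. (c z)\<^sup>2)"
    using g2 g1 unfolding c_def power2_diff by (auto simp: has_bochner_integral_iff)
  have v: "v \<ge> 0" unfolding v_def by (intro integral_nonneg_AE) simp
  have pair: "has_bochner_integral iid_seq (\<lambda>x. c (x i) * c (x j)) (if i = j then v else 0)" for i j
    using iid_seq_product[of i j c] iid_seq_single[OF ic2, of i] ic c0
    by (auto simp: v_def power2_eq_square)
  have sq: "has_bochner_integral iid_seq (\<lambda>x. (\<Sum>i<N. c (x i))\<^sup>2) (real N * v)" for N
  proof -
    have "has_bochner_integral iid_seq (\<lambda>x. \<Sum>i<N. \<Sum>j<N. c (x i) * c (x j)) (\<Sum>i<N. \<Sum>j<N. if i = j then v else 0)"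
      by (intro has_bochner_integral_sum pair)
    then show ?thesis by (simp add: power2_eq_square sum_product)
  qed
  have dev: "avg g N x - m = (\<Sum>i<N. c (x i)) / real N" if "N > 0" for N x
    using that by (simp add: avg_def c_def sum_subtractf diff_divide_distrib)
  have "integrable iid_seq (\<lambda>x. (\<Sum>i<N. g (x i)) / real N - m)" for N
    using iid_seq_single[of g] g1 by (auto simp: has_bochner_integral_iff intro!: Bochner_Integration.integrable_sum)
  then show int: "integrable iid_seq (\<lambda>x. \<bar>avg g N x - m\<bar>)" for N
    unfolding avg_def by (rule integrable_abs)
  have bound: "(\<integral>x. \<bar>avg g N x - m\<bar> \<partial>iid_seq) \<le> (v + 1) / (2 * sqrt (real N))" if N: "N > 0" for N
  proof -
    define w where "w = sqrt (real N)"
    have w: "w > 0" "w\<^sup>2 = real N" using N by (auto simp: w_def)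
    have "(\<integral>x. \<bar>avg g N x - m\<bar> \<partial>iid_seq) \<le> (\<integral>x. ((\<Sum>i<N. c (x i))\<^sup>2 / real N + 1) * (1 / (2 * w)) \<partial>iid_seq)"
    proof (rule integral_mono)
      show "integrable iid_seq (\<lambda>x. ((\<Sum>i<N. c (x i))\<^sup>2 / real N + 1) * (1 / (2 * w)))"
        using sq[of N] by (auto simp: has_bochner_integral_iff)
      fix x
      define s where "s = \<bar>\<Sum>i<N. c (x i)\<bar>"
      have "0 \<le> (s / w - 1)\<^sup>2" by simp
      then have "2 * (s / w) \<le> s\<^sup>2 / w\<^sup>2 + 1" by (simp add: power2_diff power_divide)
      then have "2 * (s / w) * (1 / (2 * w)) \<le> (s\<^sup>2 / w\<^sup>2 + 1) * (1 / (2 * w))"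
        using w by (intro mult_right_mono) auto
      also have "2 * (s / w) * (1 / (2 * w)) = s / real N" using w by (simp add: field_simps power2_eq_square)
      finally show "\<bar>avg g N x - m\<bar> \<le> ((\<Sum>i<N. c (x i))\<^sup>2 / real N + 1) * (1 / (2 * w))"
        using N unfolding dev[OF N] w(2) by (simp add: s_def)
    qed (rule int)
    also have "\<dots> = (v + 1) / (2 * w)"
      using sq[of N] N P.prob_space by (simp add: has_bochner_integral_iff)
    finally show ?thesis by (simp add: w_def)
  qed
  show "(\<lambda>N. \<integral>x. \<bar>avg g N x - m\<bar> \<partial>iid_seq) \<longlonglongrightarrow> 0"
  proof (rule tendsto_sandwich[of "\<lambda>_. 0"])
    show "\<forall>\<^sub>F N in sequentially. (\<integral>x. \<bar>avg g N x - m\<bar> \<partial>iid_seq) \<le> (v + 1) / (2 * sqrt (real N))"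
      using bound eventually_gt_at_top[of "0::nat"] by (rule eventually_mono[rotated])
    show "(\<lambda>N. (v + 1) / (2 * sqrt (real N))) \<longlonglongrightarrow> 0" by real_asymp
  qed (auto intro!: always_eventually)
qed

text \<open>
  Convergence in \<open>L1\<close> gives almost sure convergence along subsequences, which is enough to pass to
  the limit in the integrals of bounded functionals.
\<close>
lemma iid_seq_limit:
  fixes \<Psi> :: "nat \<Rightarrow> (nat \<Rightarrow> real) \<Rightarrow> real"
  assumes m2: "has_bochner_integral \<mu> (\<lambda>z. z\<^sup>2) 1" and m1: "has_bochner_integral \<mu> (\<lambda>z. \<bar>z\<bar>) m"
    and m4: "integrable \<mu> (\<lambda>z. z ^ 4)"
    and [measurable]: "\<And>N. N \<ge> k \<Longrightarrow> \<Psi> N \<in> borel_measurable iid_seq" "L \<in> borel_measurable iid_seq"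
    and b: "\<And>N x. \<bar>\<Psi> N x\<bar> \<le> B"
    and lim: "\<And>x r. strict_mono r \<Longrightarrow> (\<lambda>n. avg (\<lambda>z. z\<^sup>2) (r n) x) \<longlonglongrightarrow> 1 \<Longrightarrow> (\<lambda>n. avg abs (r n) x) \<longlonglongrightarrow> m
      \<Longrightarrow> (\<lambda>n. \<Psi> (r n) x) \<longlonglongrightarrow> L x"
  shows "(\<lambda>N. \<integral>x. \<Psi> N x \<partial>iid_seq) \<longlonglongrightarrow> (\<integral>x. L x \<partial>iid_seq)"
proof (rule ccontr)
  interpret P: prob_space iid_seq by (rule prob_iid_seq)
  let ?a = "\<lambda>N. \<integral>x. \<Psi> N x \<partial>iid_seq" and ?l = "\<integral>x. L x \<partial>iid_seq"
  define u where "u N x = \<bar>avg (\<lambda>z. z\<^sup>2) N x - 1\<bar> + \<bar>avg abs N x - m\<bar>" for N x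
  have m4': "integrable \<mu> (\<lambda>z. (z\<^sup>2)\<^sup>2)" using m4 by simp
  have m2': "integrable \<mu> (\<lambda>z. \<bar>z\<bar>\<^sup>2)" using m2 by (simp add: has_bochner_integral_iff)
  have "(\<lambda>z::real. z\<^sup>2) \<in> borel_measurable borel" "(abs :: real \<Rightarrow> real) \<in> borel_measurable borel" by measurable
  note l2 = L1_law_of_large_numbers[OF this(1) m4' m2] and l1 = L1_law_of_large_numbers[OF this(2) m2' m1]
  have iu: "integrable iid_seq (u N)" for N
    unfolding u_def by (intro Bochner_Integration.integrable_add l1(2) l2(2))
  have u0: "(\<lambda>N. \<integral>x. u N x \<partial>iid_seq) \<longlonglongrightarrow> 0"
  proof -
    have "(\<integral>x. u N x \<partial>iid_seq) = (\<integral>x. \<bar>avg (\<lambda>z. z\<^sup>2) N x - 1\<bar> \<partial>iid_seq) + (\<integral>x. \<bar>avg abs N x - m\<bar> \<partial>iid_seq)" for N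
      unfolding u_def by (rule Bochner_Integration.integral_add[OF l2(2) l1(2)])
    then show ?thesis using tendsto_add[OF l2(1) l1(1)] by simp
  qed
  assume "\<not> ?a \<longlonglongrightarrow> ?l"
  then obtain e where e: "e > 0" and "\<not> (\<forall>\<^sub>F N in sequentially. dist (?a N) ?l < e)"
    by (auto simp: tendsto_iff)
  then obtain r :: "nat \<Rightarrow> nat" where r: "strict_mono r" and far: "\<And>n. \<not> dist (?a (r n)) ?l < e"
    using not_eventually_sequentiallyD[of "\<lambda>N. dist (?a N) ?l < e"] by blast
  have "(\<lambda>n. \<integral>x. norm (u (r n) x) \<partial>iid_seq) \<longlonglongrightarrow> 0"
    using LIMSEQ_subseq_LIMSEQ[OF u0 r] by (simp add: o_def u_def)
  then obtain s where s: "strict_mono s" and ae: "AE x in iid_seq. (\<lambda>n. u (r (s n)) x) \<longlonglongrightarrow> 0"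
    using tendsto_L1_AE_subseq[of iid_seq "\<lambda>n. u (r n)"] iu by blast
  \<comment> \<open>The shift by \<open>k\<close> skips the indices at which \<open>\<Psi>\<close> need not be measurable.\<close>
  define q where "q n = r (s (n + k))" for n
  have rs: "strict_mono q" using r s by (auto simp: strict_mono_def q_def)
  have qk: "q n \<ge> k" for n
    using seq_suble[OF r, of "s (n + k)"] seq_suble[OF s, of "n + k"] by (simp add: q_def)
  have "(\<lambda>n. ?a (q n)) \<longlonglongrightarrow> ?l"
  proof (rule integral_dominated_convergence[where w = "\<lambda>_. B"])
    show "AE x in iid_seq. (\<lambda>n. \<Psi> (q n) x) \<longlonglongrightarrow> L x"
      using ae
    proof eventually_elim
      case (elim x)
      then have u: "(\<lambda>n. u (q n) x) \<longlonglongrightarrow> 0" unfolding q_def by (rule LIMSEQ_ignore_initial_segment)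
      have "(\<lambda>n. avg (\<lambda>z. z\<^sup>2) (q n) x - 1) \<longlonglongrightarrow> 0"
        by (rule Lim_null_comparison[OF _ u]) (auto simp: u_def)
      moreover have "(\<lambda>n. avg abs (q n) x - m) \<longlonglongrightarrow> 0"
        by (rule Lim_null_comparison[OF _ u]) (auto simp: u_def)
      ultimately show ?case using lim[OF rs, of x] by (simp add: LIM_zero_iff)
    qed
  qed (use b qk in auto)
  then have "\<forall>\<^sub>F n in sequentially. dist (?a (q n)) ?l < e" using e by (auto simp: tendsto_iff)
  then show False using far by (auto simp: q_def dest: eventually_happens)
qed

lemma sphere_proj_eq_avg:
  assumes "avg (\<lambda>z. z\<^sup>2) N x > 0" "i < N"
  shows "sphere_proj N x i = x i / sqrt (avg (\<lambda>z. z\<^sup>2) N x)"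
proof -
  have N: "real N > 0" using assms by simp
  have L: "L2_set x {..<N} = sqrt (real N) * sqrt (avg (\<lambda>z. z\<^sup>2) N x)"
    using N by (simp add: L2_set_def avg_def real_sqrt_divide)
  have "sqrt (avg (\<lambda>z. z\<^sup>2) N x) > 0" using assms by simp
  with L N have "L2_set x {..<N} \<noteq> 0" by simp
  then show ?thesis using assms N by (simp add: sphere_proj_def radial_proj_def L)
qed

lemma sphere_proj_restrict: "sphere_proj N (restrict x {..<N}) = sphere_proj N x"
proof -
  have "L2_set (restrict x {..<N}) {..<N} = L2_set x {..<N}" by (intro L2_set_cong) auto
  then show ?thesis by (auto simp: sphere_proj_def radial_proj_def fun_eq_iff)
qed

lemma measurable_sphere_proj_iid: "sphere_proj N \<in> iid_seq \<rightarrow>\<^sub>M sphere_space N"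
proof -
  have "(\<lambda>x. restrict x {..<N}) \<in> iid_seq \<rightarrow>\<^sub>M PiM {..<N} (\<lambda>_. \<mu>)"
    by (rule measurable_restrict_subset) simp
  moreover have "sets (PiM {..<N} (\<lambda>_. \<mu>)) = sets (PiM {..<N} (\<lambda>_. borel))"
    by (rule sets_PiM_cong) (simp_all add: sets_mu)
  ultimately have "(\<lambda>x. restrict x {..<N}) \<in> iid_seq \<rightarrow>\<^sub>M PiM {..<N} (\<lambda>_. borel)"
    using measurable_cong_sets[OF refl] by blast
  from measurable_compose[OF this measurable_sphere_proj] show ?thesis by (simp add: sphere_proj_restrict)
qed

lemma projected_iid:
  "distr (PiM {..<N} (\<lambda>_. \<mu>)) (sphere_space N) (sphere_proj N) = distr iid_seq (sphere_space N) (sphere_proj N)"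
proof -
  have p: "sphere_proj N \<in> PiM {..<N} (\<lambda>_. \<mu>) \<rightarrow>\<^sub>M sphere_space N"
    using measurable_sphere_proj[of N]
    by (subst measurable_cong_sets[OF sets_PiM_cong[OF refl sets_mu] refl]) simp
  have r: "(\<lambda>x. restrict x {..<N}) \<in> iid_seq \<rightarrow>\<^sub>M PiM {..<N} (\<lambda>_. \<mu>)"
    by (rule measurable_restrict_subset) simp
  show ?thesis
    by (subst iid_seq_restrict[symmetric], subst distr_distr[OF p r]) (simp add: o_def sphere_proj_restrict)
qed

lemma measurable_test_function:
  fixes \<phi> :: "(nat \<Rightarrow> real) \<Rightarrow> real"
  assumes "continuous_on (extensional {..<k}) \<phi>"
  shows "\<phi> \<in> borel_measurable (PiM {..<k} (\<lambda>_. borel))"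
proof -
  have "(\<lambda>x. x) \<in> PiM {..<k} (\<lambda>_. borel :: real measure) \<rightarrow>\<^sub>M (borel :: (nat \<Rightarrow> real) measure)"
  proof (rule measurable_coordinatewise_then_product)
    fix i
    show "(\<lambda>x. x i) \<in> borel_measurable (PiM {..<k} (\<lambda>_. borel :: real measure))"
    proof (cases "i < k")
      case False
      have "(\<lambda>x. undefined) \<in> borel_measurable (PiM {..<k} (\<lambda>_. borel :: real measure))" by simp
      then show ?thesis
        by (rule measurable_cong[THEN iffD1, rotated]) (use False in \<open>auto simp: space_PiM PiE_def extensional_def\<close>)
    qed simp
  qed
  then have "(\<lambda>x. x) \<in> PiM {..<k} (\<lambda>_. borel :: real measure) \<rightarrow>\<^sub>M restrict_space borel (extensional {..<k})"
    by (rule measurable_restrict_space2[rotated]) (auto simp: space_PiM PiE_def)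
  from measurable_compose[OF this borel_measurable_continuous_on_restrict[OF assms]] show ?thesis .
qed

lemma restrict_tendsto:
  fixes y :: "nat \<Rightarrow> nat \<Rightarrow> real"
  assumes "\<And>i. i < k \<Longrightarrow> (\<lambda>n. y n i) \<longlonglongrightarrow> x i"
  shows "(\<lambda>n. restrict (y n) {..<k}) \<longlonglongrightarrow> restrict x {..<k}"
proof -
  have "limitin (product_topology (\<lambda>_. euclidean) UNIV) (\<lambda>n. restrict (y n) {..<k}) (restrict x {..<k}) sequentially"
    using assms by (auto simp: limitin_componentwise restrict_def)
  then show ?thesis by (simp add: euclidean_product_topology)
qed

text \<open>
  The norm of the vector divided by \<open>sqrt N\<close> tends to 1, so the projection to the sphere multiplies the
  first \<open>k\<close> coordinates by a factor that tends to 1.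
\<close>
theorem projected_iid_chaos:
  fixes \<phi> :: "(nat \<Rightarrow> real) \<Rightarrow> real"
  assumes m2: "has_bochner_integral \<mu> (\<lambda>z. z\<^sup>2) 1" and m1: "has_bochner_integral \<mu> (\<lambda>z. \<bar>z\<bar>) m"
    and m4: "integrable \<mu> (\<lambda>z. z ^ 4)"
    and \<phi>: "continuous_on (extensional {..<k}) \<phi>" "bounded (\<phi> ` extensional {..<k})"
  shows "(\<lambda>N. \<integral>x. \<phi> x \<partial>marginal k (distr iid_seq (sphere_space N) (sphere_proj N)))
     \<longlonglongrightarrow> (\<integral>x. \<phi> x \<partial>PiM {..<k} (\<lambda>_. \<mu>))"
proof -
  obtain B where B: "\<And>x. x \<in> extensional {..<k} \<Longrightarrow> \<bar>\<phi> x\<bar> \<le> B"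
    using \<phi>(2) by (auto simp: bounded_iff)
  have m\<phi>: "\<phi> \<in> borel_measurable (PiM {..<k} (\<lambda>_. borel))" by (rule measurable_test_function[OF \<phi>(1)])
  have r: "(\<lambda>V. restrict V {..<k}) \<in> sphere_space N \<rightarrow>\<^sub>M PiM {..<k} (\<lambda>_. borel)" if "N \<ge> k" for N
    unfolding sphere_space_def using that by (intro measurable_restrict_space1 measurable_restrict_subset) auto
  have rp: "(\<lambda>x. restrict (sphere_proj N x) {..<k}) \<in> iid_seq \<rightarrow>\<^sub>M PiM {..<k} (\<lambda>_. borel)" if "N \<ge> k" for N
    using measurable_compose[OF measurable_sphere_proj_iid r[OF that]] .
  have eq: "(\<integral>x. \<phi> x \<partial>marginal k (distr iid_seq (sphere_space N) (sphere_proj N))) =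
      (\<integral>x. \<phi> (restrict (sphere_proj N x) {..<k}) \<partial>iid_seq)" if N: "N \<ge> k" for N
  proof -
    have "marginal k (distr iid_seq (sphere_space N) (sphere_proj N)) =
        distr iid_seq (PiM {..<k} (\<lambda>_. borel)) (\<lambda>x. restrict (sphere_proj N x) {..<k})"
      unfolding marginal_def using distr_distr[OF r[OF N] measurable_sphere_proj_iid] by (simp add: o_def)
    then show ?thesis using integral_distr[OF rp[OF N] m\<phi>] by simp
  qed
  have sk: "sets (PiM {..<k} (\<lambda>_. \<mu>)) = sets (PiM {..<k} (\<lambda>_. borel))"
    by (rule sets_PiM_cong) (simp_all add: sets_mu)
  have rk: "(\<lambda>x. restrict x {..<k}) \<in> iid_seq \<rightarrow>\<^sub>M PiM {..<k} (\<lambda>_. \<mu>)"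
    by (rule measurable_restrict_subset) simp
  have m\<phi>': "\<phi> \<in> borel_measurable (PiM {..<k} (\<lambda>_. \<mu>))" using m\<phi> by (simp add: measurable_cong_sets[OF sk refl])
  have "(\<lambda>N. \<integral>x. \<phi> (restrict (sphere_proj N x) {..<k}) \<partial>iid_seq) \<longlonglongrightarrow> (\<integral>x. \<phi> (restrict x {..<k}) \<partial>iid_seq)"
  proof (rule iid_seq_limit[OF m2 m1 m4, where k = k and B = B])
    show "(\<lambda>x. \<phi> (restrict (sphere_proj N x) {..<k})) \<in> borel_measurable iid_seq" if "N \<ge> k" for N
      by (rule measurable_compose[OF rp[OF that] m\<phi>])
    show "(\<lambda>x. \<phi> (restrict x {..<k})) \<in> borel_measurable iid_seq"
      by (rule measurable_compose[OF rk m\<phi>'])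
    show "\<bar>\<phi> (restrict (sphere_proj N x) {..<k})\<bar> \<le> B" for N x by (intro B) simp
    fix x :: "nat \<Rightarrow> real" and r :: "nat \<Rightarrow> nat"
    assume r: "strict_mono r" and a2: "(\<lambda>n. avg (\<lambda>z. z\<^sup>2) (r n) x) \<longlonglongrightarrow> 1"
    have "(\<lambda>n. restrict (sphere_proj (r n) x) {..<k}) \<longlonglongrightarrow> restrict x {..<k}"
    proof (rule restrict_tendsto)
      fix i assume i: "i < k"
      have "(\<lambda>n. x i / sqrt (avg (\<lambda>z. z\<^sup>2) (r n) x)) \<longlonglongrightarrow> x i / sqrt 1"
        by (intro tendsto_intros a2) simp
      moreover have "\<forall>\<^sub>F n in sequentially. x i / sqrt (avg (\<lambda>z. z\<^sup>2) (r n) x) = sphere_proj (r n) x i"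
        using order_tendstoD(1)[OF a2, of 0, simplified] eventually_ge_at_top[of "Suc i"]
      proof eventually_elim
        case (elim n)
        have "n \<le> r n" by (rule seq_suble[OF r])
        with elim show ?case by (intro sphere_proj_eq_avg[symmetric]) auto
      qed
      ultimately show "(\<lambda>n. sphere_proj (r n) x i) \<longlonglongrightarrow> x i"
        by (auto dest: Lim_transform_eventually)
    qed
    then show "(\<lambda>n. \<phi> (restrict (sphere_proj (r n) x) {..<k})) \<longlonglongrightarrow> \<phi> (restrict x {..<k})"
      by (rule continuous_on_tendsto_compose[OF \<phi>(1)]) auto
  qed
  moreover have "(\<integral>x. \<phi> (restrict x {..<k}) \<partial>iid_seq) = (\<integral>x. \<phi> x \<partial>PiM {..<k} (\<lambda>_. \<mu>))"
    using integral_distr[OF rk m\<phi>'] by (simp only: iid_seq_restrict)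
  moreover have "\<forall>\<^sub>F N in sequentially. (\<integral>x. \<phi> (restrict (sphere_proj N x) {..<k}) \<partial>iid_seq) =
      (\<integral>x. \<phi> x \<partial>marginal k (distr iid_seq (sphere_space N) (sphere_proj N)))"
    using eventually_ge_at_top[of k] by eventually_elim (simp add: eq)
  ultimately show ?thesis by (auto dest: Lim_transform_eventually)
qed

text \<open>
  After the projection the mean absolute coordinate is the average of \<open>\<bar>x j\<bar>\<close> divided by the root mean
  square, which tends to \<open>m\<close>.
\<close>
theorem projected_iid_low_l1:
  assumes m2: "has_bochner_integral \<mu> (\<lambda>z. z\<^sup>2) 1" and m1: "has_bochner_integral \<mu> (\<lambda>z. \<bar>z\<bar>) m"
    and m4: "integrable \<mu> (\<lambda>z. z ^ 4)" and mt: "m < t"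
  shows "(\<lambda>N. measure (distr iid_seq (sphere_space N) (sphere_proj N)) (low_l1 t N)) \<longlonglongrightarrow> 1"
proof -
  interpret P: prob_space iid_seq by (rule prob_iid_seq)
  have meas: "sphere_proj N -` low_l1 t N \<inter> space iid_seq \<in> sets iid_seq" for N
    by (rule measurable_sets[OF measurable_sphere_proj_iid low_l1_sets])
  have eq: "measure (distr iid_seq (sphere_space N) (sphere_proj N)) (low_l1 t N) =
      (\<integral>x. indicator (sphere_proj N -` low_l1 t N \<inter> space iid_seq) x \<partial>iid_seq)" for N
    using meas[of N] by (subst measure_distr[OF measurable_sphere_proj_iid low_l1_sets]) simp
  have sp: "space iid_seq = UNIV" using sets_eq_imp_space_eq[OF sets_mu] by (simp add: space_PiM)
  have "(\<lambda>N. \<integral>x. indicator (sphere_proj N -` low_l1 t N \<inter> space iid_seq) x \<partial>iid_seq) \<longlonglongrightarrow> (\<integral>x. (1::real) \<partial>iid_seq)"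
  proof (rule iid_seq_limit[OF m2 m1 m4, where k = 0 and B = 1])
    show "indicator (sphere_proj N -` low_l1 t N \<inter> space iid_seq) \<in> borel_measurable iid_seq" for N
      using meas[of N] by (rule borel_measurable_indicator)
    show "\<bar>indicator (sphere_proj N -` low_l1 t N \<inter> space iid_seq) x\<bar> \<le> (1::real)" for N x
      by (simp add: indicator_def)
    fix x :: "nat \<Rightarrow> real" and r :: "nat \<Rightarrow> nat"
    assume r: "strict_mono r" and a2: "(\<lambda>n. avg (\<lambda>z. z\<^sup>2) (r n) x) \<longlonglongrightarrow> 1" and a1: "(\<lambda>n. avg abs (r n) x) \<longlonglongrightarrow> m"
    have "(\<lambda>n. avg abs (r n) x / sqrt (avg (\<lambda>z. z\<^sup>2) (r n) x)) \<longlonglongrightarrow> m / sqrt 1"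
      by (intro tendsto_intros a1 a2) simp
    then have q: "\<forall>\<^sub>F n in sequentially. avg abs (r n) x / sqrt (avg (\<lambda>z. z\<^sup>2) (r n) x) < t"
      using mt by (intro order_tendstoD(2)) auto
    have "\<forall>\<^sub>F n in sequentially. 1 = (indicator (sphere_proj (r n) -` low_l1 t (r n) \<inter> space iid_seq) x :: real)"
      using order_tendstoD(1)[OF a2, of 0, simplified] q eventually_ge_at_top[of "1::nat"]
    proof eventually_elim
      case (elim n)
      let ?N = "r n" and ?s = "sqrt (avg (\<lambda>z. z\<^sup>2) (r n) x)"
      have N: "?N > 0" using elim(3) seq_suble[OF r, of n] by linarith
      have s: "?s > 0" using elim(1) by simp
      have "(\<Sum>j<?N. \<bar>sphere_proj ?N x j\<bar>) = (\<Sum>j<?N. \<bar>x j\<bar> / ?s)"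
        using s by (intro sum.cong refl) (simp add: sphere_proj_eq_avg[OF elim(1)])
      also have "\<dots> = avg abs ?N x / ?s * real ?N"
      proof -
        have "(\<Sum>j<?N. \<bar>x j\<bar> / w) = avg abs ?N x / w * real ?N" for w
          using N by (simp add: avg_def sum_divide_distrib[symmetric])
        then show ?thesis .
      qed
      also have "\<dots> \<le> t * real ?N" using elim(2) by (intro mult_right_mono) auto
      finally have "sphere_proj ?N x \<in> low_l1 t ?N" by (simp add: low_l1_def sphere_proj_in_sphere)
      then show ?case by (simp add: sp)
    qed
    then show "(\<lambda>n. indicator (sphere_proj (r n) -` low_l1 t (r n) \<inter> space iid_seq) x) \<longlonglongrightarrow> (1::real)"
      by (rule Lim_transform_eventually[OF tendsto_const])
  qed simp
  then show ?thesis unfolding eq using P.prob_space by simp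
qed

lemma projected_iid_symmetric:
  assumes p: "p permutes {..<N}"
  shows "distr (distr (PiM {..<N} (\<lambda>_. \<mu>)) (sphere_space N) (sphere_proj N)) (sphere_space N) (\<lambda>V. V \<circ> p) =
    distr (PiM {..<N} (\<lambda>_. \<mu>)) (sphere_space N) (sphere_proj N)" (is "?lhs = ?rhs")
proof -
  let ?P = "PiM {..<N} (\<lambda>_. \<mu>)"
  have sP: "sets ?P = sets (PiM {..<N} (\<lambda>_. borel))" by (rule sets_PiM_cong) (simp_all add: sets_mu)
  have spP: "space ?P = extensional {..<N}" using sets_eq_imp_space_eq[OF sets_mu] by (simp add: space_PiM PiE_def)
  have sp: "sphere_proj N \<in> ?P \<rightarrow>\<^sub>M sphere_space N"
    using measurable_sphere_proj[of N] by (simp add: measurable_cong_sets[OF sP refl])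
  have pN: "p n < N" if "n < N" for n using permutes_in_image[OF p, of n] that by simp
  note perm = measurable_permute_sphere[OF p]
  have "?lhs = distr ?P (sphere_space N) (\<lambda>x. sphere_proj N x \<circ> p)"
    using distr_distr[OF perm sp] by (simp add: o_def)
  also have "\<dots> = distr ?P (sphere_space N) (\<lambda>x. sphere_proj N (\<lambda>n\<in>{..<N}. x (p n)))"
  proof (rule distr_cong)
    fix x assume "x \<in> space ?P"
    have "sphere_proj N x \<in> extensional {..<N}" using sphere_proj_in_sphere[of N x] by (simp add: kac_sphere_def)
    then show "sphere_proj N x \<circ> p = sphere_proj N (\<lambda>n\<in>{..<N}. x (p n))"
      using pN by (subst compose_permutation_eq[OF p]) (auto simp: sphere_proj_def radial_proj_def L2_set_permutation[OF p] fun_eq_iff)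
  qed simp_all
  also have "\<dots> = distr (distr ?P ?P (\<lambda>x. \<lambda>n\<in>{..<N}. x (p n))) (sphere_space N) (sphere_proj N)"
  proof -
    have "(\<lambda>x. \<lambda>n\<in>{..<N}. x (p n)) \<in> ?P \<rightarrow>\<^sub>M ?P"
      using pN by (intro measurable_restrict measurable_component_singleton) auto
    from distr_distr[OF sp this] show ?thesis by (simp add: o_def)
  qed
  also have "distr ?P ?P (\<lambda>x. \<lambda>n\<in>{..<N}. x (p n)) = ?P"
    using pN permutes_inj_on[OF p] by (intro distr_PiM_reindex prob_mu) auto
  finally show ?thesis .
qed

end

section \<open>Regularity and moments of the two-temperature profile\<close>

lemma deriv_poly_gaussians:
  fixes a b :: real
  shows "((\<lambda>x. poly p x * exp (a * x\<^sup>2) + poly q x * exp (b * x\<^sup>2)) has_real_derivative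
    poly (pderiv p + [:0, 2 * a:] * p) x * exp (a * x\<^sup>2) + poly (pderiv q + [:0, 2 * b:] * q) x * exp (b * x\<^sup>2)) (at x)"
  by (auto intro!: derivative_eq_intros simp: algebra_simps)

text \<open>
  This form of function is closed under differentiation; a single polynomial factor is not enough because
  the two exponents differ.
\<close>
lemma smooth_poly_gaussians:
  fixes a b :: real
  shows "smooth_real (\<lambda>x. poly p x * exp (a * x\<^sup>2) + poly q x * exp (b * x\<^sup>2))" (is "smooth_real (?g p q)")
proof -
  have form: "\<exists>p' q'. (deriv ^^ n) (?g p q) = ?g p' q'" for n
  proof (induction n)
    case 0
    show ?case by (intro exI[of _ p] exI[of _ q]) simp
  next
    case (Suc n)
    then obtain p' q' where "(deriv ^^ n) (?g p q) = ?g p' q'" by blast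
    then have "(deriv ^^ Suc n) (?g p q) = deriv (?g p' q')" by simp
    also have "\<dots> = ?g (pderiv p' + [:0, 2 * a:] * p') (pderiv q' + [:0, 2 * b:] * q')"
      by (intro ext DERIV_imp_deriv deriv_poly_gaussians)
    finally show ?case by blast
  qed
  have diff: "?g p' q' differentiable at x" for p' q' x
    unfolding real_differentiable_def by (rule exI) (rule deriv_poly_gaussians)
  have "(deriv ^^ n) (?g p q) differentiable at x" for n x
  proof -
    obtain p' q' where "(deriv ^^ n) (?g p q) = ?g p' q'" using form[of n] by blast
    then show ?thesis using diff[of p' q' x] by simp
  qed
  then show ?thesis unfolding smooth_real_def by blast
qed

context
  fixes d :: real
  assumes d: "0 < d" "d < 1 / 2"
begin

lemma two_temp_exp:
  "two_temp d x = poly [:d * sqrt (d / pi):] x * exp (- d * x\<^sup>2) + poly [:(1 - d) * sqrt ((1 - d) / pi):] x * exp (- (1 - d) * x\<^sup>2)"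
  using d by (simp add: two_temp_def normal_density_half_energy)

lemma smooth_two_temp: "smooth_real (two_temp d)"
  using smooth_poly_gaussians[of "[:d * sqrt (d / pi):]" "- d" "[:(1 - d) * sqrt ((1 - d) / pi):]" "- (1 - d)"]
  unfolding two_temp_exp[abs_def] .

lemma bounded_two_temp: "bounded (range (two_temp d))"
proof -
  have "\<bar>two_temp d x\<bar> \<le> d * sqrt (d / pi) * 1 + (1 - d) * sqrt ((1 - d) / pi) * 1" for x
  proof -
    have "two_temp d x \<le> d * sqrt (d / pi) * 1 + (1 - d) * sqrt ((1 - d) / pi) * 1"
      unfolding two_temp_exp poly_pCons poly_0 using d
      by (intro add_mono mult_mono) (auto intro!: mult_nonneg_nonneg mult_nonpos_nonneg)
    then show ?thesis using two_temp_pos[OF d, of x] by linarith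
  qed
  then show ?thesis by (auto simp: bounded_iff)
qed

lemma two_temp_moment:
  assumes "has_bochner_integral lborel (\<lambda>x. normal_density 0 (half_energy_sd d) x * g x) A"
    and "has_bochner_integral lborel (\<lambda>x. normal_density 0 (half_energy_sd (1 - d)) x * g x) B"
  shows "has_bochner_integral lborel (\<lambda>x. two_temp d x * g x) (d * A + (1 - d) * B)"
  using has_bochner_integral_add[OF has_bochner_integral_mult_right[OF assms(1), of d] has_bochner_integral_mult_right[OF assms(2), of "1 - d"]]
  by (simp add: two_temp_def algebra_simps)

lemma sd_pos: "half_energy_sd d > 0" "half_energy_sd (1 - d) > 0"
  using d by (simp_all add: half_energy_sd_pos)

lemma two_temp_mean: "has_bochner_integral lborel (\<lambda>x. two_temp d x * x) 0"
  using two_temp_moment[OF normal_moment_odd[OF sd_pos(1), of 0 0, simplified] normal_moment_odd[OF sd_pos(2), of 0 0, simplified]]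
  by simp

lemma two_temp_energy: "has_bochner_integral lborel (\<lambda>x. two_temp d x * x\<^sup>2) 1"
proof -
  have "has_bochner_integral lborel (\<lambda>x. normal_density 0 (half_energy_sd a) x * x\<^sup>2) (1 / (2 * a))" if "a > 0" for a
  proof -
    have "(half_energy_sd a)\<^sup>2 = 1 / (2 * a)" using that by (simp add: half_energy_sd_def)
    then show ?thesis
      using normal_moment_even[OF half_energy_sd_pos[OF that], of 0 1] by (simp add: fact_2 numeral_2_eq_2)
  qed
  note variance = this
  have e: "d * (1 / (2 * d)) + (1 - d) * (1 / (2 * (1 - d))) = 1" using d by (simp add: divide_simps)
  have "0 < 1 - d" using d by simp
  from two_temp_moment[OF variance[OF d(1)] variance[OF this]] show ?thesis unfolding e .
qed

lemma two_temp_abs: "has_bochner_integral lborel (\<lambda>x. two_temp d x * \<bar>x\<bar>) (sqrt (2 / pi) * (sqrt (d / 2) + sqrt ((1 - d) / 2)))"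
proof -
  have s: "a * half_energy_sd a = sqrt (a / 2)" if "a > 0" for a
  proof -
    have "a / 2 = a\<^sup>2 * (1 / (2 * a))" using that by (simp add: power2_eq_square)
    then have "sqrt (a / 2) = sqrt (a\<^sup>2) * half_energy_sd a" unfolding half_energy_sd_def by (simp only: real_sqrt_mult)
    then show ?thesis using that by simp
  qed
  have "d * (half_energy_sd d * sqrt (2 / pi)) + (1 - d) * (half_energy_sd (1 - d) * sqrt (2 / pi)) =
      sqrt (2 / pi) * (d * half_energy_sd d + (1 - d) * half_energy_sd (1 - d))" by (simp add: algebra_simps)
  also have "\<dots> = sqrt (2 / pi) * (sqrt (d / 2) + sqrt ((1 - d) / 2))" using s[of d] s[of "1 - d"] d by simp
  finally show ?thesis
    using two_temp_moment[OF normal_moment_abs_odd[OF sd_pos(1), of 0 0, simplified] normal_moment_abs_odd[OF sd_pos(2), of 0 0, simplified]]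
    by simp
qed

lemma two_temp_moments: "integrable lborel (\<lambda>x. two_temp d x * \<bar>x\<bar> ^ k)"
proof -
  have "has_bochner_integral lborel (\<lambda>x. normal_density 0 s x * \<bar>x\<bar> ^ k) (\<integral>x. normal_density 0 s x * \<bar>x\<bar> ^ k \<partial>lborel)" if "s > 0" for s
    using integrable_normal_moment_abs[OF that, of 0 k] by (simp add: has_bochner_integral_iff)
  from two_temp_moment[OF this[OF sd_pos(1)] this[OF sd_pos(2)]] show ?thesis by (simp add: has_bochner_integral_iff)
qed

lemma prob_density_two_temp: "prob_density lborel (two_temp d)"
proof -
  interpret prob_space "density lborel (\<lambda>x. ennreal (two_temp d x))" by (rule prob_space_two_temp[OF d])
  have m[measurable]: "two_temp d \<in> borel_measurable borel" by (rule measurable_two_temp[OF d])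
  have "(\<integral>\<^sup>+x. ennreal (two_temp d x) \<partial>lborel) = 1"
    using emeasure_space_1 by (subst (asm) emeasure_density) auto
  then show ?thesis using two_temp_pos[OF d] by (auto simp: prob_density_def less_imp_le)
qed

lemma has_integral_two_temp_measure:
  assumes "has_bochner_integral lborel (\<lambda>x. two_temp d x * g x) A" "g \<in> borel_measurable borel"
  shows "has_bochner_integral (density lborel (\<lambda>x. ennreal (two_temp d x))) g A"
  using assms two_temp_pos[OF d] measurable_two_temp[OF d]
  by (intro has_bochner_integral_density) (auto simp: less_imp_le)

end

text \<open>
  With half of the energy in few hot particles the mean speed is close to \<open>sqrt (1 / 2)\<close> times that of
  the Gaussian, hence below 0.9 times it uniformly in small \<open>d\<close>.
\<close>
lemma small_hot_fraction_L1_moment: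
  assumes "0 < d" "d \<le> 1 / 100"
  shows "sqrt (2 / pi) * (sqrt (d / 2) + sqrt ((1 - d) / 2)) < 9 / 10 * sqrt (2 / pi)"
proof -
  have "sqrt (d / 2) \<le> sqrt ((1 / 10)\<^sup>2 * (1 / 2))" using assms by (intro real_sqrt_le_mono) (simp add: power2_eq_square)
  also have "\<dots> = 1 / 10 * sqrt (1 / 2)" unfolding real_sqrt_mult real_sqrt_abs by simp
  finally have "sqrt (d / 2) \<le> 1 / 10 * sqrt (1 / 2)" .
  moreover have "sqrt ((1 - d) / 2) \<le> sqrt (1 / 2)" using assms by (intro real_sqrt_le_mono) simp
  ultimately have "sqrt (d / 2) + sqrt ((1 - d) / 2) \<le> 11 / 10 * sqrt (1 / 2)"
    by linarith
  also have "sqrt (1 / 2) \<le> sqrt ((4 / 5)\<^sup>2 :: real)" by (intro real_sqrt_le_mono) (simp add: power2_eq_square)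
  finally have "sqrt (d / 2) + sqrt ((1 - d) / 2) \<le> 11 / 10 * (4 / 5)" by simp
  then have "sqrt (2 / pi) * (sqrt (d / 2) + sqrt ((1 - d) / 2)) \<le> sqrt (2 / pi) * (44 / 50)"
    by (intro mult_left_mono) simp_all
  also have "\<dots> < sqrt (2 / pi) * (9 / 10)" by (intro mult_strict_left_mono) simp_all
  finally show ?thesis by (simp add: mult.commute)
qed

section \<open>Bounded densities on the sphere\<close>

lemma bounded_density_regular:
  fixes F :: "(nat \<Rightarrow> real) \<Rightarrow> real"
  assumes N: "N \<ge> 1" and F[measurable]: "F \<in> borel_measurable (sphere_measure N)"
    and a: "0 < a" and Fb: "\<And>V. a \<le> F V \<and> F V \<le> b"
    and P: "prob_space (density (sphere_measure N) (\<lambda>V. ennreal (F V)))"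
  shows "prob_density (sphere_measure N) F" and "(\<integral>V. F V \<partial>sphere_measure N) = 1"
    and "sphere_entropy N F \<noteq> 0 \<Longrightarrow> entropy_ratio_defined N F"
proof -
  interpret S: prob_space "sphere_measure N" using N by (rule prob_space_sphere_measure)
  have Fpos: "F V > 0" for V using Fb[of V] a by linarith
  have bF: "bounded_measurable (sphere_measure N) F" using Fb by (intro bounded_measurableI[of _ _ a b]) auto
  have bl: "bounded_measurable (sphere_measure N) (\<lambda>V. ln (F V))" using Fb by (intro bounded_measurable_ln[of _ _ a b] a) auto
  have one: "(\<integral>\<^sup>+V. ennreal (F V) \<partial>sphere_measure N) = 1"
    using prob_space.emeasure_space_1[OF P] by (simp add: emeasure_density)
  show "prob_density (sphere_measure N) F" using one Fpos F by (simp add: prob_density_def less_imp_le)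
  have "(\<integral>\<^sup>+V. ennreal (F V) \<partial>sphere_measure N) = ennreal (\<integral>V. F V \<partial>sphere_measure N)"
    using Fpos by (intro nn_integral_eq_integral S.integrable_bounded_measurable bF) (simp add: less_imp_le)
  with one show "(\<integral>V. F V \<partial>sphere_measure N) = 1" by (simp add: ennreal_eq_1)
  assume "sphere_entropy N F \<noteq> 0"
  then show "entropy_ratio_defined N F"
    unfolding entropy_ratio_defined_def square_integrable_def power2_eq_square using Fpos F
    by (intro conjI S.integrable_bounded_measurable bounded_measurable_mult bF bl) simp_all
qed

lemma gauss_half_line: "measure (gauss 1) {0..} = 1 / 2"
proof -
  have i: "integrable lborel (\<lambda>x. indicator {0..} x *\<^sub>R normal_density 0 1 x)"
    using integrable_normal_density[of 1 0] by (intro integrable_mult_indicator) auto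
  define q where "q = (\<integral>x. indicator {0..} x *\<^sub>R normal_density 0 1 x \<partial>lborel)"
  have "has_bochner_integral lborel (\<lambda>x. indicator {0..} x *\<^sub>R normal_density 0 1 x) q"
    using i by (simp add: has_bochner_integral_iff q_def)
  then have "has_bochner_integral lborel (normal_density 0 1) (2 *\<^sub>R q)"
    by (rule has_bochner_integral_even_function) (simp add: normal_density_def)
  then have q: "q = 1 / 2" by (simp add: has_bochner_integral_iff)
  have "emeasure (gauss 1) {0..} = (\<integral>\<^sup>+x. ennreal (indicator {0..} x *\<^sub>R normal_density 0 1 x) \<partial>lborel)"
    by (subst emeasure_density) (auto intro!: nn_integral_cong simp: indicator_def)
  also have "\<dots> = ennreal q"
    unfolding q_def using i by (intro nn_integral_eq_integral) auto
  finally have "measure (gauss 1) {0..} = enn2real (ennreal q)" by (simp only: measure_def)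
  then show ?thesis using q by (simp only: enn2real_ennreal)
qed

text \<open>
  The density built from this set serves in the low dimensions, where the lower bound for the entropy says
  nothing: it is symmetric, bounded, and differs from 1 everywhere, so that its entropy is positive.
\<close>
definition orthant :: "nat \<Rightarrow> (nat \<Rightarrow> real) set" where
  "orthant N = {V \<in> kac_sphere N. \<forall>j<N. 0 \<le> V j}"

definition orthant_density :: "nat \<Rightarrow> (nat \<Rightarrow> real) \<Rightarrow> real" where
  "orthant_density N V = 1 / 2 + 2 ^ N / 2 * indicator (orthant N) V"

lemma orthant_sets[measurable]: "orthant N \<in> sets (sphere_space N)"
proof -
  have comp: "(\<lambda>V. V j) \<in> borel_measurable (sphere_space N)" if "j < N" for j
    unfolding sphere_space_def using that by (intro measurable_restrict_space1) simp
  have "{V \<in> space (sphere_space N). \<forall>j\<in>{..<N}. 0 \<le> V j} \<in> sets (sphere_space N)"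
    using comp by (intro sets.sets_Collect_finite_All borel_measurable_le) auto
  then show ?thesis unfolding orthant_def space_sphere_space Ball_def lessThan_iff .
qed

lemma measure_orthant:
  assumes N: "N \<ge> 1"
  shows "measure (sphere_measure N) (orthant N) = (1 / 2) ^ N"
proof -
  interpret G1: prob_space "gauss 1" by (simp add: prob_gauss)
  interpret P: product_prob_space "\<lambda>_::nat. gauss 1" "{..<N}"
    by (rule product_prob_spaceI) (simp add: prob_gauss)
  have "measure (sphere_measure N) (orthant N) = measure (gauss_pow 1 N) (sphere_proj N -` orthant N \<inter> space (gauss_pow 1 N))"
    by (subst sphere_measure_eq_gauss[of 1]) (use N in \<open>auto intro!: measure_distr\<close>)
  also have "\<dots> = measure (gauss_pow 1 N) (Pi\<^sub>E {..<N} (\<lambda>_. {0..}))"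
  proof (rule measure_eq_AE)
    show "AE x in gauss_pow 1 N. (x \<in> sphere_proj N -` orthant N \<inter> space (gauss_pow 1 N)) \<longleftrightarrow> x \<in> Pi\<^sub>E {..<N} (\<lambda>_. {0..})"
      using AE_gauss_pow_nonzero[OF zero_less_one N] AE_space
    proof eventually_elim
      case (elim x)
      have "L2_set x {..<N} > 0" using elim(1) by (simp add: less_le)
      then show ?case
        using elim N sphere_proj_in_sphere[of N x]
        by (auto simp: orthant_def sphere_proj_def radial_proj_def space_PiM PiE_iff zero_le_divide_iff zero_le_mult_iff)
    qed
    show "Pi\<^sub>E {..<N} (\<lambda>_. {0..}) \<in> sets (gauss_pow 1 N)" by (intro sets_PiM_I_finite) auto
  qed measurable
  also have "\<dots> = (1 / 2) ^ N"
  proof -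
    have "emeasure (gauss_pow 1 N) (Pi\<^sub>E {..<N} (\<lambda>_. {0..})) = (\<Prod>j<N. emeasure (gauss 1) {0..})"
      by (rule P.emeasure_PiM) auto
    also have "\<dots> = ennreal ((1 / 2) ^ N)"
      by (simp add: G1.emeasure_eq_measure gauss_half_line ennreal_power del: ennreal_half)
    finally show ?thesis by (simp only: measure_def enn2real_ennreal zero_le_power zero_le_divide_1_iff zero_le_numeral)
  qed
  finally show ?thesis .
qed

lemma orthant_density_bounds: "1 / 2 \<le> orthant_density N V \<and> orthant_density N V \<le> 1 / 2 + 2 ^ N / 2"
  by (simp add: orthant_density_def indicator_def)

lemma measurable_orthant_density: "orthant_density N \<in> borel_measurable (sphere_measure N)"
  unfolding orthant_density_def[abs_def] by measurable

lemma prob_space_orthant_density: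
  assumes N: "N \<ge> 1"
  shows "prob_space (density (sphere_measure N) (\<lambda>V. ennreal (orthant_density N V)))"
proof
  interpret S: prob_space "sphere_measure N" using N by (rule prob_space_sphere_measure)
  note [measurable] = measurable_orthant_density
  have A[measurable]: "orthant N \<in> sets (sphere_measure N)" by (simp add: sets_sphere_measure)
  have pos: "0 \<le> orthant_density N V" for V using orthant_density_bounds[of N V] by linarith
  have "integrable (sphere_measure N) (orthant_density N)"
    using orthant_density_bounds[of N]
    by (intro S.integrable_bounded_measurable bounded_measurableI[of _ _ "1 / 2" "1 / 2 + 2 ^ N / 2"]) auto
  then have "(\<integral>\<^sup>+V. ennreal (orthant_density N V) \<partial>sphere_measure N) = ennreal (\<integral>V. orthant_density N V \<partial>sphere_measure N)"
    using pos by (intro nn_integral_eq_integral) auto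
  also have "(\<integral>V. orthant_density N V \<partial>sphere_measure N) = 1 / 2 + 2 ^ N / 2 * measure (sphere_measure N) (orthant N)"
    unfolding orthant_density_def using A S.prob_space
    by (subst Bochner_Integration.integral_add) (auto simp: integrable_real_indicator less_top[symmetric])
  also have "\<dots> = 1" using measure_orthant[OF N] by (simp add: power_divide)
  finally show "emeasure (density (sphere_measure N) (\<lambda>V. ennreal (orthant_density N V)))
      (space (density (sphere_measure N) (\<lambda>V. ennreal (orthant_density N V)))) = 1"
    by (simp add: emeasure_density)
qed

lemma orthant_density_entropy:
  assumes N: "N \<ge> 1"
  shows "sphere_entropy N (orthant_density N) > 0"
  unfolding sphere_entropy_def
proof (rule entropy_pos)
  show "prob_space (sphere_measure N)" by (rule prob_space_sphere_measure[OF N])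
  show "(\<integral>V. orthant_density N V \<partial>sphere_measure N) = 1"
    by (rule bounded_density_regular(2)[OF N measurable_orthant_density _ orthant_density_bounds prob_space_orthant_density[OF N]]) simp
  have "(2::real) ^ N > 1" using N by (intro one_less_power) auto
  then show "orthant_density N V \<noteq> 1" for V by (auto simp: orthant_density_def indicator_def)
  show "(0::real) < 1 / 2" by simp
qed (rule measurable_orthant_density orthant_density_bounds)+

lemma orthant_density_permute:
  assumes p: "p permutes {..<N}" and V: "V \<in> kac_sphere N"
  shows "orthant_density N (V \<circ> p) = orthant_density N V"
proof -
  have "V \<circ> p \<in> extensional {..<N}"
    using V permutes_not_in[OF p] by (auto simp: kac_sphere_def extensional_def)
  moreover have "(\<Sum>n<N. (V (p n))\<^sup>2) = (\<Sum>n<N. (V n)\<^sup>2)"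
    using sum.permute[OF p, of "\<lambda>n. (V n)\<^sup>2"] by (simp add: o_def)
  ultimately have "V \<circ> p \<in> kac_sphere N" using V by (simp add: kac_sphere_def L2_set_def)
  moreover have "(\<forall>j<N. 0 \<le> (V \<circ> p) j) \<longleftrightarrow> (\<forall>j<N. 0 \<le> V j)"
  proof -
    have "(\<forall>j\<in>p ` {..<N}. 0 \<le> V j) \<longleftrightarrow> (\<forall>j\<in>{..<N}. 0 \<le> (V \<circ> p) j)" by simp
    then show ?thesis unfolding permutes_image[OF p] by auto
  qed
  ultimately have "V \<circ> p \<in> orthant N \<longleftrightarrow> V \<in> orthant N" using V by (simp only: orthant_def mem_Collect_eq simp_thms)
  then show ?thesis by (simp add: orthant_density_def indicator_def)
qed

lemma sphere_measure_symmetric: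
  assumes N: "N \<ge> 1" and p: "p permutes {..<N}"
  shows "distr (sphere_measure N) (sphere_space N) (\<lambda>V. V \<circ> p) = sphere_measure N"
  using projected_iid_symmetric[of "gauss 1", OF prob_gauss _ p] sphere_measure_eq_gauss[of 1 N] N by simp

lemma orthant_density_symmetric:
  assumes N: "N \<ge> 1" and p: "p permutes {..<N}"
  defines "M \<equiv> density (sphere_measure N) (\<lambda>V. ennreal (orthant_density N V))"
  shows "distr M M (\<lambda>V. V \<circ> p) = M"
proof (rule measure_eqI)
  note [measurable] = measurable_orthant_density
  have sS: "sets (sphere_measure N) = sets (sphere_space N)" by (rule sets_sphere_measure)
  have sM: "sets M = sets (sphere_space N)" by (simp add: M_def sS)
  have perm: "(\<lambda>V. V \<circ> p) \<in> sphere_space N \<rightarrow>\<^sub>M sphere_space N"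
    by (rule measurable_permute_sphere[OF p])
  have permM: "(\<lambda>V. V \<circ> p) \<in> M \<rightarrow>\<^sub>M M" and permS: "(\<lambda>V. V \<circ> p) \<in> sphere_measure N \<rightarrow>\<^sub>M sphere_space N"
    using perm by (simp_all add: measurable_cong_sets[OF sM sM] measurable_cong_sets[OF sS refl])
  fix A assume "A \<in> sets (distr M M (\<lambda>V. V \<circ> p))"
  then have A: "A \<in> sets M" and A'[measurable]: "A \<in> sets (sphere_space N)" by (simp_all add: sM)
  have od: "orthant_density N \<in> borel_measurable (sphere_space N)"
    using measurable_orthant_density by (simp add: measurable_cong_sets[OF sS refl])
  have "emeasure (distr M M (\<lambda>V. V \<circ> p)) A = emeasure M ((\<lambda>V. V \<circ> p) -` A \<inter> space M)"
    by (rule emeasure_distr[OF permM A])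
  also have "\<dots> = (\<integral>\<^sup>+V. ennreal (orthant_density N V) * indicator ((\<lambda>V. V \<circ> p) -` A \<inter> space M) V \<partial>sphere_measure N)"
    unfolding M_def using measurable_sets[OF permM A] sM sS by (intro emeasure_density) (auto simp: M_def)
  also have "\<dots> = (\<integral>\<^sup>+V. ennreal (orthant_density N (V \<circ> p)) * indicator A (V \<circ> p) \<partial>sphere_measure N)"
    by (intro nn_integral_cong)
       (auto simp: space_sphere_measure M_def orthant_density_permute[OF p] indicator_def)
  also have "\<dots> = (\<integral>\<^sup>+V. ennreal (orthant_density N V) * indicator A V \<partial>distr (sphere_measure N) (sphere_space N) (\<lambda>V. V \<circ> p))"
    using od by (intro nn_integral_distr[OF permS, symmetric]) measurable
  also have "\<dots> = emeasure M A"
    unfolding sphere_measure_symmetric[OF N p] M_def by (intro emeasure_density[symmetric]) (simp_all add: sS)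
  finally show "emeasure (distr M M (\<lambda>V. V \<circ> p)) A = emeasure M A" .
qed simp

section \<open>The ratio of entropy production to entropy\<close>

lemma small_fraction_exists:
  assumes "\<epsilon> > 0"
  shows "\<exists>d>0. d \<le> 1 / 100 \<and> 16 * d * ln (1 / d) \<le> (\<epsilon>::real)"
proof -
  have "((\<lambda>d::real. 16 * d * ln (1 / d)) \<longlongrightarrow> 0) (at_right 0)" by real_asymp
  then have "\<forall>\<^sub>F d in at_right 0. 16 * d * ln (1 / d) < \<epsilon>"
    using assms by (rule order_tendstoD)
  moreover have "\<forall>\<^sub>F d::real in at_right 0. d < 1 / 100" by (intro eventually_at_right_less[THEN eventually_mono] order_tendstoD tendsto_intros) auto
  moreover have "\<forall>\<^sub>F d::real in at_right 0. 0 < d" by (rule eventually_at_right_less)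
  ultimately have "\<forall>\<^sub>F d::real in at_right 0. 0 < d \<and> d \<le> 1 / 100 \<and> 16 * d * ln (1 / d) \<le> \<epsilon>"
    by eventually_elim auto
  then show ?thesis by (metis (no_types, lifting) eventually_happens trivial_limit_at_right_real)
qed

theorem theorem3:
  fixes c :: real
  assumes "c > 0"
  shows "\<exists>(f :: real \<Rightarrow> real) (F :: nat \<Rightarrow> (nat \<Rightarrow> real) \<Rightarrow> real).
    prob_density lborel f \<and>
    has_bochner_integral lborel (\<lambda>v. v * f v) 0 \<and>
    has_bochner_integral lborel (\<lambda>v. v\<^sup>2 * f v) 1 \<and>
    (\<forall>N\<ge>1. prob_density (sphere_measure N) (F N)) \<and>
    chaotic (density lborel f) (\<lambda>N. density (sphere_measure N) (F N)) \<and>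
    (\<forall>N\<ge>2. entropy_ratio_defined N (F N)) \<and>
    limsup (\<lambda>N. ereal (- sphere_inner N (\<lambda>V. ln (F N V)) (kac_L N (F N))
                        / sphere_entropy N (F N))) \<le> ereal c \<and>
    smooth_real f \<and>
    bounded (range f) \<and>
    (\<forall>k::nat. integrable lborel (\<lambda>v. \<bar>v\<bar> ^ k * f v))"
proof -
  define t where "t = 9 / 10 * sqrt (2 / pi)"
  have t: "0 < t" "t < sqrt (2 / pi)" by (simp_all add: t_def)
  obtain \<eta> where \<eta>: "\<eta> > 0" and rare: "\<And>N. N \<ge> 1 \<Longrightarrow> measure (sphere_measure N) (low_l1 t N) \<le> exp (- (\<eta> * real N))"
    using sphere_low_l1_exponentially_small[OF t] by blast
  \<comment> \<open>The rate \<open>\<eta>\<close> of the entropy bound is fixed before the hot fraction \<open>d\<close> is chosen.\<close>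
  obtain d where d0: "0 < d" "d \<le> 1 / 100" and d\<epsilon>: "16 * d * ln (1 / d) \<le> c * \<eta>"
    using small_fraction_exists[of "c * \<eta>"] \<eta> assms by auto
  have d: "0 < d" "d < 1 / 2" using d0 by auto
  define f where "f = two_temp d"
  define \<mu> where "\<mu> = density lborel (\<lambda>x. ennreal (f x))"
  have prob_mu: "prob_space \<mu>" and sets_mu: "sets \<mu> = sets borel"
    unfolding \<mu>_def f_def by (auto intro: prob_space_two_temp[OF d])
  define m where "m = sqrt (2 / pi) * (sqrt (d / 2) + sqrt ((1 - d) / 2))"
  have m2: "has_bochner_integral \<mu> (\<lambda>z. z\<^sup>2) 1"
    unfolding \<mu>_def f_def by (rule has_integral_two_temp_measure[OF d two_temp_energy[OF d]]) simp
  have m1: "has_bochner_integral \<mu> (\<lambda>z. \<bar>z\<bar>) m"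
    unfolding \<mu>_def f_def m_def by (rule has_integral_two_temp_measure[OF d two_temp_abs[OF d]]) simp
  have m4: "integrable \<mu> (\<lambda>z. z ^ 4)"
  proof -
    have "has_bochner_integral lborel (\<lambda>x. two_temp d x * x ^ 4) (\<integral>x. two_temp d x * x ^ 4 \<partial>lborel)"
      using two_temp_moments[OF d, of 4] by (simp add: has_bochner_integral_iff power_even_abs)
    then have "has_bochner_integral \<mu> (\<lambda>z. z ^ 4) (\<integral>x. two_temp d x * x ^ 4 \<partial>lborel)"
      unfolding \<mu>_def f_def by (rule has_integral_two_temp_measure[OF d]) simp
    then show ?thesis by (simp add: has_bochner_integral_iff)
  qed
  have mt: "m < t" unfolding m_def t_def by (rule small_hot_fraction_L1_moment[OF d0])
  define Q where "Q N = distr (PiM UNIV (\<lambda>_. \<mu>)) (sphere_space N) (sphere_proj N)" for N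
  have Q: "distr (two_temp_pow d N) (sphere_space N) (sphere_proj N) = Q N" for N
    unfolding Q_def using projected_iid[OF prob_mu sets_mu, of N] by (simp add: \<mu>_def f_def)
  have "\<forall>N. \<exists>F. N \<ge> 1 \<longrightarrow> F \<in> borel_measurable (sphere_measure N) \<and> (\<forall>V. d ^ N \<le> F V \<and> F V \<le> (1 / sqrt d) ^ N) \<and>
      distr (two_temp_pow d N) (sphere_space N) (sphere_proj N) = density (sphere_measure N) (\<lambda>V. ennreal (F V))"
    using projected_density_exists[OF d] by blast
  then obtain G where Gm: "\<And>N. N \<ge> 1 \<Longrightarrow> G N \<in> borel_measurable (sphere_measure N)"
    and Gb: "\<And>N V. N \<ge> 1 \<Longrightarrow> d ^ N \<le> G N V \<and> G N V \<le> (1 / sqrt d) ^ N"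
    and GD: "\<And>N. N \<ge> 1 \<Longrightarrow> distr (two_temp_pow d N) (sphere_space N) (sphere_proj N) = density (sphere_measure N) (\<lambda>V. ennreal (G N V))"
    by metis
  have dN: "0 < d ^ N" for N using d by simp
  have GQ: "density (sphere_measure N) (\<lambda>V. ennreal (G N V)) = Q N" if "N \<ge> 1" for N
    using GD[OF that] Q by simp
  have prob_Q: "prob_space (Q N)" for N
    unfolding Q_def using measurable_sphere_proj_iid[OF prob_mu sets_mu] prob_iid_seq[OF prob_mu sets_mu]
    by (intro prob_space.prob_space_distr)
  have Gprob: "prob_space (density (sphere_measure N) (\<lambda>V. ennreal (G N V)))" if "N \<ge> 1" for N
    using GQ[OF that] prob_Q by simp
  note Greg = bounded_density_regular[OF _ Gm dN Gb Gprob]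
  have p: "(\<lambda>N. measure (Q N) (low_l1 t N)) \<longlonglongrightarrow> 1"
    unfolding Q_def by (rule projected_iid_low_l1[OF prob_mu sets_mu m2 m1 m4 mt])
  have Gent: "\<eta> * real N * measure (Q N) (low_l1 t N) - 1 \<le> sphere_entropy N (G N)" if N: "N \<ge> 1" for N
    unfolding sphere_entropy_def GQ[OF N, symmetric]
    using N rare[OF N] Greg(2)[OF N N N N] Gb[OF N]
    by (intro entropy_ge_of_event[OF prob_space_sphere_measure Gm dN]) (auto simp: sets_sphere_measure)
  have "\<forall>\<^sub>F N in sequentially. 3 / 4 < measure (Q N) (low_l1 t N)"
    using p by (rule order_tendstoD) simp
  moreover have "\<forall>\<^sub>F N in sequentially. 4 / \<eta> \<le> real N"
    by (rule eventually_compose_filterlim[OF eventually_ge_at_top filterlim_real_sequentially])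
  ultimately have "\<forall>\<^sub>F N in sequentially. \<eta> * real N / 2 \<le> sphere_entropy N (G N)"
    using eventually_ge_at_top[of "1::nat"]
  proof eventually_elim
    case (elim N)
    have "4 \<le> \<eta> * real N" using elim(2) \<eta> by (simp add: field_simps)
    moreover have "\<eta> * real N * (3 / 4) \<le> \<eta> * real N * measure (Q N) (low_l1 t N)"
      using elim(1) \<eta> by (intro mult_left_mono) auto
    ultimately show ?case using Gent[OF elim(3)] by linarith
  qed
  then obtain N1 where N1: "\<And>N. N \<ge> N1 \<Longrightarrow> \<eta> * real N / 2 \<le> sphere_entropy N (G N)"
    by (auto simp: eventually_sequentially)
  define N0 where "N0 = max N1 2"
  \<comment> \<open>The entropy is only bounded from below for large \<open>N\<close>; the finitely many other densities are replaced.\<close>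
  define F where "F N = (if N < N0 then orthant_density N else G N)" for N
  have small: "F N = orthant_density N" if "N < N0" for N using that by (simp add: F_def)
  have large: "F N = G N" "N \<ge> 2" "N \<ge> 1" "sphere_entropy N (G N) \<ge> \<eta> * real N / 2" "\<eta> * real N / 2 > 0" if "N0 \<le> N" for N
    using that N1[of N] \<eta> by (auto simp: F_def N0_def)
  note Oreg = bounded_density_regular[OF _ measurable_orthant_density _ orthant_density_bounds prob_space_orthant_density]
  have FQ: "density (sphere_measure N) (\<lambda>V. ennreal (F N V)) = Q N" if "N0 \<le> N" for N
    using GQ[OF large(3)[OF that]] large(1)[OF that] by simp
  have dens: "prob_density (sphere_measure N) (F N)" if N: "N \<ge> 1" for N
  proof (cases "N < N0")
    case True
    then show ?thesis using Oreg(1)[OF N _ N] by (simp add: small)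
  next
    case False
    then show ?thesis using Greg(1)[OF N N N N] large(1)[of N] by simp
  qed
  have def: "entropy_ratio_defined N (F N)" if N: "N \<ge> 2" for N
  proof (cases "N < N0")
    case True
    have "N \<ge> 1" using N by simp
    then show ?thesis using Oreg(3)[of N] orthant_density_entropy[of N] True by (simp add: small)
  next
    case False
    then have N0: "N0 \<le> N" by simp
    have "sphere_entropy N (G N) \<noteq> 0" using large(4,5)[OF N0] by linarith
    then show ?thesis using Greg(3)[of N] large(1,3)[OF N0] by simp
  qed
  have chaos: "chaotic \<mu> (\<lambda>N. density (sphere_measure N) (\<lambda>V. ennreal (F N V)))"
    unfolding chaotic_def
  proof (intro conjI allI impI)
    show "prob_space \<mu>" "sets \<mu> = sets borel" by (rule prob_mu) (rule sets_mu)
    fix N :: nat assume N: "N \<ge> 1"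
    show "prob_space (density (sphere_measure N) (\<lambda>V. ennreal (F N V)))"
      using prob_space_orthant_density[OF N] Gprob[OF N] by (simp add: F_def)
    show "sets (density (sphere_measure N) (\<lambda>V. ennreal (F N V))) = sets (restrict_space (Pi\<^sub>M {..<N} (\<lambda>_. borel)) (kac_sphere N))"
      by (simp add: sets_sphere_measure sphere_space_def)
    fix p assume p: "p permutes {..<N}"
    let ?M = "density (sphere_measure N) (\<lambda>V. ennreal (F N V))"
    show "distr ?M ?M (\<lambda>V. V \<circ> p) = ?M"
    proof (cases "N < N0")
      case True
      then show ?thesis using orthant_density_symmetric[OF N p] by (simp add: small)
    next
      case False
      then have M: "?M = Q N" by (simp add: FQ)
      have "distr (Q N) (Q N) (\<lambda>V. V \<circ> p) = distr (Q N) (sphere_space N) (\<lambda>V. V \<circ> p)"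
        by (rule distr_cong) (simp_all add: Q_def)
      also have "\<dots> = Q N"
        using projected_iid_symmetric[OF prob_mu sets_mu p] unfolding projected_iid[OF prob_mu sets_mu] Q_def .
      finally show ?thesis unfolding M .
    qed
  next
    fix k :: nat and \<phi> :: "(nat \<Rightarrow> real) \<Rightarrow> real"
    assume "continuous_on (extensional {..<k}) \<phi> \<and> bounded (\<phi> ` extensional {..<k})"
    then have "(\<lambda>N. \<integral>x. \<phi> x \<partial>marginal k (Q N)) \<longlonglongrightarrow> (\<integral>x. \<phi> x \<partial>Pi\<^sub>M {..<k} (\<lambda>_. \<mu>))"
      unfolding Q_def using projected_iid_chaos[OF prob_mu sets_mu m2 m1 m4] by blast
    moreover have "\<forall>\<^sub>F N in sequentially. (\<integral>x. \<phi> x \<partial>marginal k (Q N)) =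
        (\<integral>x. \<phi> x \<partial>marginal k (density (sphere_measure N) (\<lambda>V. ennreal (F N V))))"
      using eventually_ge_at_top[of N0] by eventually_elim (simp add: FQ)
    ultimately show "(\<lambda>N. \<integral>x. \<phi> x \<partial>marginal k (density (sphere_measure N) (\<lambda>V. ennreal (F N V))))
        \<longlonglongrightarrow> (\<integral>x. \<phi> x \<partial>Pi\<^sub>M {..<k} (\<lambda>_. \<mu>))"
      by (rule Lim_transform_eventually)
  qed
  have ratio: "- sphere_inner N (\<lambda>V. ln (F N V)) (kac_L N (F N)) / sphere_entropy N (F N) \<le> c" if N: "N0 \<le> N" for N
  proof -
    note l = large[OF N]
    have "- sphere_inner N (\<lambda>V. ln (G N V)) (kac_L N (G N)) \<le> real N * (8 * d * ln (1 / d))"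
      by (rule kac_entropy_production_le[OF l(2) Gm[OF l(3)] dN Gb[OF l(3)]])
         (rule projected_dissipation_bound[OF d _ _ Gm[OF l(3)] Gb[OF l(3)] GD[OF l(3)]])
    also have "\<dots> \<le> c * (\<eta> * real N / 2)"
      using mult_left_mono[OF d\<epsilon>, of "real N / 2"] by (simp add: algebra_simps)
    also have "\<dots> \<le> c * sphere_entropy N (G N)" using l(4) assms by (intro mult_left_mono) auto
    finally have "- sphere_inner N (\<lambda>V. ln (G N V)) (kac_L N (G N)) \<le> c * sphere_entropy N (G N)" .
    moreover have "sphere_entropy N (G N) > 0" using l(4,5) by linarith
    ultimately show ?thesis unfolding l(1) by (simp only: pos_divide_le_eq)
  qed
  have lim: "limsup (\<lambda>N. ereal (- sphere_inner N (\<lambda>V. ln (F N V)) (kac_L N (F N)) / sphere_entropy N (F N))) \<le> ereal c"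
    using ratio by (intro Limsup_bounded eventually_sequentiallyI[of N0]) simp
  have mean: "has_bochner_integral lborel (\<lambda>v. v * f v) 0" and energy: "has_bochner_integral lborel (\<lambda>v. v\<^sup>2 * f v) 1"
    using two_temp_mean[OF d] two_temp_energy[OF d] by (simp_all add: f_def mult.commute)
  have moments: "integrable lborel (\<lambda>v. \<bar>v\<bar> ^ k * f v)" for k
    using two_temp_moments[OF d, of k] by (simp add: f_def mult.commute)
  show ?thesis
    using prob_density_two_temp[OF d] mean energy dens chaos def lim smooth_two_temp[OF d] bounded_two_temp[OF d] moments
    unfolding \<mu>_def f_def[symmetric] by (intro exI[of _ f] exI[of _ F]) blast
qed

end
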